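(* Suppose that for every $\tau\in\mathcal{T}$ there is a vector function $\widetilde\rho_\tau$ such that, as $\Delta\to0$, $$\int\big(\sqrt{g_{\tau,\Delta}}-1-\Delta^t\widetilde\rho_\tau/2\big)^2\,dG_\tau=o(\|\Delta\|^2),\qquad \int g_{\tau,\Delta}\,dG_\tau=1+o(\|\Delta\|^2),$$ that $E_\tau u^2(X,\theta)$ is locally bounded in $\tau$, and that the matrices $I_\tau$ are of full rank for all $\tau\in\mathcal{T}$. Let $$\phi_{*,\tau}\equiv\overline u_\tau-\mu_\tau+\rho_\tau^tI_\tau^{-1}\gamma_\tau,\qquad \gamma_\tau\equiv E_\tau\operatorname{Cov}_\tau\big(u(X,\theta),\widetilde\rho_\tau(\theta)\,|\,X\big)=E_\tau\{u(X,\theta)\widetilde\rho_\tau(\theta)-\overline u_\tau(X)\rho_\tau(X)\}.$$ Then, for every $\tau\in\mathcal{T}$, a sequence of estimators $\{\widehat S_n,n\ge1\}$ is an asymptotically efficient estimator at $P_\tau$ of $S_n=\sum_{j=1}^nu(X_j,\theta_j)$ if and only if $$\frac{\widehat S_n}{n}=\mu_\tau+\frac1n\sum_{j=1}^n\phi_{*,\tau}(X_j)+o_{P_\tau}(n^{-1/2}).$$ That is, $\phi_{*,\tau}$ is the efficient influence function for the estimation of $S_n$.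
   Context: $\{G_\tau,\tau\in\mathcal{T}\}$ is a parametric family of distributions with $\mathcal{T}$ an open subset of a Euclidean space. Under $P_\tau$ (with expectation $E_\tau$), $(X,\theta),(X_1,\theta_1),(X_2,\theta_2),\dots$ are i.i.d. with $\theta\sim G_\tau$ and, given $\theta$, $X$ has density $f(x|\theta)$ with respect to a measure $\nu$, where $f(\cdot|\cdot)$ is known; so $(X,\theta)\sim f(x|\vartheta)\nu(dx)G_\tau(d\vartheta)$. The $X_j$ are observed, the $\theta_j$ and $\tau$ are not; estimators $\widehat S_n$ are functions of $X_1,\dots,X_n$. The utility $u(x,\vartheta)$ is a known Borel function. $g_{\tau,\Delta}$ is the Radon–Nikodym derivative of the absolutely continuous part of $G_{\tau+\Delta}$ with respect to $G_\tau$. Define $\rho_\tau(x)\equiv E_\tau[\widetilde\rho_\tau(\theta)|X=x]$, $I_\tau\equiv\operatorname{Cov}_\tau(\rho_\tau(X))$ (Fisher information matrix based on a single $X$), $\overline u_\tau(x)\equiv E_\tau[u(X,\theta)|X=x]$, $\mu_\tau\equiv E_\tau u(X,\theta)$. Regularity and efficiency: an estimator $\widetilde S_n$ of $S_n$ is (locally asymptotically) regular at $P_\tau$ if there is a random variable $\xi_0$ such that for every fixed vector $a$, the law of $n^{-1/2}(\widetilde S_n-S_n)$ under $P_{\tau+a/\sqrt n}$ converges weakly, as $n\to\infty$, to the law of $\xi_0$ (the same for all $a$). It is asymptotically efficient at $P_\tau$ (in contiguous neighborhoods) if it is regular at $P_\tau$ and the second moment $E\xi_0^2$ of its limit equals the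 sharp lower bound for the variance of the limits $\xi_0$ of all estimators regular at $P_\tau$. *)

theory Defs
  imports "HOL-Probability.Probability" "HOL-Library.Landau_Symbols"
begin

section \<open>The model\<close>

text \<open>
  The law of one pair \<open>(X, \<theta>)\<close>, that is \<open>f(x|\<vartheta>) \<nu>(dx) G(d\<vartheta>)\<close>, where \<open>f x t\<close> stands for
  \<open>f(x|t)\<close>. All observations and all parameters live in arbitrary measurable spaces: the
  \<open>\<sigma>\<close>-algebra for \<open>X\<close> is that of \<open>\<nu>\<close>.
\<close>

definition joint_law :: "'x measure \<Rightarrow> ('x \<Rightarrow> 't \<Rightarrow> real) \<Rightarrow> 't measure \<Rightarrow> ('x \<times> 't) measure" where
  "joint_law \<nu> f G = density (\<nu> \<Otimes>\<^sub>M G) (\<lambda>(x, t). ennreal (f x t))"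

definition mixture_model ::
  "'x measure \<Rightarrow> ('x \<Rightarrow> 't \<Rightarrow> real) \<Rightarrow> 't measure \<Rightarrow> 'p set \<Rightarrow> ('p \<Rightarrow> 't measure) \<Rightarrow> bool" where
  "mixture_model \<nu> f \<Theta> T G \<longleftrightarrow>
     sigma_finite_measure \<nu> \<and>
     (\<forall>\<tau>\<in>T. prob_space (G \<tau>) \<and> sets (G \<tau>) = sets \<Theta>) \<and>
     (\<lambda>(x, t). f x t) \<in> borel_measurable (\<nu> \<Otimes>\<^sub>M \<Theta>) \<and>
     (\<forall>x\<in>space \<nu>. \<forall>t\<in>space \<Theta>. 0 \<le> f x t) \<and>
     (\<forall>t\<in>space \<Theta>. (\<integral>\<^sup>+ x. ennreal (f x t) \<partial>\<nu>) = 1)"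

text \<open>
  The i.i.d. sequence \<open>(X\<^sub>1, \<theta>\<^sub>1), (X\<^sub>2, \<theta>\<^sub>2), \<dots>\<close> is realised by the coordinates of the infinite
  product space, with indices shifted to start at \<open>0\<close>: the first \<open>n\<close> pairs are \<open>\<omega> 0, \<dots>, \<omega> (n - 1)\<close>.
\<close>

definition iid_law :: "'z measure \<Rightarrow> (nat \<Rightarrow> 'z) measure" where
  "iid_law Q = (\<Pi>\<^sub>M i\<in>UNIV. Q)"

definition observed :: "nat \<Rightarrow> (nat \<Rightarrow> 'x \<times> 't) \<Rightarrow> nat \<Rightarrow> 'x" where
  "observed n \<omega> = (\<lambda>i\<in>{..<n}. fst (\<omega> i))"

definition estimator :: "'x measure \<Rightarrow> (nat \<Rightarrow> (nat \<Rightarrow> 'x) \<Rightarrow> real) \<Rightarrow> bool" where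
  "estimator \<nu> S \<longleftrightarrow> (\<forall>n. S n \<in> borel_measurable (\<Pi>\<^sub>M i\<in>{..<n}. \<nu>))"

definition util_sum :: "('x \<Rightarrow> 't \<Rightarrow> real) \<Rightarrow> nat \<Rightarrow> (nat \<Rightarrow> 'x \<times> 't) \<Rightarrow> real" where
  "util_sum u n \<omega> = (\<Sum>j<n. u (fst (\<omega> j)) (snd (\<omega> j)))"


section \<open>Lebesgue decomposition\<close>

definition mutually_singular :: "'t measure \<Rightarrow> 't measure \<Rightarrow> bool" where
  "mutually_singular M L \<longleftrightarrow>
     sets L = sets M \<and> (\<exists>A\<in>sets M. emeasure M A = 0 \<and> emeasure L (space M - A) = 0)"

definition ac_part :: "'t measure \<Rightarrow> 't measure \<Rightarrow> 't measure" where
  "ac_part M N = (SOME K. sets K = sets M \<and> absolutely_continuous M K \<and>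
     (\<exists>L. mutually_singular M L \<and> (\<forall>A\<in>sets M. emeasure N A = emeasure K A + emeasure L A)))"

definition ac_deriv :: "('p::plus \<Rightarrow> 't measure) \<Rightarrow> 'p \<Rightarrow> 'p \<Rightarrow> 't \<Rightarrow> real" where
  "ac_deriv G \<tau> \<Delta> t = enn2real (RN_deriv (G \<tau>) (ac_part (G \<tau>) (G (\<tau> + \<Delta>))) t)"


section \<open>Score condition\<close>

text \<open>
  Integrability is required explicitly because the Bochner integral of a non-integrable function
  is \<open>0\<close>. The function \<open>ac_deriv G \<tau> \<Delta>\<close> is always integrable for small \<open>\<Delta>\<close>, its integral being at
  most \<open>1\<close>.
\<close>

definition score_at ::
  "'t measure \<Rightarrow> (real^'k \<Rightarrow> 't measure) \<Rightarrow> real^'k \<Rightarrow> ('t \<Rightarrow> real^'k) \<Rightarrow> bool" where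
  "score_at \<Theta> G \<tau> s \<longleftrightarrow>
     s \<in> borel_measurable \<Theta> \<and>
     (\<forall>\<^sub>F \<Delta> in at 0. integrable (G \<tau>) (\<lambda>t. (sqrt (ac_deriv G \<tau> \<Delta> t) - 1 - (\<Delta> \<bullet> s t) / 2)\<^sup>2)) \<and>
     (\<lambda>\<Delta>. \<integral>t. (sqrt (ac_deriv G \<tau> \<Delta> t) - 1 - (\<Delta> \<bullet> s t) / 2)\<^sup>2 \<partial>G \<tau>) \<in> o[at 0](\<lambda>\<Delta>. (norm \<Delta>)\<^sup>2) \<and>
     (\<lambda>\<Delta>. (\<integral>t. ac_deriv G \<tau> \<Delta> t \<partial>G \<tau>) - 1) \<in> o[at 0](\<lambda>\<Delta>. (norm \<Delta>)\<^sup>2)"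


section \<open>Conditional moments given the observation\<close>

text \<open>
  \<open>cond_exp_X \<nu> Q Z x\<close> is \<open>E[Z(X,\<theta>) | X = x]\<close> for \<open>(X, \<theta>) \<sim> Q\<close>: a version, as a measurable function
  of \<open>x\<close>, of the conditional expectation given the \<open>\<sigma>\<close>-algebra generated by \<open>X\<close>. It is determined
  up to null sets of the law of \<open>X\<close>.
\<close>

definition cond_exp_X :: "'x measure \<Rightarrow> ('x \<times> 't) measure \<Rightarrow> ('x \<times> 't \<Rightarrow> real) \<Rightarrow> 'x \<Rightarrow> real" where
  "cond_exp_X \<nu> Q Z = (SOME h. h \<in> borel_measurable \<nu> \<and>
     (AE z in Q. real_cond_exp Q (vimage_algebra (space Q) fst \<nu>) Z z = h (fst z)))"

definition cond_cov_X ::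
  "'x measure \<Rightarrow> ('x \<times> 't) measure \<Rightarrow> ('x \<times> 't \<Rightarrow> real) \<Rightarrow> ('x \<times> 't \<Rightarrow> real) \<Rightarrow> 'x \<Rightarrow> real" where
  "cond_cov_X \<nu> Q Z W =
     cond_exp_X \<nu> Q (\<lambda>z. (Z z - cond_exp_X \<nu> Q Z (fst z)) * (W z - cond_exp_X \<nu> Q W (fst z)))"

definition covariance :: "'z measure \<Rightarrow> ('z \<Rightarrow> real) \<Rightarrow> ('z \<Rightarrow> real) \<Rightarrow> real" where
  "covariance Q Z W = (\<integral>z. (Z z - (\<integral>y. Z y \<partial>Q)) * (W z - (\<integral>y. W y \<partial>Q)) \<partial>Q)"

definition score_X ::
  "'x measure \<Rightarrow> ('x \<times> 't) measure \<Rightarrow> ('t \<Rightarrow> real^'k) \<Rightarrow> 'x \<Rightarrow> real^'k" where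
  "score_X \<nu> Q s x = (\<chi> i. cond_exp_X \<nu> Q (\<lambda>z. s (snd z) $ i) x)"

definition fisher_info ::
  "'x measure \<Rightarrow> ('x \<times> 't) measure \<Rightarrow> ('t \<Rightarrow> real^'k) \<Rightarrow> real^'k^'k" where
  "fisher_info \<nu> Q s =
     (\<chi> i j. covariance Q (\<lambda>z. score_X \<nu> Q s (fst z) $ i) (\<lambda>z. score_X \<nu> Q s (fst z) $ j))"

definition u_bar :: "'x measure \<Rightarrow> ('x \<times> 't) measure \<Rightarrow> ('x \<Rightarrow> 't \<Rightarrow> real) \<Rightarrow> 'x \<Rightarrow> real" where
  "u_bar \<nu> Q u = cond_exp_X \<nu> Q (\<lambda>z. u (fst z) (snd z))"

definition mean_u :: "('x \<times> 't) measure \<Rightarrow> ('x \<Rightarrow> 't \<Rightarrow> real) \<Rightarrow> real" where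
  "mean_u Q u = (\<integral>z. u (fst z) (snd z) \<partial>Q)"

definition gamma_vec ::
  "'x measure \<Rightarrow> ('x \<times> 't) measure \<Rightarrow> ('x \<Rightarrow> 't \<Rightarrow> real) \<Rightarrow> ('t \<Rightarrow> real^'k) \<Rightarrow> real^'k" where
  "gamma_vec \<nu> Q u s =
     (\<chi> i. \<integral>z. cond_cov_X \<nu> Q (\<lambda>y. u (fst y) (snd y)) (\<lambda>y. s (snd y) $ i) (fst z) \<partial>Q)"

definition phi_star ::
  "'x measure \<Rightarrow> ('x \<times> 't) measure \<Rightarrow> ('x \<Rightarrow> 't \<Rightarrow> real) \<Rightarrow> ('t \<Rightarrow> real^'k) \<Rightarrow> 'x \<Rightarrow> real" where
  "phi_star \<nu> Q u s x = u_bar \<nu> Q u x - mean_u Q u +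
     score_X \<nu> Q s x \<bullet> (matrix_inv (fisher_info \<nu> Q s) *v gamma_vec \<nu> Q u s)"


section \<open>Regularity and efficiency\<close>

text \<open>
  The limit variable \<open>\<xi>\<^sub>0\<close> is represented by its law \<open>L\<close>. The parameter \<open>\<tau> + a / \<surd>n\<close> may lie outside
  the (open) parameter set for finitely many \<open>n\<close>; these do not affect the limit.
\<close>

definition regular_with_limit ::
  "'x measure \<Rightarrow> (real^'k \<Rightarrow> ('x \<times> 't) measure) \<Rightarrow> ('x \<Rightarrow> 't \<Rightarrow> real) \<Rightarrow> real^'k \<Rightarrow>
   (nat \<Rightarrow> (nat \<Rightarrow> 'x) \<Rightarrow> real) \<Rightarrow> real measure \<Rightarrow> bool" where
  "regular_with_limit \<nu> P u \<tau> S L \<longleftrightarrow>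
     estimator \<nu> S \<and> real_distribution L \<and>
     (\<forall>a. weak_conv_m
        (\<lambda>n. distr (iid_law (P (\<tau> + (1 / sqrt (real n)) *\<^sub>R a))) borel
               (\<lambda>\<omega>. (S n (observed n \<omega>) - util_sum u n \<omega>) / sqrt (real n)))
        L)"

text \<open>
  Variance of a law on the line as an extended number; it is \<open>\<infinity>\<close> if the second moment is, also when
  the mean does not exist (the Bochner integral is then \<open>0\<close>).
\<close>

definition ext_variance :: "real measure \<Rightarrow> ennreal" where
  "ext_variance L = (\<integral>\<^sup>+ x. ennreal ((x - (\<integral>y. y \<partial>L))\<^sup>2) \<partial>L)"

definition variance_bound ::
  "'x measure \<Rightarrow> (real^'k \<Rightarrow> ('x \<times> 't) measure) \<Rightarrow> ('x \<Rightarrow> 't \<Rightarrow> real) \<Rightarrow> real^'k \<Rightarrow> ennreal" where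
  "variance_bound \<nu> P u \<tau> = (INF L\<in>{L. \<exists>S. regular_with_limit \<nu> P u \<tau> S L}. ext_variance L)"

definition asymptotically_efficient ::
  "'x measure \<Rightarrow> (real^'k \<Rightarrow> ('x \<times> 't) measure) \<Rightarrow> ('x \<Rightarrow> 't \<Rightarrow> real) \<Rightarrow> real^'k \<Rightarrow>
   (nat \<Rightarrow> (nat \<Rightarrow> 'x) \<Rightarrow> real) \<Rightarrow> bool" where
  "asymptotically_efficient \<nu> P u \<tau> S \<longleftrightarrow>
     (\<exists>L. regular_with_limit \<nu> P u \<tau> S L \<and>
          (\<integral>\<^sup>+ x. ennreal (x\<^sup>2) \<partial>L) = variance_bound \<nu> P u \<tau>)"


section \<open>Stochastic order symbol\<close>

text \<open>\<open>small_o_prob M R r\<close> says that \<open>R n = o\<^sub>P(r n)\<close> under the fixed measure \<open>M\<close>.\<close>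

definition small_o_prob :: "'w measure \<Rightarrow> (nat \<Rightarrow> 'w \<Rightarrow> real) \<Rightarrow> (nat \<Rightarrow> real) \<Rightarrow> bool" where
  "small_o_prob M R r \<longleftrightarrow>
     (\<forall>\<epsilon>>0. (\<lambda>n. measure M {\<omega> \<in> space M. \<bar>R n \<omega>\<bar> > \<epsilon> * r n}) \<longlonglongrightarrow> 0)"

end

theory Submission
  imports Defs "HOL-Complex_Analysis.Great_Picard"
begin

text \<open>
  Fix \<open>\<tau>\<close> and put \<open>\<psi> = \<mu> + \<phi>\<^sub>* - u\<close>, so that the normalised error of an estimator is
  \<open>V\<^sub>n = R\<^sub>n + n\<^sup>-\<^sup>1\<^sup>/\<^sup>2 \<Sum>\<psi>(X\<^sub>j, \<theta>\<^sub>j)\<close>, where \<open>R\<^sub>n\<close> depends on the observations only; the claimed expansion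
  says that \<open>R\<^sub>n\<close> tends to \<open>0\<close> in probability. The likelihood ratio of \<open>\<tau> + a/\<surd>n\<close> with respect to \<open>\<tau>\<close>
  is approximated in \<open>L\<^sup>1\<close> by the product of the factors \<open>1 + a \<bullet> s(\<theta>\<^sub>j)/\<surd>n\<close>, where \<open>s\<close> is the score of
  \<open>G\<close>. These products are bounded in \<open>L\<^sup>2\<close> and polynomial in \<open>a\<close>.

  If \<open>R\<^sub>n\<close> is negligible, the error has the same normal limit with variance \<open>\<sigma>\<^sup>2 = E \<psi>\<^sup>2\<close> under all local
  alternatives, because \<open>\<psi>\<close> is uncorrelated with every \<open>a \<bullet> s\<close>. Conversely, let the estimator be regular
  and let \<open>h = I\<^sup>-\<^sup>1 \<gamma>\<close>. Then \<open>E exp(itV\<^sub>n) \<Prod>(1 + r h \<bullet> s(\<theta>\<^sub>j)/\<surd>n)\<close> converges, for every real \<open>r\<close>, to the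
  characteristic function \<open>\<chi>(t)\<close> of the limit, and by Montel's theorem the same holds for complex \<open>r\<close>.
  For \<open>r = -it\<close> the conditional expectation of \<open>exp(it n\<^sup>-\<^sup>1\<^sup>/\<^sup>2 \<Sum>\<psi>) \<Prod>(1 + r h \<bullet> s/\<surd>n)\<close> given the observations
  tends to the constant \<open>exp(-\<sigma>\<^sup>2t\<^sup>2/2)\<close> in \<open>L\<^sup>2\<close>, since \<open>\<psi>\<close> and \<open>h \<bullet> s\<close> have the same conditional expectation.
  Hence \<open>\<chi>(t) = exp(-\<sigma>\<^sup>2t\<^sup>2/2) lim E exp(itR\<^sub>n)\<close>, the convolution theorem. It bounds the variance of the
  limit from below by \<open>\<sigma>\<^sup>2\<close>, and a second moment equal to \<open>\<sigma>\<^sup>2\<close> forces \<open>E exp(itR\<^sub>n)\<close> to tend to \<open>1\<close>.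
\<close>

section \<open>Powers and square integrable functions\<close>

text \<open>Regularity speaks about real directions only, and the estimator is an arbitrary
  measurable function of the observations, so all information about it passes through bounded test
  functions of X. This forces r = -it: the linear term of the tilted factor becomes i t (\<psi> - h
  . s)/sqrt n, the one combination that such test functions do not see, and what remains is of order
  1/n. Working with 1 + a . s/sqrt n instead of the exponential of the local asymptotic normality
  expansion asks for second moments only and makes the step to complex r harmless. The price is that
  these products can be negative, so that they are compared with likelihood ratios through their
  absolute values. The origin of h is the identity E \<psi> s = I h - \<gamma>: it vanishes for this
  h alone, and this orthogonality removes the direction a from every limit. The second moment, not
  the variance, enters the definition of efficiency; it is what fixes the behaviour of the
  characteristic function of the limit at the origin.\<close>

lemma power_tendsto_exp:
  fixes c :: "nat \<Rightarrow> complex"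
  assumes lim: "(\<lambda>n. of_nat n * (c n - 1)) \<longlonglongrightarrow> z"
  shows "(\<lambda>n. c n ^ n) \<longlonglongrightarrow> exp z"
proof -
  have "(\<lambda>n. (of_nat n * (c n - 1)) * inverse (of_nat n)) \<longlonglongrightarrow> z * 0"
    by (intro tendsto_mult lim lim_inverse_n)
  moreover have "\<forall>\<^sub>F n in sequentially. (of_nat n * (c n - 1)) * inverse (of_nat n) = c n - 1"
    using eventually_gt_at_top[of 0] by eventually_elim (simp add: field_simps)
  ultimately have "(\<lambda>n. c n - 1) \<longlonglongrightarrow> 0"
    by (simp add: tendsto_cong)
  then have c1: "c \<longlonglongrightarrow> 1"
    by (simp add: LIM_zero_iff)
  \<comment> \<open>The Caratheodory form of the derivative writes \<open>n * Ln (c n)\<close> as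
    \<open>n * (c n - 1)\<close> times a factor tending to 1, so no Taylor remainder has to be
    estimated.\<close>
  have "DERIV Ln 1 :> inverse (1::complex)"
    by (rule has_field_derivative_Ln) simp
  then obtain q where q: "\<And>w. Ln w - Ln 1 = q w * (w - 1)" "isCont q 1" "q 1 = 1"
    unfolding CARAT_DERIV by auto
  have "(\<lambda>n. q (c n)) \<longlonglongrightarrow> 1"
    using isCont_tendsto_compose[OF q(2) c1] q(3) by simp
  from tendsto_mult[OF lim this]
  have "(\<lambda>n. of_nat n * Ln (c n)) \<longlonglongrightarrow> z"
    using q(1) by (simp add: mult_ac)
  then have "(\<lambda>n. exp (of_nat n * Ln (c n))) \<longlonglongrightarrow> exp z"
    by (rule tendsto_exp)
  moreover have "\<forall>\<^sub>F n in sequentially. exp (of_nat n * Ln (c n)) = c n ^ n"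
    using tendsto_imp_eventually_ne[OF c1, of 0] by (auto elim!: eventually_mono simp: exp_of_nat_mult)
  ultimately show ?thesis
    by (simp add: tendsto_cong)
qed

lemma power_tendsto_exp_real:
  fixes c :: "nat \<Rightarrow> real"
  assumes "(\<lambda>n. real n * (c n - 1)) \<longlonglongrightarrow> z"
  shows "(\<lambda>n. c n ^ n) \<longlonglongrightarrow> exp z"
proof -
  have "(\<lambda>n. of_nat n * (complex_of_real (c n) - 1)) \<longlonglongrightarrow> of_real z"
    using tendsto_of_real[OF assms, where 'a=complex] by simp
  from power_tendsto_exp[OF this] have "(\<lambda>n. complex_of_real (c n ^ n)) \<longlonglongrightarrow> of_real (exp z)"
    by (simp add: exp_of_real)
  then show ?thesis
    by (simp only: tendsto_of_real_iff)
qed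

lemma integrable_mult_L2:
  fixes f g :: "'a \<Rightarrow> real"
  assumes [measurable]: "f \<in> borel_measurable M" "g \<in> borel_measurable M"
    and "integrable M (\<lambda>x. (f x)\<^sup>2)" "integrable M (\<lambda>x. (g x)\<^sup>2)"
  shows "integrable M (\<lambda>x. f x * g x)"
proof (rule Bochner_Integration.integrable_bound)
  show "integrable M (\<lambda>x. (f x)\<^sup>2 + (g x)\<^sup>2)"
    using assms by auto
  have "\<bar>a * b\<bar> \<le> a\<^sup>2 + b\<^sup>2" for a b :: real
  proof -
    have "2 * (\<bar>a\<bar> * \<bar>b\<bar>) \<le> \<bar>a\<bar>\<^sup>2 + \<bar>b\<bar>\<^sup>2"
      using sum_squares_bound[of "\<bar>a\<bar>" "\<bar>b\<bar>"] by (simp add: mult_ac)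
    moreover have "0 \<le> \<bar>a\<bar> * \<bar>b\<bar>" by simp
    ultimately show ?thesis unfolding abs_mult power2_abs by linarith
  qed
  then show "AE x in M. norm (f x * g x) \<le> norm ((f x)\<^sup>2 + (g x)\<^sup>2)"
    by simp
qed simp

lemma integrable_square_add:
  fixes f g :: "'a \<Rightarrow> real"
  assumes [measurable]: "f \<in> borel_measurable M" "g \<in> borel_measurable M"
    and "integrable M (\<lambda>x. (f x)\<^sup>2)" "integrable M (\<lambda>x. (g x)\<^sup>2)"
  shows "integrable M (\<lambda>x. (f x + g x)\<^sup>2)"
  using assms integrable_mult_L2[OF assms] by (simp add: power2_sum mult.assoc)

lemma integrable_square_diff:
  fixes f g :: "'a \<Rightarrow> real"
  assumes [measurable]: "f \<in> borel_measurable M" "g \<in> borel_measurable M"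
    and "integrable M (\<lambda>x. (f x)\<^sup>2)" "integrable M (\<lambda>x. (g x)\<^sup>2)"
  shows "integrable M (\<lambda>x. (f x - g x)\<^sup>2)"
  using assms integrable_mult_L2[OF assms] by (simp add: power2_diff mult.assoc)

lemma integrable_square_cmult:
  fixes f :: "'a \<Rightarrow> real"
  assumes "integrable M (\<lambda>x. (f x)\<^sup>2)"
  shows "integrable M (\<lambda>x. (c * f x)\<^sup>2)"
  using assms by (simp add: power_mult_distrib)

lemma integral_Cauchy_Schwarz:
  fixes f g :: "'a \<Rightarrow> real"
  assumes [measurable]: "f \<in> borel_measurable M" "g \<in> borel_measurable M"
    and f: "integrable M (\<lambda>x. (f x)\<^sup>2)" and g: "integrable M (\<lambda>x. (g x)\<^sup>2)"
  shows "(\<integral>x. \<bar>f x * g x\<bar> \<partial>M) \<le> sqrt (\<integral>x. (f x)\<^sup>2 \<partial>M) * sqrt (\<integral>x. (g x)\<^sup>2 \<partial>M)"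
proof -
  have fg: "integrable M (\<lambda>x. \<bar>f x * g x\<bar>)"
    using integrable_mult_L2[OF assms] by simp
  have "(\<integral>\<^sup>+x. ennreal \<bar>f x\<bar> * ennreal \<bar>g x\<bar> \<partial>M)\<^sup>2 \<le> (\<integral>\<^sup>+x. (ennreal \<bar>f x\<bar>)\<^sup>2 \<partial>M) * (\<integral>\<^sup>+x. (ennreal \<bar>g x\<bar>)\<^sup>2 \<partial>M)"
    by (rule Cauchy_Schwarz_nn_integral) simp_all
  also have "(\<integral>\<^sup>+x. (ennreal \<bar>f x\<bar>)\<^sup>2 \<partial>M) = ennreal (\<integral>x. (f x)\<^sup>2 \<partial>M)"
    using nn_integral_eq_integral[OF f] by (simp add: ennreal_power)
  also have "(\<integral>\<^sup>+x. (ennreal \<bar>g x\<bar>)\<^sup>2 \<partial>M) = ennreal (\<integral>x. (g x)\<^sup>2 \<partial>M)"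
    using nn_integral_eq_integral[OF g] by (simp add: ennreal_power)
  also have "(\<integral>\<^sup>+x. ennreal \<bar>f x\<bar> * ennreal \<bar>g x\<bar> \<partial>M) = ennreal (\<integral>x. \<bar>f x * g x\<bar> \<partial>M)"
    using nn_integral_eq_integral[OF fg] by (simp add: ennreal_mult'[symmetric] abs_mult)
  finally have "(\<integral>x. \<bar>f x * g x\<bar> \<partial>M)\<^sup>2 \<le> (\<integral>x. (f x)\<^sup>2 \<partial>M) * (\<integral>x. (g x)\<^sup>2 \<partial>M)"
    by (simp add: ennreal_power ennreal_mult'[symmetric] ennreal_le_iff)
  then show ?thesis
    by (metis real_le_rsqrt real_sqrt_mult)
qed

section \<open>Finite products of a probability space\<close>

lemma (in prob_space) product_sigma_finite_const: "product_sigma_finite (\<lambda>_. M)"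
  by (simp add: product_sigma_finite_def prob_space_imp_sigma_finite prob_space_axioms)

lemma (in prob_space) prob_space_PiM_const: "prob_space (\<Pi>\<^sub>M i\<in>I. M)"
  by (rule prob_space_PiM) (rule prob_space_axioms)

lemma (in prob_space) PiM_integrable_prod:
  fixes h :: "'a \<Rightarrow> 'b::{real_normed_field,banach,second_countable_topology}"
  assumes "finite I" "integrable M h"
  shows "integrable (\<Pi>\<^sub>M i\<in>I. M) (\<lambda>\<omega>. \<Prod>i\<in>I. h (\<omega> i))"
  using product_sigma_finite.product_integrable_prod[OF product_sigma_finite_const assms(1), of "\<lambda>_. h"] assms
  by simp

lemma (in prob_space) PiM_integral_prod:
  fixes h :: "'a \<Rightarrow> 'b::{real_normed_field,banach,second_countable_topology}"
  assumes "finite I" "integrable M h"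
  shows "(\<integral>\<omega>. (\<Prod>i\<in>I. h (\<omega> i)) \<partial>(\<Pi>\<^sub>M i\<in>I. M)) = (\<integral>x. h x \<partial>M) ^ card I"
  using product_sigma_finite.product_integral_prod[OF product_sigma_finite_const assms(1), of "\<lambda>_. h"] assms
  by simp

text \<open>Boxes determine a product measure, and on a box both sides factor. Only finiteness of
  \<open>density M g\<close> is asked for, because the absolutely continuous part of an alternative
  may have mass below 1.\<close>

lemma (in prob_space) PiM_density:
  assumes [measurable]: "g \<in> borel_measurable M" and I: "finite I"
    and fin: "finite_measure (density M g)"
  shows "(\<Pi>\<^sub>M i\<in>I. density M g) = density (\<Pi>\<^sub>M i\<in>I. M) (\<lambda>\<omega>. \<Prod>i\<in>I. g (\<omega> i))"
proof -
  interpret P: product_sigma_finite "\<lambda>_. M"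
    by (rule product_sigma_finite_const)
  interpret D: finite_measure "density M g" by fact
  interpret Q: product_sigma_finite "\<lambda>_. density M g"
    by (simp add: product_sigma_finite_def D.sigma_finite_measure_axioms)
  show ?thesis
  proof (rule Q.PiM_eqI[symmetric, OF I])
    show "sets (density (\<Pi>\<^sub>M i\<in>I. M) (\<lambda>\<omega>. \<Prod>i\<in>I. g (\<omega> i))) = sets (\<Pi>\<^sub>M i\<in>I. density M g)"
      unfolding sets_density by (rule sets_PiM_cong) simp_all
  next
    fix A assume A: "\<And>i. i \<in> I \<Longrightarrow> A i \<in> sets (density M g)"
    then have [measurable]: "\<And>i. i \<in> I \<Longrightarrow> A i \<in> sets M" by simp
    have "emeasure (density (\<Pi>\<^sub>M i\<in>I. M) (\<lambda>\<omega>. \<Prod>i\<in>I. g (\<omega> i))) (Pi\<^sub>E I A)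
        = (\<integral>\<^sup>+\<omega>. (\<Prod>i\<in>I. g (\<omega> i)) * indicator (Pi\<^sub>E I A) \<omega> \<partial>(\<Pi>\<^sub>M i\<in>I. M))"
      using I by (intro emeasure_density) (auto intro!: sets_PiM_I_finite)
    also have "\<dots> = (\<integral>\<^sup>+\<omega>. (\<Prod>i\<in>I. g (\<omega> i) * indicator (A i) (\<omega> i)) \<partial>(\<Pi>\<^sub>M i\<in>I. M))"
    proof (rule nn_integral_cong)
      fix \<omega> assume "\<omega> \<in> space (\<Pi>\<^sub>M i\<in>I. M)"
      \<comment> \<open>Membership in the box also demands extensionality, which points of the
        product space have; only then is the indicator a product over \<open>I\<close>.\<close>
      then have "\<omega> \<in> extensional I" by (simp add: space_PiM PiE_def)
      then have "indicator (Pi\<^sub>E I A) \<omega> = (\<Prod>i\<in>I. indicator (A i) (\<omega> i) :: ennreal)"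
        using I by (cases "\<forall>i\<in>I. \<omega> i \<in> A i") (auto simp: indicator_def PiE_def Pi_def)
      then show "(\<Prod>i\<in>I. g (\<omega> i)) * indicator (Pi\<^sub>E I A) \<omega> = (\<Prod>i\<in>I. g (\<omega> i) * indicator (A i) (\<omega> i))"
        by (simp add: prod.distrib)
    qed
    also have "\<dots> = (\<Prod>i\<in>I. \<integral>\<^sup>+x. g x * indicator (A i) x \<partial>M)"
      using I by (intro P.product_nn_integral_prod) auto
    also have "\<dots> = (\<Prod>i\<in>I. emeasure (density M g) (A i))"
      by (intro prod.cong refl emeasure_density[symmetric]) auto
    finally show "emeasure (density (\<Pi>\<^sub>M i\<in>I. M) (\<lambda>\<omega>. \<Prod>i\<in>I. g (\<omega> i))) (Pi\<^sub>E I A)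
      = (\<Prod>i\<in>I. emeasure (density M g) (A i))" .
  qed
qed

text \<open>With the other coordinates frozen, \<open>F\<close> is a bounded test function of
  \<open>X (\<omega> i)\<close> alone, and against those \<open>w i\<close> and \<open>k\<close>
  have equal integrals. Conditioning on the whole sample thus never requires a conditional
  expectation on the product space. The weights may differ between coordinates so that the step can
  be iterated.\<close>

lemma (in prob_space) PiM_integral_replace_one:
  fixes w :: "'i \<Rightarrow> 'a \<Rightarrow> complex" and F :: "('i \<Rightarrow> 'x) \<Rightarrow> complex"
  assumes I: "finite I" "i \<in> I"
    and X[measurable]: "X \<in> measurable M N"
    and F[measurable]: "F \<in> borel_measurable (\<Pi>\<^sub>M i\<in>I. N)" and F1: "\<And>x. norm (F x) \<le> 1"
    and w: "\<And>j. j \<in> I \<Longrightarrow> integrable M (w j)"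
    and k: "integrable M k"
    and eq: "\<And>F. F \<in> borel_measurable N \<Longrightarrow> (\<And>x. norm (F x) \<le> 1) \<Longrightarrow>
      (\<integral>z. F (X z) * w i z \<partial>M) = (\<integral>z. F (X z) * k z \<partial>M)"
  shows "(\<integral>\<omega>. F (\<lambda>j\<in>I. X (\<omega> j)) * (\<Prod>j\<in>I. w j (\<omega> j)) \<partial>(\<Pi>\<^sub>M i\<in>I. M))
       = (\<integral>\<omega>. F (\<lambda>j\<in>I. X (\<omega> j)) * (\<Prod>j\<in>I. (w(i := k)) j (\<omega> j)) \<partial>(\<Pi>\<^sub>M i\<in>I. M))"
proof -
  interpret P: product_sigma_finite "\<lambda>_. M"
    by (rule product_sigma_finite_const)
  define J where "J = I - {i}"
  have J: "finite J" "i \<notin> J" and IJ: "I = insert i J" using I by (auto simp: J_def)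
  have eval: "(\<integral>\<omega>. F (\<lambda>j\<in>I. X (\<omega> j)) * (\<Prod>j\<in>I. v j (\<omega> j)) \<partial>(\<Pi>\<^sub>M i\<in>I. M))
      = (\<integral>x. (\<Prod>j\<in>J. v j (x j)) * (\<integral>y. F ((\<lambda>j\<in>I. X (x j))(i := X y)) * v i y \<partial>M) \<partial>(\<Pi>\<^sub>M i\<in>J. M))"
    if v: "\<And>j. j \<in> I \<Longrightarrow> integrable M (v j)" for v
  proof -
    have [measurable]: "\<And>j. j \<in> I \<Longrightarrow> v j \<in> borel_measurable M"
      using v by auto
    have int: "integrable (\<Pi>\<^sub>M i\<in>I. M) (\<lambda>\<omega>. F (\<lambda>j\<in>I. X (\<omega> j)) * (\<Prod>j\<in>I. v j (\<omega> j)))"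
    proof (rule Bochner_Integration.integrable_bound)
      show "integrable (\<Pi>\<^sub>M i\<in>I. M) (\<lambda>\<omega>. \<Prod>j\<in>I. v j (\<omega> j))"
        using I v by (intro P.product_integrable_prod) auto
      show "AE \<omega> in (\<Pi>\<^sub>M i\<in>I. M). norm (F (\<lambda>j\<in>I. X (\<omega> j)) * (\<Prod>j\<in>I. v j (\<omega> j))) \<le> norm (\<Prod>j\<in>I. v j (\<omega> j))"
        using F1 by (intro AE_I2) (simp add: norm_mult mult_left_le_one_le)
    qed measurable
    have "(\<integral>\<omega>. F (\<lambda>j\<in>I. X (\<omega> j)) * (\<Prod>j\<in>I. v j (\<omega> j)) \<partial>(\<Pi>\<^sub>M i\<in>I. M))
      = (\<integral>x. (\<integral>y. F (\<lambda>j\<in>I. X ((x(i := y)) j)) * (\<Prod>j\<in>I. v j ((x(i := y)) j)) \<partial>M) \<partial>(\<Pi>\<^sub>M i\<in>J. M))"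
      using P.product_integral_insert[OF J int[unfolded IJ]] by (simp only: IJ)
    also have "\<dots> = (\<integral>x. (\<integral>y. (\<Prod>j\<in>J. v j (x j)) * (F ((\<lambda>j\<in>I. X (x j))(i := X y)) * v i y) \<partial>M) \<partial>(\<Pi>\<^sub>M i\<in>J. M))"
    proof (intro Bochner_Integration.integral_cong refl)
      fix x y
      have 1: "(\<lambda>j\<in>I. X ((x(i := y)) j)) = (\<lambda>j\<in>I. X (x j))(i := X y)"
        using I by auto
      have 2: "(\<Prod>j\<in>I. v j ((x(i := y)) j)) = v i y * (\<Prod>j\<in>J. v j (x j))"
      proof -
        have "(\<Prod>j\<in>J. v j ((x(i := y)) j)) = (\<Prod>j\<in>J. v j (x j))"
          using J by (intro prod.cong) auto
        then show ?thesis using J by (simp add: IJ)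
      qed
      show "F (\<lambda>j\<in>I. X ((x(i := y)) j)) * (\<Prod>j\<in>I. v j ((x(i := y)) j))
         = (\<Prod>j\<in>J. v j (x j)) * (F ((\<lambda>j\<in>I. X (x j))(i := X y)) * v i y)"
        unfolding 1 2 by (simp add: mult_ac)
    qed
    finally show ?thesis by simp
  qed
  have "(\<integral>y. F ((\<lambda>j\<in>I. X (x j))(i := X y)) * w i y \<partial>M) = (\<integral>y. F ((\<lambda>j\<in>I. X (x j))(i := X y)) * k y \<partial>M)"
    if x: "x \<in> space (\<Pi>\<^sub>M i\<in>J. M)" for x
  proof (rule eq)
    have "(\<lambda>y. (\<lambda>j\<in>J. X (x j))(i := y)) \<in> measurable N (\<Pi>\<^sub>M i\<in>insert i J. N)"
      using x J measurable_space[OF X]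
      by (intro measurable_component_update) (auto simp: space_PiM dest: PiE_mem)
    \<comment> \<open>The two base points differ at \<open>i\<close> only, and the update overwrites
      that coordinate.\<close>
    moreover have "(\<lambda>y. (\<lambda>j\<in>J. X (x j))(i := y)) = (\<lambda>y. (\<lambda>j\<in>I. X (x j))(i := y))"
      by (auto simp: IJ fun_eq_iff)
    ultimately have [measurable]: "(\<lambda>y. (\<lambda>j\<in>I. X (x j))(i := y)) \<in> measurable N (\<Pi>\<^sub>M i\<in>I. N)"
      by (simp add: IJ)
    show "(\<lambda>y. F ((\<lambda>j\<in>I. X (x j))(i := y))) \<in> borel_measurable N"
      by measurable
  qed (rule F1)
  moreover have "(\<Prod>j\<in>J. (w(i := k)) j (x j)) = (\<Prod>j\<in>J. w j (x j))" for x
    using J by (intro prod.cong) auto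
  ultimately show ?thesis
    using w k by (subst (1 2) eval) (auto intro!: Bochner_Integration.integral_cong)
qed

text \<open>Coordinates are exchanged one at a time; in the induction \<open>J\<close> is the set of
  those already carrying \<open>k\<close>.\<close>

lemma (in prob_space) PiM_integral_replace:
  fixes h k :: "'a \<Rightarrow> complex" and F :: "('i \<Rightarrow> 'x) \<Rightarrow> complex"
  assumes I: "finite I"
    and X: "X \<in> measurable M N"
    and F: "F \<in> borel_measurable (\<Pi>\<^sub>M i\<in>I. N)" "\<And>x. norm (F x) \<le> 1"
    and h: "integrable M h" and k: "integrable M k"
    and eq: "\<And>F. F \<in> borel_measurable N \<Longrightarrow> (\<And>x. norm (F x) \<le> 1) \<Longrightarrow>
      (\<integral>z. F (X z) * h z \<partial>M) = (\<integral>z. F (X z) * k z \<partial>M)"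
  shows "(\<integral>\<omega>. F (\<lambda>j\<in>I. X (\<omega> j)) * (\<Prod>j\<in>I. h (\<omega> j)) \<partial>(\<Pi>\<^sub>M i\<in>I. M))
       = (\<integral>\<omega>. F (\<lambda>j\<in>I. X (\<omega> j)) * (\<Prod>j\<in>I. k (\<omega> j)) \<partial>(\<Pi>\<^sub>M i\<in>I. M))"
proof -
  have "J \<subseteq> I \<Longrightarrow> (\<integral>\<omega>. F (\<lambda>j\<in>I. X (\<omega> j)) * (\<Prod>j\<in>I. h (\<omega> j)) \<partial>(\<Pi>\<^sub>M i\<in>I. M))
       = (\<integral>\<omega>. F (\<lambda>j\<in>I. X (\<omega> j)) * (\<Prod>j\<in>I. (if j \<in> J then k else h) (\<omega> j)) \<partial>(\<Pi>\<^sub>M i\<in>I. M))" for J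
  proof (induction J rule: infinite_finite_induct)
    case (infinite J)
    then show ?case using I finite_subset by blast
  next
    case empty
    show ?case by simp
  next
    case (insert i J)
    let ?w = "\<lambda>j. if j \<in> J then k else h"
    have upd: "?w(i := k) = (\<lambda>j. if j \<in> insert i J then k else h)"
      by auto
    have "(\<integral>\<omega>. F (\<lambda>j\<in>I. X (\<omega> j)) * (\<Prod>j\<in>I. ?w j (\<omega> j)) \<partial>(\<Pi>\<^sub>M i\<in>I. M))
       = (\<integral>\<omega>. F (\<lambda>j\<in>I. X (\<omega> j)) * (\<Prod>j\<in>I. (?w(i := k)) j (\<omega> j)) \<partial>(\<Pi>\<^sub>M i\<in>I. M))"
      using insert h k eq by (intro PiM_integral_replace_one[OF I _ X F]) auto
    from trans[OF insert.IH this[unfolded upd]] insert.prems show ?case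
      by blast
  qed
  from this[OF subset_refl] show ?thesis
    by (simp cong: prod.cong)
qed

section \<open>Likelihood ratios of local alternatives\<close>

text \<open>A bound for all x, meant for domination: multiplying by the conjugate factor, which is
  at least 1, gives |sqrt |1 + x| - 1| at most |x|, and the term x / 2 supplies the remaining
  half.\<close>

lemma abs_sqrt_abs_taylor_le:
  fixes x :: real
  shows "\<bar>sqrt \<bar>1 + x\<bar> - 1 - x / 2\<bar> \<le> 3 / 2 * \<bar>x\<bar>"
proof -
  have "\<bar>sqrt \<bar>1 + x\<bar> - 1\<bar> \<le> \<bar>sqrt \<bar>1 + x\<bar> - 1\<bar> * (sqrt \<bar>1 + x\<bar> + 1)"
    by (simp add: algebra_simps)
  also have "\<dots> = \<bar>(sqrt \<bar>1 + x\<bar> - 1) * (sqrt \<bar>1 + x\<bar> + 1)\<bar>"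
    by (simp add: abs_mult)
  also have "\<dots> = \<bar>\<bar>1 + x\<bar> - 1\<bar>"
    by (simp add: algebra_simps)
  also have "\<dots> \<le> \<bar>x\<bar>" by simp
  finally show ?thesis by linarith
qed

text \<open>For s = sqrt (1 + x) the error is exactly -(s - 1)^2 / 2, and |s - 1| is at most |x|.
  The quadratic order gives pointwise convergence where the linear bound cannot.\<close>

lemma abs_sqrt_taylor_le:
  fixes x :: real
  assumes "\<bar>x\<bar> \<le> 1"
  shows "\<bar>sqrt \<bar>1 + x\<bar> - 1 - x / 2\<bar> \<le> x\<^sup>2 / 2"
proof -
  define s where "s = sqrt (1 + x)"
  have s: "0 \<le> s" "s\<^sup>2 = 1 + x" using assms by (auto simp: s_def)
  have "x\<^sup>2 = ((s - 1) * (s + 1))\<^sup>2"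
    using s by (simp add: algebra_simps power2_eq_square)
  also have "\<dots> = (s - 1)\<^sup>2 * (s + 1)\<^sup>2"
    by (rule power_mult_distrib)
  also have "\<dots> \<ge> (s - 1)\<^sup>2 * 1"
    using s by (intro mult_left_mono) auto
  finally have "(s - 1)\<^sup>2 \<le> x\<^sup>2" by simp
  moreover have "s - 1 - x / 2 = - ((s - 1)\<^sup>2 / 2)"
    using s by (simp add: power2_eq_square field_simps)
  ultimately show ?thesis
    using assms by (simp add: s_def)
qed

text \<open>A difference of squares is (Y - W)(Y + W); after Cauchy-Schwarz only L2 norms are left,
  and these expand into three one-coordinate integrals raised to the power n. Here \<open>c\<close>
  is the Hellinger affinity of the two factors.\<close>

lemma (in prob_space) integral_abs_PiM_prod_square_diff_le:
  fixes y w :: "'a \<Rightarrow> real"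
  assumes [measurable]: "y \<in> borel_measurable M" "w \<in> borel_measurable M"
    and y: "integrable M (\<lambda>x. (y x)\<^sup>2)" and w: "integrable M (\<lambda>x. (w x)\<^sup>2)"
  defines "a \<equiv> \<integral>x. (y x)\<^sup>2 \<partial>M" and "b \<equiv> \<integral>x. (w x)\<^sup>2 \<partial>M" and "c \<equiv> \<integral>x. y x * w x \<partial>M"
  shows "(\<integral>\<omega>. \<bar>(\<Prod>j<n. (y (\<omega> j))\<^sup>2) - (\<Prod>j<n. (w (\<omega> j))\<^sup>2)\<bar> \<partial>(\<Pi>\<^sub>M i\<in>{..<n}. M))
    \<le> sqrt (a ^ n + b ^ n - 2 * c ^ n) * sqrt (a ^ n + b ^ n + 2 * c ^ n)"
proof -
  let ?P = "\<Pi>\<^sub>M i\<in>{..<n}. M"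
  let ?Y = "\<lambda>\<omega>. \<Prod>j<n. y (\<omega> j)" and ?W = "\<lambda>\<omega>. \<Prod>j<n. w (\<omega> j)"
  have yw: "integrable M (\<lambda>x. y x * w x)"
    using y w by (intro integrable_mult_L2) auto
  have Y: "integrable ?P (\<lambda>\<omega>. (?Y \<omega>)\<^sup>2)" "(\<integral>\<omega>. (?Y \<omega>)\<^sup>2 \<partial>?P) = a ^ n"
    using PiM_integrable_prod[OF _ y, of "{..<n}"] PiM_integral_prod[OF _ y, of "{..<n}"]
    by (simp_all add: prod_power_distrib a_def)
  have W: "integrable ?P (\<lambda>\<omega>. (?W \<omega>)\<^sup>2)" "(\<integral>\<omega>. (?W \<omega>)\<^sup>2 \<partial>?P) = b ^ n"
    using PiM_integrable_prod[OF _ w, of "{..<n}"] PiM_integral_prod[OF _ w, of "{..<n}"]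
    by (simp_all add: prod_power_distrib b_def)
  have YW: "integrable ?P (\<lambda>\<omega>. ?Y \<omega> * ?W \<omega>)" "(\<integral>\<omega>. ?Y \<omega> * ?W \<omega> \<partial>?P) = c ^ n"
    using PiM_integrable_prod[OF _ yw, of "{..<n}"] PiM_integral_prod[OF _ yw, of "{..<n}"]
    by (simp_all add: prod.distrib c_def)
  have factor: "p\<^sup>2 - q\<^sup>2 = (p - q) * (p + q)" for p q :: real
    by (simp add: power2_eq_square algebra_simps)
  have "(\<integral>\<omega>. \<bar>(\<Prod>j<n. (y (\<omega> j))\<^sup>2) - (\<Prod>j<n. (w (\<omega> j))\<^sup>2)\<bar> \<partial>?P)
    = (\<integral>\<omega>. \<bar>(?Y \<omega> - ?W \<omega>) * (?Y \<omega> + ?W \<omega>)\<bar> \<partial>?P)"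
    by (simp only: prod_power_distrib[symmetric] factor)
  also have "\<dots> \<le> sqrt (\<integral>\<omega>. (?Y \<omega> - ?W \<omega>)\<^sup>2 \<partial>?P) * sqrt (\<integral>\<omega>. (?Y \<omega> + ?W \<omega>)\<^sup>2 \<partial>?P)"
    using Y W by (intro integral_Cauchy_Schwarz integrable_square_diff integrable_square_add) auto
  also have "(\<integral>\<omega>. (?Y \<omega> - ?W \<omega>)\<^sup>2 \<partial>?P) = a ^ n + b ^ n - 2 * c ^ n"
    using Y W YW by (simp add: power2_diff mult.assoc)
  also have "(\<integral>\<omega>. (?Y \<omega> + ?W \<omega>)\<^sup>2 \<partial>?P) = a ^ n + b ^ n + 2 * c ^ n"
    using Y W YW by (simp add: power2_sum mult.assoc)
  finally show ?thesis .
qed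

text \<open>The surrogate factors satisfy the same root expansion as the true density ratios. The
  linear bound gives the integrable majorant 9/4 times \<zeta> squared; the quadratic one gives a
  pointwise O(1/n), whose fourth power of \<zeta> never has to be integrated.\<close>

lemma (in prob_space) sqrt_score_dominated:
  fixes \<zeta> :: "'a \<Rightarrow> real"
  assumes [measurable]: "\<zeta> \<in> borel_measurable M" and z2: "integrable M (\<lambda>x. (\<zeta> x)\<^sup>2)"
  shows "(\<lambda>n. real n * (\<integral>x. (sqrt \<bar>1 + \<zeta> x / sqrt n\<bar> - 1 - \<zeta> x / (2 * sqrt n))\<^sup>2 \<partial>M)) \<longlonglongrightarrow> 0"
proof -
  have "(\<lambda>n. \<integral>x. real n * (sqrt \<bar>1 + \<zeta> x / sqrt n\<bar> - 1 - \<zeta> x / (2 * sqrt n))\<^sup>2 \<partial>M) \<longlonglongrightarrow> (\<integral>x. 0 \<partial>M)"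
  proof (rule integral_dominated_convergence)
    show "integrable M (\<lambda>x. 9 / 4 * (\<zeta> x)\<^sup>2)" using z2 by simp
  next
    fix n :: nat
    show "AE x in M. norm (real n * (sqrt \<bar>1 + \<zeta> x / sqrt n\<bar> - 1 - \<zeta> x / (2 * sqrt n))\<^sup>2) \<le> 9 / 4 * (\<zeta> x)\<^sup>2"
    proof (rule AE_I2)
      fix x
      have "(sqrt \<bar>1 + \<zeta> x / sqrt n\<bar> - 1 - \<zeta> x / (2 * sqrt n))\<^sup>2 \<le> (3 / 2 * \<bar>\<zeta> x / sqrt n\<bar>)\<^sup>2"
        using abs_sqrt_abs_taylor_le[of "\<zeta> x / sqrt n"] by (intro abs_le_square_iff[THEN iffD1]) (simp add: field_simps)
      then have "real n * (sqrt \<bar>1 + \<zeta> x / sqrt n\<bar> - 1 - \<zeta> x / (2 * sqrt n))\<^sup>2 \<le> real n * (3 / 2 * \<bar>\<zeta> x / sqrt n\<bar>)\<^sup>2"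
        by (intro mult_left_mono) (auto simp: power_mult_distrib power_divide power2_abs)
      also have "\<dots> \<le> 9 / 4 * (\<zeta> x)\<^sup>2"
        by (cases "n = 0") (auto simp: power_divide power_mult_distrib)
      finally show "norm (real n * (sqrt \<bar>1 + \<zeta> x / sqrt n\<bar> - 1 - \<zeta> x / (2 * sqrt n))\<^sup>2) \<le> 9 / 4 * (\<zeta> x)\<^sup>2"
        by simp
    qed
  next
    show "AE x in M. (\<lambda>n. real n * (sqrt \<bar>1 + \<zeta> x / sqrt n\<bar> - 1 - \<zeta> x / (2 * sqrt n))\<^sup>2) \<longlonglongrightarrow> 0"
    proof (rule AE_I2, rule real_tendsto_sandwich)
      fix x
      show "\<forall>\<^sub>F n in sequentially. 0 \<le> real n * (sqrt \<bar>1 + \<zeta> x / sqrt n\<bar> - 1 - \<zeta> x / (2 * sqrt n))\<^sup>2"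
        by simp
      show "(\<lambda>_. 0) \<longlonglongrightarrow> (0::real)" by simp
      show "(\<lambda>n. (\<zeta> x) ^ 4 / 4 * inverse (real n)) \<longlonglongrightarrow> 0"
        using tendsto_mult[OF tendsto_const[of "(\<zeta> x) ^ 4 / 4"] lim_inverse_n[where 'a=real]] by simp
      have "(\<lambda>n. \<zeta> x * inverse (sqrt n)) \<longlonglongrightarrow> \<zeta> x * 0"
        by (intro tendsto_intros tendsto_inverse_0_at_top filterlim_compose[OF sqrt_at_top] filterlim_real_sequentially)
      then have "(\<lambda>n. \<zeta> x / sqrt n) \<longlonglongrightarrow> 0" by (simp add: field_simps)
      then have "\<forall>\<^sub>F n in sequentially. \<bar>\<zeta> x / sqrt n\<bar> < 1"
        using tendstoD[of "\<lambda>n. \<zeta> x / sqrt n" 0 sequentially 1] by simp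
      then show "\<forall>\<^sub>F n in sequentially. real n * (sqrt \<bar>1 + \<zeta> x / sqrt n\<bar> - 1 - \<zeta> x / (2 * sqrt n))\<^sup>2
          \<le> (\<zeta> x) ^ 4 / 4 * inverse (real n)"
        using eventually_gt_at_top[of 0]
      proof eventually_elim
        case (elim n)
        have "(sqrt \<bar>1 + \<zeta> x / sqrt n\<bar> - 1 - \<zeta> x / (2 * sqrt n))\<^sup>2 \<le> ((\<zeta> x / sqrt n)\<^sup>2 / 2)\<^sup>2"
          using abs_sqrt_taylor_le[of "\<zeta> x / sqrt n"] elim
          by (intro abs_le_square_iff[THEN iffD1]) (simp add: field_simps)
        then have "real n * (sqrt \<bar>1 + \<zeta> x / sqrt n\<bar> - 1 - \<zeta> x / (2 * sqrt n))\<^sup>2 \<le> real n * ((\<zeta> x / sqrt n)\<^sup>2 / 2)\<^sup>2"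
          by (intro mult_left_mono) auto
        also have "\<dots> = (\<zeta> x) ^ 4 / 4 * inverse (real n)"
          using elim by (simp add: power_divide field_simps power2_eq_square power4_eq_xxxx)
        finally show ?case .
      qed
    qed
  qed simp_all
  then show ?thesis by simp
qed

text \<open>As \<zeta> has mean 0, the excess mass comes from the negative part of 1 + \<zeta>/sqrt
  n. That part lives where \<zeta> is below -sqrt n, is at most \<zeta> squared over n, and vanishes
  pointwise for large n.\<close>

lemma (in prob_space) abs_score_mass:
  fixes \<zeta> :: "'a \<Rightarrow> real"
  assumes [measurable]: "\<zeta> \<in> borel_measurable M" and z2: "integrable M (\<lambda>x. (\<zeta> x)\<^sup>2)"
    and z0: "(\<integral>x. \<zeta> x \<partial>M) = 0"
  shows "(\<lambda>n. real n * ((\<integral>x. \<bar>1 + \<zeta> x / sqrt n\<bar> \<partial>M) - 1)) \<longlonglongrightarrow> 0"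
proof -
  have z1: "integrable M \<zeta>" by (rule square_integrable_imp_integrable) (use z2 in auto)
  have eq: "real n * ((\<integral>x. \<bar>1 + \<zeta> x / sqrt n\<bar> \<partial>M) - 1)
    = (\<integral>x. real n * (\<bar>1 + \<zeta> x / sqrt n\<bar> - (1 + \<zeta> x / sqrt n)) \<partial>M)" for n
    using z1 z0 by (simp add: prob_space)
  have "(\<lambda>n. \<integral>x. real n * (\<bar>1 + \<zeta> x / sqrt n\<bar> - (1 + \<zeta> x / sqrt n)) \<partial>M) \<longlonglongrightarrow> (\<integral>x. 0 \<partial>M)"
  proof (rule integral_dominated_convergence)
    show "integrable M (\<lambda>x. 2 * (\<zeta> x)\<^sup>2)" using z2 by simp
  next
    fix n :: nat
    show "AE x in M. norm (real n * (\<bar>1 + \<zeta> x / sqrt n\<bar> - (1 + \<zeta> x / sqrt n))) \<le> 2 * (\<zeta> x)\<^sup>2"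
    proof (rule AE_I2)
      fix x
      define v where "v = \<zeta> x / sqrt n"
      have "\<bar>1 + v\<bar> - (1 + v) \<le> 2 * v\<^sup>2"
      proof (cases "1 + v \<ge> 0")
        case False
        then have "1 \<le> - v" by simp
        then have "- v * 1 \<le> - v * - v" by (intro mult_left_mono) auto
        then show ?thesis using False by (simp add: power2_eq_square)
      qed simp
      then have "real n * (\<bar>1 + v\<bar> - (1 + v)) \<le> real n * (2 * v\<^sup>2)"
        by (intro mult_left_mono) auto
      also have "\<dots> \<le> 2 * (\<zeta> x)\<^sup>2"
        by (cases "n = 0") (auto simp: power_divide v_def)
      finally show "norm (real n * (\<bar>1 + \<zeta> x / sqrt n\<bar> - (1 + \<zeta> x / sqrt n))) \<le> 2 * (\<zeta> x)\<^sup>2"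
        by (simp add: v_def[symmetric] abs_mult)
    qed
  next
    show "AE x in M. (\<lambda>n. real n * (\<bar>1 + \<zeta> x / sqrt n\<bar> - (1 + \<zeta> x / sqrt n))) \<longlonglongrightarrow> 0"
    proof (rule AE_I2)
      fix x
      have "(\<lambda>n. \<zeta> x * inverse (sqrt n)) \<longlonglongrightarrow> \<zeta> x * 0"
        by (intro tendsto_intros tendsto_inverse_0_at_top filterlim_compose[OF sqrt_at_top] filterlim_real_sequentially)
      then have "(\<lambda>n. \<zeta> x / sqrt n) \<longlonglongrightarrow> 0" by (simp add: field_simps)
      then have "\<forall>\<^sub>F n in sequentially. \<bar>\<zeta> x / sqrt n\<bar> < 1"
        using tendstoD[of "\<lambda>n. \<zeta> x / sqrt n" 0 sequentially 1] by simp
      then have "\<forall>\<^sub>F n in sequentially. real n * (\<bar>1 + \<zeta> x / sqrt n\<bar> - (1 + \<zeta> x / sqrt n)) = 0"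
      proof eventually_elim
        case (elim n)
        then have "\<bar>1 + \<zeta> x / sqrt n\<bar> = 1 + \<zeta> x / sqrt n" by linarith
        then show ?case by simp
      qed
      then show "(\<lambda>n. real n * (\<bar>1 + \<zeta> x / sqrt n\<bar> - (1 + \<zeta> x / sqrt n))) \<longlonglongrightarrow> 0"
        by (rule tendsto_eventually)
    qed
  qed simp_all
  then show ?thesis unfolding eq by simp
qed

text \<open>
  Both products are squares of products, of \<open>\<surd>g\<close> and of \<open>\<surd>\<bar>1 + \<zeta>/\<surd>n\<bar>\<close>, whose \<open>L\<^sup>2\<close> distance factorises.
  The absolute value is harmless: the signed product has mean \<open>1\<close>, its absolute value mean tending to \<open>1\<close>.
\<close>

theorem (in prob_space) likelihood_approximation:
  fixes g :: "nat \<Rightarrow> 'a \<Rightarrow> real" and \<zeta> :: "'a \<Rightarrow> real"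
  assumes [measurable]: "\<And>n. g n \<in> borel_measurable M" "\<zeta> \<in> borel_measurable M"
    and g0: "\<And>n x. 0 \<le> g n x" and g: "\<And>n. integrable M (g n)"
    and mass: "(\<lambda>n. real n * ((\<integral>x. g n x \<partial>M) - 1)) \<longlonglongrightarrow> 0"
    and z2: "integrable M (\<lambda>x. (\<zeta> x)\<^sup>2)" and z0: "(\<integral>x. \<zeta> x \<partial>M) = 0"
    and hell: "(\<lambda>n. real n * (\<integral>x. (sqrt (g n x) - 1 - \<zeta> x / (2 * sqrt n))\<^sup>2 \<partial>M)) \<longlonglongrightarrow> 0"
  shows "(\<lambda>n. \<integral>\<omega>. \<bar>(\<Prod>j<n. g n (\<omega> j)) - (\<Prod>j<n. 1 + \<zeta> (\<omega> j) / sqrt n)\<bar> \<partial>(\<Pi>\<^sub>M i\<in>{..<n}. M)) \<longlonglongrightarrow> 0"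
proof -
  define y where "y n x = sqrt (g n x)" for n x
  define w where "w n x = sqrt \<bar>1 + \<zeta> x / sqrt n\<bar>" for n :: nat and x
  define \<Lambda> where "\<Lambda> n \<omega> = (\<Prod>j<n. 1 + \<zeta> (\<omega> j) / sqrt n)" for n and \<omega> :: "nat \<Rightarrow> 'a"
  let ?P = "\<lambda>n. \<Pi>\<^sub>M i\<in>{..<n}. M"
  have [measurable]: "y n \<in> borel_measurable M" "w n \<in> borel_measurable M" for n
    unfolding y_def[abs_def] w_def[abs_def] by measurable
  have ysq: "(y n x)\<^sup>2 = g n x" and wsq: "(w n x)\<^sup>2 = \<bar>1 + \<zeta> x / sqrt n\<bar>" for n x
    using g0 by (simp_all add: y_def w_def)
  have z1: "integrable M \<zeta>" by (rule square_integrable_imp_integrable) (use z2 in auto)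
  have lin: "integrable M (\<lambda>x. 1 + \<zeta> x / sqrt n)" for n using z1 by simp
  have y2: "integrable M (\<lambda>x. (y n x)\<^sup>2)" and w2: "integrable M (\<lambda>x. (w n x)\<^sup>2)" for n
    using g lin by (simp_all only: ysq wsq integrable_abs)
  have yw: "integrable M (\<lambda>x. y n x * w n x)" for n
    using y2 w2 by (intro integrable_mult_L2) auto
  define a b c where "a n = (\<integral>x. (y n x)\<^sup>2 \<partial>M)" and "b n = (\<integral>x. (w n x)\<^sup>2 \<partial>M)"
    and "c n = (\<integral>x. y n x * w n x \<partial>M)" for n
  have a: "(\<lambda>n. real n * (a n - 1)) \<longlonglongrightarrow> 0"
    using mass by (simp add: a_def ysq)
  have b: "(\<lambda>n. real n * (b n - 1)) \<longlonglongrightarrow> 0"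
    using abs_score_mass[OF _ z2 z0] by (simp add: b_def wsq)
  \<comment> \<open>\<open>d\<close> is compared through the common linearisation 1 + \<zeta>/(2
    sqrt n) of both roots, one side by \<open>hell\<close>, the other by
    \<open>sqrt_score_dominated\<close>.\<close>
  define d where "d n = (\<integral>x. (y n x - w n x)\<^sup>2 \<partial>M)" for n
  have d: "(\<lambda>n. real n * d n) \<longlonglongrightarrow> 0"
  proof (rule real_tendsto_sandwich)
    let ?e1 = "\<lambda>n x. y n x - 1 - \<zeta> x / (2 * sqrt (real n))"
    let ?e2 = "\<lambda>n x. w n x - 1 - \<zeta> x / (2 * sqrt (real n))"
    have lin2: "integrable M (\<lambda>x. (c * \<zeta> x)\<^sup>2)" for c
      using z2 by (rule integrable_square_cmult)
    have e: "integrable M (\<lambda>x. (?e1 n x)\<^sup>2)" "integrable M (\<lambda>x. (?e2 n x)\<^sup>2)" for n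
      using y2 w2 lin2[of "1 / (2 * sqrt (real n))"] by (auto intro!: integrable_square_diff)
    show "\<forall>\<^sub>F n in sequentially. 0 \<le> real n * d n"
      by (simp add: d_def)
    have "d n \<le> (\<integral>x. 2 * (?e1 n x)\<^sup>2 + 2 * (?e2 n x)\<^sup>2 \<partial>M)" for n
      unfolding d_def
    proof (rule integral_mono)
      show "integrable M (\<lambda>x. (y n x - w n x)\<^sup>2)"
        using y2 w2 by (intro integrable_square_diff) auto
      show "integrable M (\<lambda>x. 2 * (?e1 n x)\<^sup>2 + 2 * (?e2 n x)\<^sup>2)"
        using e by simp
      show "(y n x - w n x)\<^sup>2 \<le> 2 * (?e1 n x)\<^sup>2 + 2 * (?e2 n x)\<^sup>2" for x
      proof -
        have "(p - q)\<^sup>2 \<le> 2 * p\<^sup>2 + 2 * q\<^sup>2" for p q :: real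
          using zero_le_power2[of "p + q"] by (simp add: power2_sum power2_diff)
        from this[of "?e1 n x" "?e2 n x"] show ?thesis by simp
      qed
    qed
    also have "(\<integral>x. 2 * (?e1 n x)\<^sup>2 + 2 * (?e2 n x)\<^sup>2 \<partial>M) = 2 * (\<integral>x. (?e1 n x)\<^sup>2 \<partial>M) + 2 * (\<integral>x. (?e2 n x)\<^sup>2 \<partial>M)" for n
      using e by simp
    finally have "real n * d n \<le> real n * (2 * (\<integral>x. (?e1 n x)\<^sup>2 \<partial>M) + 2 * (\<integral>x. (?e2 n x)\<^sup>2 \<partial>M))" for n
      by (rule mult_left_mono) simp
    then show "\<forall>\<^sub>F n in sequentially. real n * d n
       \<le> 2 * (real n * (\<integral>x. (?e1 n x)\<^sup>2 \<partial>M)) + 2 * (real n * (\<integral>x. (?e2 n x)\<^sup>2 \<partial>M))"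
      by (intro always_eventually allI) (simp add: algebra_simps)
    have "(\<lambda>n. 2 * (real n * (\<integral>x. (?e1 n x)\<^sup>2 \<partial>M)) + 2 * (real n * (\<integral>x. (?e2 n x)\<^sup>2 \<partial>M))) \<longlonglongrightarrow> 2 * 0 + 2 * 0"
      using hell sqrt_score_dominated[OF _ z2] unfolding y_def w_def by (intro tendsto_intros) auto
    then show "(\<lambda>n. 2 * (real n * (\<integral>x. (?e1 n x)\<^sup>2 \<partial>M)) + 2 * (real n * (\<integral>x. (?e2 n x)\<^sup>2 \<partial>M))) \<longlonglongrightarrow> 0"
      by simp
  qed simp
  have d_eq: "d n = a n + b n - 2 * c n" for n
    using y2 w2 yw by (simp add: d_def a_def b_def c_def power2_diff mult.assoc)
  \<comment> \<open>Polarisation: the affinity \<open>c\<close> is recovered from both masses and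
    the distance \<open>d\<close>. All three numbers are then 1 + o(1/n), and their n-th powers tend
    to 1.\<close>
  have "(\<lambda>n. (real n * (a n - 1) + real n * (b n - 1) - real n * d n) / 2) \<longlonglongrightarrow> (0 + 0 - 0) / 2"
    by (intro tendsto_intros a b d) simp
  then have c: "(\<lambda>n. real n * (c n - 1)) \<longlonglongrightarrow> 0"
    by (simp add: d_eq algebra_simps add_divide_distrib diff_divide_distrib)
  note lims = a[THEN power_tendsto_exp_real] b[THEN power_tendsto_exp_real] c[THEN power_tendsto_exp_real]
  have \<Lambda>_int: "integrable (?P n) (\<Lambda> n)" "(\<integral>\<omega>. \<Lambda> n \<omega> \<partial>?P n) = 1" for n
    using PiM_integrable_prod[OF _ lin, of "{..<n}" n] PiM_integral_prod[OF _ lin, of "{..<n}" n] z0 z1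
    by (auto simp: \<Lambda>_def[abs_def] prob_space)
  have abs\<Lambda>: "\<bar>\<Lambda> n \<omega>\<bar> = (\<Prod>j<n. (w n (\<omega> j))\<^sup>2)" for n \<omega>
    by (simp add: \<Lambda>_def abs_prod wsq)
  have abs\<Lambda>_int: "(\<integral>\<omega>. \<bar>\<Lambda> n \<omega>\<bar> \<partial>?P n) = b n ^ n" for n
    unfolding abs\<Lambda> using PiM_integral_prod[OF _ w2, of "{..<n}" n] by (simp add: b_def)
  have G_int: "integrable (?P n) (\<lambda>\<omega>. \<Prod>j<n. g n (\<omega> j))" for n
    by (rule PiM_integrable_prod) (auto intro: g)
  show ?thesis
    unfolding \<Lambda>_def[symmetric]
  proof (rule real_tendsto_sandwich)
    let ?s = "\<lambda>n. sqrt (a n ^ n + b n ^ n - 2 * c n ^ n) * sqrt (a n ^ n + b n ^ n + 2 * c n ^ n)"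
    show "\<forall>\<^sub>F n in sequentially. 0 \<le> (\<integral>\<omega>. \<bar>(\<Prod>j<n. g n (\<omega> j)) - \<Lambda> n \<omega>\<bar> \<partial>?P n)"
      by simp
    show "\<forall>\<^sub>F n in sequentially. (\<integral>\<omega>. \<bar>(\<Prod>j<n. g n (\<omega> j)) - \<Lambda> n \<omega>\<bar> \<partial>?P n) \<le> ?s n + (b n ^ n - 1)"
    proof (intro always_eventually allI)
      fix n
      \<comment> \<open>The signed product is replaced by its absolute value at the cost of
        |\<Lambda>| - \<Lambda>, a nonnegative function of integral
        \<open>b n ^ n - 1\<close>.\<close>
      have "(\<integral>\<omega>. \<bar>(\<Prod>j<n. g n (\<omega> j)) - \<Lambda> n \<omega>\<bar> \<partial>?P n)
        \<le> (\<integral>\<omega>. \<bar>(\<Prod>j<n. g n (\<omega> j)) - \<bar>\<Lambda> n \<omega>\<bar>\<bar> + (\<bar>\<Lambda> n \<omega>\<bar> - \<Lambda> n \<omega>) \<partial>?P n)"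
        using \<Lambda>_int G_int by (intro integral_mono) auto
      also have "\<dots> = (\<integral>\<omega>. \<bar>(\<Prod>j<n. g n (\<omega> j)) - \<bar>\<Lambda> n \<omega>\<bar>\<bar> \<partial>?P n) + (b n ^ n - 1)"
        using \<Lambda>_int G_int abs\<Lambda>_int by simp
      also have "(\<integral>\<omega>. \<bar>(\<Prod>j<n. g n (\<omega> j)) - \<bar>\<Lambda> n \<omega>\<bar>\<bar> \<partial>?P n) \<le> ?s n"
        unfolding abs\<Lambda> ysq[symmetric] a_def b_def c_def
        by (rule integral_abs_PiM_prod_square_diff_le) (use y2 w2 in auto)
      finally show "(\<integral>\<omega>. \<bar>(\<Prod>j<n. g n (\<omega> j)) - \<Lambda> n \<omega>\<bar> \<partial>?P n) \<le> ?s n + (b n ^ n - 1)"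
        by simp
    qed
    have "(\<lambda>n. ?s n + (b n ^ n - 1)) \<longlonglongrightarrow> sqrt (exp 0 + exp 0 - 2 * exp 0) * sqrt (exp 0 + exp 0 + 2 * exp 0) + (exp 0 - 1)"
      by (intro tendsto_intros lims)
    then show "(\<lambda>n. ?s n + (b n ^ n - 1)) \<longlonglongrightarrow> 0" by simp
  qed simp
qed

text \<open>The set \<open>C\<close> is the complement of a carrier of the singular part of \<open>M'\<close>.\<close>

lemma (in prob_space) PiM_integral_alternative_le:
  fixes F :: "(nat \<Rightarrow> 'a) \<Rightarrow> complex" and g :: "'a \<Rightarrow> real" and \<Lambda> :: "(nat \<Rightarrow> 'a) \<Rightarrow> real"
  assumes M': "prob_space M'" and sets_eq: "sets M' = sets M" and C: "C \<in> sets M"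
    and g[measurable]: "g \<in> borel_measurable M" and g0: "\<And>x. 0 \<le> g x" and g_int: "integrable M g"
    and dens: "density M (\<lambda>x. ennreal (g x)) = density M' (indicator C)"
    and F[measurable]: "F \<in> borel_measurable (\<Pi>\<^sub>M i\<in>{..<n}. M)" and F1: "\<And>\<omega>. norm (F \<omega>) \<le> 1"
    and \<Lambda>: "integrable (\<Pi>\<^sub>M i\<in>{..<n}. M) \<Lambda>"
  shows "norm ((\<integral>\<omega>. F \<omega> \<partial>(\<Pi>\<^sub>M i\<in>{..<n}. M')) - (\<integral>\<omega>. F \<omega> * of_real (\<Lambda> \<omega>) \<partial>(\<Pi>\<^sub>M i\<in>{..<n}. M)))
    \<le> (1 - (\<integral>x. g x \<partial>M) ^ n) + (\<integral>\<omega>. \<bar>(\<Prod>j<n. g (\<omega> j)) - \<Lambda> \<omega>\<bar> \<partial>(\<Pi>\<^sub>M i\<in>{..<n}. M))"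
proof -
  let ?P = "\<Pi>\<^sub>M i\<in>{..<n}. M" and ?P' = "\<Pi>\<^sub>M i\<in>{..<n}. M'"
  let ?c = "\<lambda>\<omega>. (\<Prod>j<n. indicator C (\<omega> j)) :: real" and ?g = "\<lambda>\<omega>. \<Prod>j<n. g (\<omega> j)"
  interpret M': prob_space M' by fact
  interpret P: prob_space ?P by (rule prob_space_PiM_const)
  interpret P': prob_space ?P' by (rule M'.prob_space_PiM_const)
  have sets_P': "sets ?P' = sets ?P"
    using sets_eq by (intro sets_PiM_cong) auto
  have [measurable]: "C \<in> sets M'" using C sets_eq by simp
  have F'[measurable]: "F \<in> borel_measurable ?P'"
    using F measurable_cong_sets[OF sets_P' refl] by blast
  have \<Lambda>_meas[measurable]: "\<Lambda> \<in> borel_measurable ?P" using \<Lambda> by auto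
  have "finite_measure (density M' (indicator C))"
    by (intro finite_measureI) (simp add: emeasure_restricted)
  then have fin: "finite_measure (density M (\<lambda>x. ennreal (g x)))" "finite_measure (density M' (indicator C))"
    using dens by simp_all
  have "density ?P (\<lambda>\<omega>. ennreal (?g \<omega>)) = (\<Pi>\<^sub>M i\<in>{..<n}. density M (\<lambda>x. ennreal (g x)))"
    using g0 by (subst PiM_density[OF _ _ fin(1)]) (auto simp: prod_ennreal)
  also have "\<dots> = density ?P' (\<lambda>\<omega>. \<Prod>j<n. indicator C (\<omega> j))"
    unfolding dens by (rule M'.PiM_density[OF _ _ fin(2)]) auto
  also have "\<dots> = density ?P' (\<lambda>\<omega>. ennreal (?c \<omega>))"
    by (simp add: prod_ennreal[symmetric] ennreal_indicator)
  finally have dens_n: "density ?P (\<lambda>\<omega>. ennreal (?g \<omega>)) = density ?P' (\<lambda>\<omega>. ennreal (?c \<omega>))" .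
  have c01: "0 \<le> ?c \<omega>" "?c \<omega> \<le> 1" for \<omega>
    by (auto intro!: prod_nonneg prod_le_1 simp: indicator_def)
  have g0n: "0 \<le> ?g \<omega>" for \<omega>
    using g0 by (intro prod_nonneg) auto
  have change: "(\<integral>\<omega>. ?c \<omega> *\<^sub>R H \<omega> \<partial>?P') = (\<integral>\<omega>. ?g \<omega> *\<^sub>R H \<omega> \<partial>?P)"
    if [measurable]: "H \<in> borel_measurable ?P" for H :: "(nat \<Rightarrow> 'a) \<Rightarrow> complex"
  proof -
    have [measurable]: "H \<in> borel_measurable ?P'"
      using that measurable_cong_sets[OF sets_P' refl] by blast
    have "(\<integral>\<omega>. ?c \<omega> *\<^sub>R H \<omega> \<partial>?P') = (\<integral>\<omega>. H \<omega> \<partial>density ?P' (\<lambda>\<omega>. ennreal (?c \<omega>)))"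
      using c01 by (intro integral_density[symmetric]) auto
    also have "\<dots> = (\<integral>\<omega>. ?g \<omega> *\<^sub>R H \<omega> \<partial>?P)"
      unfolding dens_n[symmetric] using g0n by (intro integral_density) auto
    finally show ?thesis .
  qed
  have c_int: "integrable ?P' ?c"
    using c01 by (intro P'.integrable_const_bound[where B=1]) auto
  have F_int: "integrable ?P' F"
    using F1 by (intro P'.integrable_const_bound[where B=1]) auto
  have cF_int: "integrable ?P' (\<lambda>\<omega>. ?c \<omega> *\<^sub>R F \<omega>)"
    using F1 c01 by (intro P'.integrable_const_bound[where B=1]) (auto intro!: mult_le_one simp del: of_real_prod)
  have g_int_n: "integrable ?P ?g" by (rule PiM_integrable_prod) (auto intro: g_int)
  have gF_int: "integrable ?P (\<lambda>\<omega>. ?g \<omega> *\<^sub>R F \<omega>)"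
    using F1 g0n by (intro Bochner_Integration.integrable_bound[OF g_int_n]) (auto intro!: mult_left_le)
  have \<Lambda>F_int: "integrable ?P (\<lambda>\<omega>. F \<omega> * of_real (\<Lambda> \<omega>))"
    using F1 by (intro Bochner_Integration.integrable_bound[OF \<Lambda>]) (auto simp: norm_mult intro!: mult_left_le_one_le)
  have "of_real (\<integral>\<omega>. ?c \<omega> \<partial>?P') = (of_real (\<integral>\<omega>. ?g \<omega> \<partial>?P) :: complex)"
    using change[of "\<lambda>_. 1"] by (simp add: scaleR_conv_of_real del: of_real_prod)
  then have mass: "(\<integral>\<omega>. ?c \<omega> \<partial>?P') = (\<integral>x. g x \<partial>M) ^ n"
    using PiM_integral_prod[OF _ g_int, of "{..<n}"] by (simp del: of_real_prod of_real_power)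
  \<comment> \<open>The alternative is split along the n-fold product of \<open>C\<close>: inside,
    the integral is carried over to \<open>M\<close> by \<open>change\<close>; outside, only mass 1
    - (integral of g)^n is left.\<close>
  have "(\<integral>\<omega>. F \<omega> \<partial>?P') - (\<integral>\<omega>. F \<omega> * of_real (\<Lambda> \<omega>) \<partial>?P)
     = ((\<integral>\<omega>. F \<omega> \<partial>?P') - (\<integral>\<omega>. ?c \<omega> *\<^sub>R F \<omega> \<partial>?P')) + ((\<integral>\<omega>. ?g \<omega> *\<^sub>R F \<omega> \<partial>?P) - (\<integral>\<omega>. F \<omega> * of_real (\<Lambda> \<omega>) \<partial>?P))"
    using change[OF F] by simp
  also have "\<dots> = (\<integral>\<omega>. F \<omega> - ?c \<omega> *\<^sub>R F \<omega> \<partial>?P') + (\<integral>\<omega>. ?g \<omega> *\<^sub>R F \<omega> - F \<omega> * of_real (\<Lambda> \<omega>) \<partial>?P)"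
    using F_int cF_int gF_int \<Lambda>F_int by simp
  also have "norm \<dots> \<le> (\<integral>\<omega>. 1 - ?c \<omega> \<partial>?P') + (\<integral>\<omega>. \<bar>?g \<omega> - \<Lambda> \<omega>\<bar> \<partial>?P)"
  proof (rule norm_triangle_le, rule add_mono)
    show "norm (\<integral>\<omega>. F \<omega> - ?c \<omega> *\<^sub>R F \<omega> \<partial>?P') \<le> (\<integral>\<omega>. 1 - ?c \<omega> \<partial>?P')"
    proof (rule order_trans[OF integral_norm_bound], rule integral_mono)
      fix \<omega>
      have "F \<omega> - ?c \<omega> *\<^sub>R F \<omega> = (1 - ?c \<omega>) *\<^sub>R F \<omega>" by (simp add: algebra_simps)
      then show "norm (F \<omega> - ?c \<omega> *\<^sub>R F \<omega>) \<le> 1 - ?c \<omega>"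
        using F1[of \<omega>] c01[of \<omega>] by (auto intro!: mult_left_le)
    qed (use F_int cF_int c_int in auto)
    show "norm (\<integral>\<omega>. ?g \<omega> *\<^sub>R F \<omega> - F \<omega> * of_real (\<Lambda> \<omega>) \<partial>?P) \<le> (\<integral>\<omega>. \<bar>?g \<omega> - \<Lambda> \<omega>\<bar> \<partial>?P)"
    proof (rule order_trans[OF integral_norm_bound], rule integral_mono)
      fix \<omega>
      have "?g \<omega> *\<^sub>R F \<omega> - F \<omega> * of_real (\<Lambda> \<omega>) = (?g \<omega> - \<Lambda> \<omega>) *\<^sub>R F \<omega>"
        by (simp add: scaleR_conv_of_real algebra_simps)
      then show "norm (?g \<omega> *\<^sub>R F \<omega> - F \<omega> * of_real (\<Lambda> \<omega>)) \<le> \<bar>?g \<omega> - \<Lambda> \<omega>\<bar>"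
        using F1[of \<omega>] by (auto intro!: mult_left_le)
    qed (use gF_int \<Lambda>F_int g_int_n \<Lambda> in auto)
  qed
  also have "(\<integral>\<omega>. 1 - ?c \<omega> \<partial>?P') = 1 - (\<integral>x. g x \<partial>M) ^ n"
    using c_int mass by (simp add: P'.prob_space)
  finally show ?thesis .
qed

text \<open>Two errors have to vanish: the mass carried by the singular parts, by
  \<open>mass\<close>, and the L1 distance between likelihood ratio and surrogate. The test
  functions may change with n, as the statistics they come from are arbitrary.\<close>

theorem (in prob_space) local_alternative_limit:
  fixes g :: "nat \<Rightarrow> 'a \<Rightarrow> real" and \<zeta> :: "'a \<Rightarrow> real" and F :: "nat \<Rightarrow> (nat \<Rightarrow> 'a) \<Rightarrow> complex"
  assumes M': "\<And>n. prob_space (M' n)" "\<And>n. sets (M' n) = sets M" "\<And>n. C n \<in> sets M"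
    and dens: "\<And>n. density M (\<lambda>x. ennreal (g n x)) = density (M' n) (indicator (C n))"
    and g: "\<And>n. g n \<in> borel_measurable M" "\<And>n x. 0 \<le> g n x" "\<And>n. integrable M (g n)"
    and \<zeta>: "\<zeta> \<in> borel_measurable M" "integrable M (\<lambda>x. (\<zeta> x)\<^sup>2)" "(\<integral>x. \<zeta> x \<partial>M) = 0"
    and mass: "(\<lambda>n. real n * ((\<integral>x. g n x \<partial>M) - 1)) \<longlonglongrightarrow> 0"
    and hell: "(\<lambda>n. real n * (\<integral>x. (sqrt (g n x) - 1 - \<zeta> x / (2 * sqrt n))\<^sup>2 \<partial>M)) \<longlonglongrightarrow> 0"
    and F: "\<And>n. F n \<in> borel_measurable (\<Pi>\<^sub>M i\<in>{..<n}. M)" "\<And>n \<omega>. norm (F n \<omega>) \<le> 1"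
  shows "(\<lambda>n. (\<integral>\<omega>. F n \<omega> \<partial>(\<Pi>\<^sub>M i\<in>{..<n}. M' n))
      - (\<integral>\<omega>. F n \<omega> * of_real (\<Prod>j<n. 1 + \<zeta> (\<omega> j) / sqrt n) \<partial>(\<Pi>\<^sub>M i\<in>{..<n}. M))) \<longlonglongrightarrow> 0"
proof (rule Lim_null_comparison)
  let ?L = "\<lambda>n \<omega>. \<Prod>j<n. 1 + \<zeta> (\<omega> j) / sqrt (real n)"
  have z1: "integrable M \<zeta>" by (rule square_integrable_imp_integrable) (use \<zeta> in auto)
  have "integrable (\<Pi>\<^sub>M i\<in>{..<n}. M) (?L n)" for n
    by (rule PiM_integrable_prod[of "{..<n}" "\<lambda>x. 1 + \<zeta> x / sqrt n"]) (use z1 in auto)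
  then show "\<forall>\<^sub>F n in sequentially. norm ((\<integral>\<omega>. F n \<omega> \<partial>(\<Pi>\<^sub>M i\<in>{..<n}. M' n))
      - (\<integral>\<omega>. F n \<omega> * of_real (?L n \<omega>) \<partial>(\<Pi>\<^sub>M i\<in>{..<n}. M)))
      \<le> (1 - (\<integral>x. g n x \<partial>M) ^ n) + (\<integral>\<omega>. \<bar>(\<Prod>j<n. g n (\<omega> j)) - ?L n \<omega>\<bar> \<partial>(\<Pi>\<^sub>M i\<in>{..<n}. M))"
    by (intro always_eventually allI PiM_integral_alternative_le[OF M' g dens F])
  have "(\<lambda>n. (1 - (\<integral>x. g n x \<partial>M) ^ n) + (\<integral>\<omega>. \<bar>(\<Prod>j<n. g n (\<omega> j)) - ?L n \<omega>\<bar> \<partial>(\<Pi>\<^sub>M i\<in>{..<n}. M))) \<longlonglongrightarrow> (1 - exp 0) + 0"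
    by (intro tendsto_intros power_tendsto_exp_real mass likelihood_approximation g \<zeta> hell)
  then show "(\<lambda>n. (1 - (\<integral>x. g n x \<partial>M) ^ n) + (\<integral>\<omega>. \<bar>(\<Prod>j<n. g n (\<omega> j)) - ?L n \<omega>\<bar> \<partial>(\<Pi>\<^sub>M i\<in>{..<n}. M))) \<longlonglongrightarrow> 0"
    by simp
qed

section \<open>Conditional expectation given a random element\<close>

text \<open>The Doob-Dynkin factorisation, by induction over nonnegative measurable functions:
  indicators come from preimages, and each closure operation is repeated on the factors.\<close>

lemma vimage_algebra_factor_ennreal:
  fixes Z :: "'a \<Rightarrow> ennreal"
  assumes X: "X \<in> S \<rightarrow> space N" and Z: "Z \<in> borel_measurable (vimage_algebra S X N)"
  shows "\<exists>k\<in>borel_measurable N. \<forall>x\<in>S. Z x = k (X x)"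
  using Z
proof (induction rule: borel_measurable_induct)
  case (cong f g)
  then show ?case by simp
next
  case (set A)
  then obtain B where "B \<in> sets N" "A = X -` B \<inter> S"
    using X by (auto simp: sets_vimage_algebra2)
  then show ?case
    by (intro bexI[of _ "indicator B"]) (auto simp: indicator_def)
next
  case (mult u c)
  then obtain k where "k \<in> borel_measurable N" "\<forall>x\<in>S. u x = k (X x)" by blast
  then show ?case by (intro bexI[of _ "\<lambda>y. c * k y"]) auto
next
  case (add u v)
  then obtain k l where "k \<in> borel_measurable N" "\<forall>x\<in>S. u x = k (X x)"
    "l \<in> borel_measurable N" "\<forall>x\<in>S. v x = l (X x)" by blast
  then show ?case by (intro bexI[of _ "\<lambda>y. k y + l y"]) (auto simp: add.commute)
next
  case (seq U)
  then have "\<forall>i. \<exists>k. k \<in> borel_measurable N \<and> (\<forall>x\<in>S. U i x = k (X x))"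
    using seq.IH unfolding Bex_def by blast
  then obtain k where k: "\<And>i. k i \<in> borel_measurable N" "\<And>i x. x \<in> S \<Longrightarrow> U i x = k i (X x)" by metis
  show ?case
  proof (intro bexI[of _ "\<lambda>y. SUP i. k i y"] ballI)
    show "(SUP i. U i) x = (SUP i. k i (X x))" if "x \<in> S" for x
      unfolding SUP_apply using k(2)[OF that] by simp
    show "(\<lambda>y. SUP i. k i y) \<in> borel_measurable N"
      by (rule borel_measurable_SUP) (use k in auto)
  qed
qed

lemma vimage_algebra_factor_real:
  fixes Z :: "'a \<Rightarrow> real"
  assumes X: "X \<in> S \<rightarrow> space N" and Z[measurable]: "Z \<in> borel_measurable (vimage_algebra S X N)"
  shows "\<exists>k\<in>borel_measurable N. \<forall>x\<in>S. Z x = k (X x)"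
proof -
  \<comment> \<open>\<open>ennreal\<close> sends negative numbers to 0, so \<open>k\<close> and
    \<open>l\<close> factor the positive and the negative part.\<close>
  have 1: "(\<lambda>x. ennreal (Z x)) \<in> borel_measurable (vimage_algebra S X N)" by measurable
  have 2: "(\<lambda>x. ennreal (- Z x)) \<in> borel_measurable (vimage_algebra S X N)" by measurable
  obtain k where k[measurable]: "k \<in> borel_measurable N" and keq: "\<forall>x\<in>S. ennreal (Z x) = k (X x)"
    using vimage_algebra_factor_ennreal[OF X 1] by blast
  obtain l where l[measurable]: "l \<in> borel_measurable N" and leq: "\<forall>x\<in>S. ennreal (- Z x) = l (X x)"
    using vimage_algebra_factor_ennreal[OF X 2] by blast
  have "Z x = enn2real (k (X x)) - enn2real (l (X x))" if "x \<in> S" for x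
  proof -
    have "enn2real (k (X x)) = max 0 (Z x)" "enn2real (l (X x)) = max 0 (- Z x)"
      using keq leq that by (auto simp: max_def enn2real_eq_posreal_iff ennreal_neg simp flip: keq leq)
    then show ?thesis by simp
  qed
  then show ?thesis
    by (intro bexI[of _ "\<lambda>y. enn2real (k y) - enn2real (l y)"]) auto
qed

lemma (in prob_space) sigma_finite_subalgebra_vimage:
  assumes "X \<in> measurable M N"
  shows "sigma_finite_subalgebra M (vimage_algebra (space M) X N)"
proof (rule finite_measure_subalgebra_is_sigma_finite)
  have "subalgebra M (vimage_algebra (space M) X N)"
    unfolding subalgebra_def
  proof (intro conjI subsetI)
    have "X \<in> space M \<rightarrow> space N"
      using assms by (auto simp: measurable_space)
    then show "A \<in> sets (vimage_algebra (space M) X N) \<Longrightarrow> A \<in> sets M" for A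
      using assms by (auto simp: sets_vimage_algebra2 intro: measurable_sets)
  qed simp
  then show "finite_measure_subalgebra M (vimage_algebra (space M) X N)"
    by (simp add: finite_measure_subalgebra_def finite_measure_subalgebra_axioms_def finite_measure_axioms)
qed

text \<open>The existence statement that makes the choice in \<open>cond_exp_X\<close>
  meaningful.\<close>

lemma (in prob_space) cond_exp_factor:
  fixes Z :: "'a \<Rightarrow> real"
  assumes "X \<in> measurable M N"
  shows "\<exists>k. k \<in> borel_measurable N \<and>
    (AE z in M. real_cond_exp M (vimage_algebra (space M) X N) Z z = k (X z))"
proof -
  have "real_cond_exp M (vimage_algebra (space M) X N) Z \<in> borel_measurable (vimage_algebra (space M) X N)"
    by (rule borel_measurable_cond_exp)
  moreover have "X \<in> space M \<rightarrow> space N"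
    using assms by (auto simp: measurable_space)
  ultimately obtain k where "k \<in> borel_measurable N"
    "\<forall>z\<in>space M. real_cond_exp M (vimage_algebra (space M) X N) Z z = k (X z)"
    using vimage_algebra_factor_real by metis
  then show ?thesis by (intro exI[of _ k]) (auto intro!: AE_I2)
qed

text \<open>Stated for an arbitrary version \<open>k\<close>, since the chosen one is unknown.
  Bounded complex test functions serve the replacement inside products; real ones under an
  integrability condition serve the covariance computations.\<close>

lemma (in prob_space) cond_exp_version_integral:
  fixes k :: "'x \<Rightarrow> real" and F :: "'x \<Rightarrow> complex"
  fixes Z :: "'a \<Rightarrow> real"
  assumes X[measurable]: "X \<in> measurable M N" and Z: "integrable M Z"
    and k[measurable]: "k \<in> borel_measurable N"
    and ver: "AE z in M. real_cond_exp M (vimage_algebra (space M) X N) Z z = k (X z)"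
  shows "integrable M (\<lambda>z. k (X z))"
    and "(\<integral>z. k (X z) \<partial>M) = (\<integral>z. Z z \<partial>M)"
    and "F \<in> borel_measurable N \<Longrightarrow> (\<And>x. norm (F x) \<le> 1) \<Longrightarrow>
      (\<integral>z. F (X z) * of_real (Z z) \<partial>M) = (\<integral>z. F (X z) * of_real (k (X z)) \<partial>M)"
    and "H \<in> borel_measurable N \<Longrightarrow> integrable M (\<lambda>z. H (X z) * Z z) \<Longrightarrow>
      integrable M (\<lambda>z. H (X z) * k (X z)) \<and> (\<integral>z. H (X z) * Z z \<partial>M) = (\<integral>z. H (X z) * k (X z) \<partial>M)"
proof -
  let ?V = "vimage_algebra (space M) X N"
  let ?E = "real_cond_exp M ?V Z"
  interpret V: sigma_finite_subalgebra M ?V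
    by (rule sigma_finite_subalgebra_vimage) fact
  have [measurable]: "Z \<in> borel_measurable M" using Z by auto
  have XV: "X \<in> measurable ?V N"
    using measurable_space[OF X] by (intro measurable_vimage_algebra1) auto
  have real: "integrable M (\<lambda>z. H (X z) * k (X z)) \<and> (\<integral>z. H (X z) * Z z \<partial>M) = (\<integral>z. H (X z) * k (X z) \<partial>M)"
    if H[measurable]: "H \<in> borel_measurable N" and int: "integrable M (\<lambda>z. H (X z) * Z z)" for H
  proof -
    have HX: "(\<lambda>z. H (X z)) \<in> borel_measurable ?V"
      using measurable_compose[OF XV H] .
    have ae: "AE z in M. H (X z) * ?E z = H (X z) * k (X z)"
      using ver by eventually_elim simp
    have "integrable M (\<lambda>z. H (X z) * ?E z)" and eq: "(\<integral>z. H (X z) * ?E z \<partial>M) = (\<integral>z. H (X z) * Z z \<partial>M)"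
      using V.real_cond_exp_intg[OF int HX] by auto
    then show ?thesis
      using integrable_cong_AE[OF _ _ ae] integral_cong_AE[OF _ _ ae] by (simp add: eq[symmetric])
  qed
  show "integrable M (\<lambda>z. k (X z))" "(\<integral>z. k (X z) \<partial>M) = (\<integral>z. Z z \<partial>M)"
    using real[of "\<lambda>_. 1"] Z by auto
  show "H \<in> borel_measurable N \<Longrightarrow> integrable M (\<lambda>z. H (X z) * Z z) \<Longrightarrow>
      integrable M (\<lambda>z. H (X z) * k (X z)) \<and> (\<integral>z. H (X z) * Z z \<partial>M) = (\<integral>z. H (X z) * k (X z) \<partial>M)"
    by (rule real)
  assume F[measurable]: "F \<in> borel_measurable N" and F1: "\<And>x. norm (F x) \<le> 1"
  have int: "integrable M (\<lambda>z. H (X z) * Z z)" if [measurable]: "H \<in> borel_measurable N" and "\<And>x. \<bar>H x\<bar> \<le> 1" for H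
    using that by (intro Bochner_Integration.integrable_bound[OF Z]) (auto simp: abs_mult intro!: mult_left_le_one_le)
  have re: "integrable M (\<lambda>z. Re (F (X z)) * Z z)" and im: "integrable M (\<lambda>z. Im (F (X z)) * Z z)"
    using F1 abs_Re_le_cmod abs_Im_le_cmod by (auto intro!: int intro: order_trans)
  \<comment> \<open>The library conditional expectation is real, so the complex test function is
    taken apart.\<close>
  have split: "F (X z) * of_real c = of_real (Re (F (X z)) * c) + \<i> * of_real (Im (F (X z)) * c)" for z c
    by (simp add: complex_eq_iff)
  note r = real[OF _ re] real[OF _ im]
  show "(\<integral>z. F (X z) * of_real (Z z) \<partial>M) = (\<integral>z. F (X z) * of_real (k (X z)) \<partial>M)"
    unfolding split using r re im by (simp del: of_real_mult)
qed

text \<open>Conditional Jensen for the square: conditioning contracts L2. This is how smallness of a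
  remainder passes to its conditional expectation.\<close>

lemma (in prob_space) cond_exp_version_square:
  fixes Z :: "'a \<Rightarrow> real"
  assumes X[measurable]: "X \<in> measurable M N" and Z[measurable]: "Z \<in> borel_measurable M"
    and Z2: "integrable M (\<lambda>z. (Z z)\<^sup>2)" and k[measurable]: "k \<in> borel_measurable N"
    and ver: "AE z in M. real_cond_exp M (vimage_algebra (space M) X N) Z z = k (X z)"
  shows "integrable M (\<lambda>z. (k (X z))\<^sup>2)" and "(\<integral>z. (k (X z))\<^sup>2 \<partial>M) \<le> (\<integral>z. (Z z)\<^sup>2 \<partial>M)"
proof -
  let ?V = "vimage_algebra (space M) X N"
  let ?E = "real_cond_exp M ?V Z" and ?E2 = "real_cond_exp M ?V (\<lambda>z. (Z z)\<^sup>2)"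
  interpret V: sigma_finite_subalgebra M ?V
    by (rule sigma_finite_subalgebra_vimage) fact
  have Z1: "integrable M Z" by (rule square_integrable_imp_integrable) (use Z2 in auto)
  have "AE z in M. (?E z)\<^sup>2 \<le> ?E2 z"
    by (rule V.real_cond_exp_jensens_inequality(2)[where I=UNIV and q="\<lambda>x. x\<^sup>2"])
      (use Z1 Z2 in \<open>auto intro!: convex_power2\<close>)
  then have le: "AE z in M. (k (X z))\<^sup>2 \<le> ?E2 z"
    using ver by eventually_elim simp
  have E2: "integrable M ?E2" "(\<integral>z. ?E2 z \<partial>M) = (\<integral>z. (Z z)\<^sup>2 \<partial>M)"
    using V.real_cond_exp_int[OF Z2] by auto
  show int: "integrable M (\<lambda>z. (k (X z))\<^sup>2)"
    by (rule Bochner_Integration.integrable_bound[OF E2(1)]) (use le in auto)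
  show "(\<integral>z. (k (X z))\<^sup>2 \<partial>M) \<le> (\<integral>z. (Z z)\<^sup>2 \<partial>M)"
    unfolding E2(2)[symmetric] by (rule integral_mono_AE) (use int E2 le in auto)
qed

text \<open>Real and imaginary parts are conditioned separately; the contraction survives because
  the squared modulus is the sum of their squares.\<close>

lemma (in prob_space) complex_cond_exp_exists:
  fixes Z :: "'a \<Rightarrow> complex"
  assumes X[measurable]: "X \<in> measurable M N" and Z[measurable]: "Z \<in> borel_measurable M"
    and Z2: "integrable M (\<lambda>z. (cmod (Z z))\<^sup>2)"
  obtains k where "k \<in> borel_measurable N" "integrable M (\<lambda>z. k (X z))"
    "(\<integral>z. k (X z) \<partial>M) = (\<integral>z. Z z \<partial>M)"
    "integrable M (\<lambda>z. (cmod (k (X z)))\<^sup>2)" "(\<integral>z. (cmod (k (X z)))\<^sup>2 \<partial>M) \<le> (\<integral>z. (cmod (Z z))\<^sup>2 \<partial>M)"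
    "\<And>F. F \<in> borel_measurable N \<Longrightarrow> (\<And>x. norm (F x) \<le> 1) \<Longrightarrow>
      (\<integral>z. F (X z) * Z z \<partial>M) = (\<integral>z. F (X z) * k (X z) \<partial>M)"
proof -
  let ?V = "vimage_algebra (space M) X N"
  have re2: "integrable M (\<lambda>z. (Re (Z z))\<^sup>2)" and im2: "integrable M (\<lambda>z. (Im (Z z))\<^sup>2)"
    by (auto intro!: Bochner_Integration.integrable_bound[OF Z2] simp: cmod_power2)
  have re: "integrable M (\<lambda>z. Re (Z z))" and im: "integrable M (\<lambda>z. Im (Z z))"
    by (rule square_integrable_imp_integrable; use re2 im2 in simp)+
  obtain a where a[measurable]: "a \<in> borel_measurable N" and va: "AE z in M. real_cond_exp M ?V (\<lambda>z. Re (Z z)) z = a (X z)"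
    using cond_exp_factor[OF X] by blast
  obtain b where b[measurable]: "b \<in> borel_measurable N" and vb: "AE z in M. real_cond_exp M ?V (\<lambda>z. Im (Z z)) z = b (X z)"
    using cond_exp_factor[OF X] by blast
  note A = cond_exp_version_integral[OF X re a va] and B = cond_exp_version_integral[OF X im b vb]
  note A2 = cond_exp_version_square[OF X _ re2 a va] and B2 = cond_exp_version_square[OF X _ im2 b vb]
  define k where "k x = Complex (a x) (b x)" for x
  have k_eq: "k x = of_real (a x) + \<i> * of_real (b x)" for x
    by (simp add: k_def complex_eq_iff)
  have Z_eq: "Z z = of_real (Re (Z z)) + \<i> * of_real (Im (Z z))" for z
    by (simp add: complex_eq_iff)
  have k_norm: "(cmod (k x))\<^sup>2 = (a x)\<^sup>2 + (b x)\<^sup>2" for x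
    by (simp add: k_def cmod_power2)
  have aX: "integrable M (\<lambda>z. complex_of_real (a (X z)))" "integrable M (\<lambda>z. complex_of_real (b (X z)))"
    using A(1) B(1) by auto
  show thesis
  proof (rule that[of k])
    show k[measurable]: "k \<in> borel_measurable N" unfolding k_eq[abs_def] by measurable
    show "integrable M (\<lambda>z. k (X z))" using aX by (simp add: k_eq)
    have "(\<integral>z. Z z \<partial>M) = (\<integral>z. of_real (Re (Z z)) + \<i> * of_real (Im (Z z)) \<partial>M)"
      using Z_eq by simp
    then show "(\<integral>z. k (X z) \<partial>M) = (\<integral>z. Z z \<partial>M)"
      using A(1,2) B(1,2) re im by (simp add: k_eq)
    show "integrable M (\<lambda>z. (cmod (k (X z)))\<^sup>2)"
      using A2 B2 by (simp add: k_norm)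
    show "(\<integral>z. (cmod (k (X z)))\<^sup>2 \<partial>M) \<le> (\<integral>z. (cmod (Z z))\<^sup>2 \<partial>M)"
      using A2 B2 re2 im2 by (simp add: k_norm cmod_power2[of "Z _"] add_mono)
    fix F :: "'b \<Rightarrow> complex" assume F[measurable]: "F \<in> borel_measurable N" and F1: "\<And>x. norm (F x) \<le> 1"
    have bd: "integrable M (\<lambda>z. F (X z) * of_real (v z))" if "integrable M v" for v :: "'a \<Rightarrow> real"
      using that F1 by (intro Bochner_Integration.integrable_bound[OF that]) (auto simp: norm_mult intro!: mult_left_le_one_le)
    have "(\<integral>z. F (X z) * Z z \<partial>M) = (\<integral>z. F (X z) * of_real (Re (Z z)) + \<i> * (F (X z) * of_real (Im (Z z))) \<partial>M)"
      by (subst Z_eq) (simp add: algebra_simps)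
    also have "\<dots> = (\<integral>z. F (X z) * of_real (a (X z)) + \<i> * (F (X z) * of_real (b (X z))) \<partial>M)"
      using bd[OF re] bd[OF im] bd[OF A(1)] bd[OF B(1)] A(3)[OF F F1] B(3)[OF F F1] by simp
    finally show "(\<integral>z. F (X z) * Z z \<partial>M) = (\<integral>z. F (X z) * k (X z) \<partial>M)"
      by (simp add: k_eq algebra_simps)
  qed
qed

section \<open>Tilted characteristic functions\<close>

text \<open>The sharp bounds near 0 drive pointwise limits; the bounds by 2 and by 2|y| allow
  domination with second moments only.\<close>

lemma norm_iexp_diff_le:
  fixes y :: real
  shows "cmod (iexp y - 1) \<le> \<bar>y\<bar>" "cmod (iexp y - 1) \<le> 2"
    "cmod (iexp y - 1 - \<i> * y) \<le> y\<^sup>2 / 2" "cmod (iexp y - 1 - \<i> * y) \<le> 2 * \<bar>y\<bar>"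
    "cmod (iexp y - 1 - \<i> * y + y\<^sup>2 / 2) \<le> \<bar>y\<bar> ^ 3 / 6"
proof -
  show "cmod (iexp y - 1) \<le> \<bar>y\<bar>" using iexp_approx1[of y 0] by simp
  have "cmod (iexp y - 1) \<le> cmod (iexp y) + cmod 1" by (rule norm_triangle_ineq4)
  then show "cmod (iexp y - 1) \<le> 2" by simp
  show "cmod (iexp y - 1 - \<i> * y) \<le> y\<^sup>2 / 2" using iexp_approx1[of y 1] by (simp add: algebra_simps numeral_2_eq_2)
  show "cmod (iexp y - 1 - \<i> * y) \<le> 2 * \<bar>y\<bar>" using iexp_approx2[of y 1] by (simp add: algebra_simps)
  show "cmod (iexp y - 1 - \<i> * y + y\<^sup>2 / 2) \<le> \<bar>y\<bar> ^ 3 / 6"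
    using iexp_approx1[of y 2] by (simp add: algebra_simps numeral_2_eq_2 numeral_3_eq_3 power_mult_distrib)
qed

text \<open>One coordinate of the characteristic function weighted by the surrogate likelihood
  ratio; \<open>p\<close> and \<open>z\<close> stand for values of \<psi> and of the score. The
  parameter \<open>r\<close> is complex to permit analytic continuation in the direction.\<close>

definition tilt :: "real \<Rightarrow> complex \<Rightarrow> nat \<Rightarrow> real \<Rightarrow> real \<Rightarrow> complex" where
  "tilt t r n p z = iexp (t * p / sqrt n) * (1 + r * z / sqrt n)"

text \<open>The tilt without its terms of order 0 and 1 in 1/sqrt n.\<close>

definition tilt_rest :: "real \<Rightarrow> complex \<Rightarrow> nat \<Rightarrow> real \<Rightarrow> real \<Rightarrow> complex" where
  "tilt_rest t r n p z = tilt t r n p z - 1 - (\<i> * t * p + r * z) / sqrt n"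

lemma tilt_rest_eq:
  "tilt_rest t r n p z = (iexp (t * p / sqrt n) - 1 - \<i> * (t * p / sqrt n))
     + (iexp (t * p / sqrt n) - 1) * (r * z / sqrt n)"
  by (simp add: tilt_rest_def tilt_def algebra_simps add_divide_distrib)

text \<open>The right side is of degree two in \<open>p\<close> and \<open>z\<close>, hence an
  integrable majorant for square integrable \<psi> and \<zeta>.\<close>

lemma norm_tilt_rest_le:
  "real n * cmod (tilt_rest t r n p z) \<le> t\<^sup>2 * p\<^sup>2 / 2 + \<bar>t\<bar> * cmod r * \<bar>p * z\<bar>"
proof (cases "n = 0")
  case False
  define s where "s = sqrt (real n)"
  have s: "s > 0" "real n = s * s" using False by (auto simp: s_def)
  define y where "y = t * p / s"
  have "cmod (tilt_rest t r n p z) \<le> cmod (iexp y - 1 - \<i> * y) + cmod (iexp y - 1) * cmod (r * z / s)"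
    unfolding tilt_rest_eq y_def s_def by (rule norm_triangle_le) (simp add: norm_mult norm_divide)
  also have "\<dots> \<le> y\<^sup>2 / 2 + \<bar>y\<bar> * cmod (r * z / s)"
    using norm_iexp_diff_le[of y] by (intro add_mono mult_right_mono) auto
  finally have "real n * cmod (tilt_rest t r n p z) \<le> s * s * (y\<^sup>2 / 2 + \<bar>y\<bar> * cmod (r * z / s))"
    unfolding s(2) using s(1) by (intro mult_left_mono) auto
  also have "\<dots> = t\<^sup>2 * p\<^sup>2 / 2 + \<bar>t\<bar> * cmod r * \<bar>p * z\<bar>"
    using s(1) by (simp add: y_def norm_mult norm_divide abs_mult field_simps power2_eq_square)
  finally show ?thesis .
qed simp

text \<open>Squaring the previous bound would call for fourth moments; the cruder linear bounds on
  the exponential keep the degree at two.\<close>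

lemma norm_tilt_rest_square_le:
  "real n * (cmod (tilt_rest t r n p z))\<^sup>2 \<le> 8 * t\<^sup>2 * p\<^sup>2 + 8 * (cmod r)\<^sup>2 * z\<^sup>2"
proof (cases "n = 0")
  case False
  define s where "s = sqrt (real n)"
  have s: "s > 0" "real n = s\<^sup>2" using False by (auto simp: s_def)
  define y where "y = t * p / s"
  have "cmod (tilt_rest t r n p z) \<le> cmod (iexp y - 1 - \<i> * y) + cmod (iexp y - 1) * cmod (r * z / s)"
    unfolding tilt_rest_eq y_def s_def by (rule norm_triangle_le) (simp add: norm_mult norm_divide)
  also have "\<dots> \<le> 2 * \<bar>y\<bar> + 2 * cmod (r * z / s)"
    using norm_iexp_diff_le[of y] by (intro add_mono mult_right_mono) auto
  finally have "s * cmod (tilt_rest t r n p z) \<le> s * (2 * \<bar>y\<bar> + 2 * cmod (r * z / s))"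
    using s(1) by (intro mult_left_mono) auto
  also have "\<dots> = 2 * \<bar>t * p\<bar> + 2 * (cmod r * \<bar>z\<bar>)"
    using s(1) by (simp add: y_def norm_mult norm_divide abs_mult field_simps)
  finally have "(s * cmod (tilt_rest t r n p z))\<^sup>2 \<le> (2 * \<bar>t * p\<bar> + 2 * (cmod r * \<bar>z\<bar>))\<^sup>2"
    using s(1) by (intro power_mono) auto
  also have "\<dots> \<le> 8 * \<bar>t * p\<bar>\<^sup>2 + 8 * (cmod r * \<bar>z\<bar>)\<^sup>2"
  proof -
    have "(2 * a + 2 * b)\<^sup>2 \<le> 8 * a\<^sup>2 + 8 * b\<^sup>2" for a b :: real
      using zero_le_power2[of "a - b"] by (simp add: power2_eq_square algebra_simps)
    then show ?thesis .
  qed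
  finally show ?thesis
    by (simp add: s(2) power_mult_distrib)
qed simp

text \<open>The limit collects the quadratic term of the exponential and the cross term between
  exponential and linear factor. \<open>A\<close> and \<open>B\<close> are the normalised Taylor
  errors of these two, each O(1/sqrt n).\<close>

lemma tilt_rest_tendsto:
  "(\<lambda>n. of_nat n * tilt_rest t r n p z) \<longlonglongrightarrow> of_real (- (t\<^sup>2 * p\<^sup>2 / 2)) + \<i> * t * r * (p * z)"
proof -
  define q where "q = t * p"
  define A where "A n = of_nat n * (iexp (q / sqrt n) - 1 - \<i> * (q / sqrt n) + (q / sqrt n)\<^sup>2 / 2)" for n :: nat
  define B where "B n = sqrt n * (iexp (q / sqrt n) - 1 - \<i> * (q / sqrt n))" for n :: nat
  have inv: "(\<lambda>n. inverse (sqrt (real n))) \<longlonglongrightarrow> 0"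
    by (intro tendsto_inverse_0_at_top filterlim_compose[OF sqrt_at_top] filterlim_real_sequentially)
  have A: "A \<longlonglongrightarrow> 0"
  proof (rule Lim_null_comparison)
    show "\<forall>\<^sub>F n in sequentially. norm (A n) \<le> \<bar>q\<bar> ^ 3 / 6 * inverse (sqrt (real n))"
      using eventually_gt_at_top[of 0]
    proof eventually_elim
      case (elim n)
      define s where "s = sqrt (real n)"
      have s: "s > 0" "real n = s * s" using elim by (auto simp: s_def)
      have "norm (A n) = (s * s) * cmod (iexp (q / s) - 1 - \<i> * (q / s) + (q / s)\<^sup>2 / 2)"
        unfolding A_def norm_mult s_def using elim by simp
      also have "\<dots> \<le> (s * s) * (\<bar>q / s\<bar> ^ 3 / 6)"
        using norm_iexp_diff_le(5)[of "q / s"] s(1) by (intro mult_left_mono) auto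
      also have "\<dots> = \<bar>q\<bar> ^ 3 / 6 * inverse s"
        using s(1) by (simp add: power_divide power3_eq_cube field_simps)
      finally show ?case by (simp add: s_def)
    qed
    show "(\<lambda>n. \<bar>q\<bar> ^ 3 / 6 * inverse (sqrt (real n))) \<longlonglongrightarrow> 0"
      using tendsto_mult[OF tendsto_const inv, of "\<bar>q\<bar> ^ 3 / 6"] by simp
  qed
  have B: "B \<longlonglongrightarrow> 0"
  proof (rule Lim_null_comparison)
    show "\<forall>\<^sub>F n in sequentially. norm (B n) \<le> q\<^sup>2 / 2 * inverse (sqrt (real n))"
      using eventually_gt_at_top[of 0]
    proof eventually_elim
      case (elim n)
      define s where "s = sqrt (real n)"
      have s: "s > 0" "real n = s * s" using elim by (auto simp: s_def)
      have "norm (B n) = s * cmod (iexp (q / s) - 1 - \<i> * (q / s))"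
        unfolding B_def norm_mult s_def using elim by simp
      also have "\<dots> \<le> s * ((q / s)\<^sup>2 / 2)"
        using norm_iexp_diff_le(3)[of "q / s"] s(1) by (intro mult_left_mono) auto
      also have "\<dots> = q\<^sup>2 / 2 * inverse s"
        using s(1) by (simp add: power_divide power2_eq_square field_simps)
      finally show ?case by (simp add: s_def)
    qed
    show "(\<lambda>n. q\<^sup>2 / 2 * inverse (sqrt (real n))) \<longlonglongrightarrow> 0"
      using tendsto_mult[OF tendsto_const inv, of "q\<^sup>2 / 2"] by simp
  qed
  have "(\<lambda>n. A n - of_real (q\<^sup>2 / 2) + (B n + \<i> * q) * (r * z)) \<longlonglongrightarrow> 0 - of_real (q\<^sup>2 / 2) + (0 + \<i> * q) * (r * z)"
    by (intro tendsto_intros A B)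
  moreover have "\<forall>\<^sub>F n in sequentially. A n - of_real (q\<^sup>2 / 2) + (B n + \<i> * q) * (r * z) = of_nat n * tilt_rest t r n p z"
    using eventually_gt_at_top[of 0]
  proof eventually_elim
    case (elim n)
    define s where "s = complex_of_real (sqrt (real n))"
    have s: "s \<noteq> 0" "of_nat n = s * s"
      using elim by (auto simp: s_def simp flip: of_real_mult)
    show ?case
      unfolding A_def B_def tilt_rest_eq q_def[symmetric] of_real_divide s_def[symmetric]
      using s by (simp add: field_simps power2_eq_square)
  qed
  ultimately show ?thesis
    by (simp add: tendsto_cong q_def power_mult_distrib mult_ac)
qed

lemma (in prob_space) tilt_integrable:
  fixes \<psi> \<zeta> :: "'a \<Rightarrow> real"
  assumes [measurable]: "\<psi> \<in> borel_measurable M" "\<zeta> \<in> borel_measurable M"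
    and L2: "integrable M (\<lambda>x. (\<psi> x)\<^sup>2)" "integrable M (\<lambda>x. (\<zeta> x)\<^sup>2)"
  shows "integrable M (\<lambda>x. tilt t r n (\<psi> x) (\<zeta> x))" "integrable M (\<lambda>x. tilt_rest t r n (\<psi> x) (\<zeta> x))"
    "integrable M (\<lambda>x. (cmod (tilt_rest t r n (\<psi> x) (\<zeta> x)))\<^sup>2)"
proof -
  have L1: "integrable M \<psi>" "integrable M \<zeta>"
    by (rule square_integrable_imp_integrable; use L2 in simp)+
  have c: "integrable M (\<lambda>x. complex_of_real (\<psi> x))" "integrable M (\<lambda>x. complex_of_real (\<zeta> x))"
    using L1 by auto
  have meas: "(\<lambda>x. tilt_rest t r n (\<psi> x) (\<zeta> x)) \<in> borel_measurable M"
    "(\<lambda>x. tilt t r n (\<psi> x) (\<zeta> x)) \<in> borel_measurable M"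
    unfolding tilt_rest_def tilt_def by measurable
  show tilt: "integrable M (\<lambda>x. tilt t r n (\<psi> x) (\<zeta> x))"
  proof (rule Bochner_Integration.integrable_bound)
    show "integrable M (\<lambda>x. 1 + r * \<zeta> x / sqrt n)" using c by simp
  qed (use meas in \<open>simp_all add: tilt_def norm_mult\<close>)
  then show "integrable M (\<lambda>x. tilt_rest t r n (\<psi> x) (\<zeta> x))"
    unfolding tilt_rest_def using c by (auto intro!: integrable_divide)
  show "integrable M (\<lambda>x. (cmod (tilt_rest t r n (\<psi> x) (\<zeta> x)))\<^sup>2)"
  proof (cases "n = 0")
    case True
    then show ?thesis by (simp add: tilt_rest_def tilt_def)
  next
    case False
    have b: "integrable M (\<lambda>x. (8 * t\<^sup>2 * (\<psi> x)\<^sup>2 + 8 * (cmod r)\<^sup>2 * (\<zeta> x)\<^sup>2) / n)"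
      using L2 by simp
    have "(cmod (tilt_rest t r n p z))\<^sup>2 \<le> (8 * t\<^sup>2 * p\<^sup>2 + 8 * (cmod r)\<^sup>2 * z\<^sup>2) / n" for p z
      using norm_tilt_rest_square_le[of n t r p z] False by (simp add: field_simps)
    then show ?thesis
      using meas by (intro Bochner_Integration.integrable_bound[OF b]) (auto intro!: AE_I2 intro: order_trans)
  qed
qed

text \<open>Orthogonality annihilates the cross term i t r E[\<psi> \<zeta>], the only place where
  \<open>r\<close> could enter the limit. Zero means remove the first-order terms.\<close>

lemma (in prob_space) tilt_mean:
  fixes \<psi> \<zeta> :: "'a \<Rightarrow> real"
  assumes [measurable]: "\<psi> \<in> borel_measurable M" "\<zeta> \<in> borel_measurable M"
    and L2: "integrable M (\<lambda>x. (\<psi> x)\<^sup>2)" "integrable M (\<lambda>x. (\<zeta> x)\<^sup>2)"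
    and mean: "(\<integral>x. \<psi> x \<partial>M) = 0" "(\<integral>x. \<zeta> x \<partial>M) = 0"
    and orth: "(\<integral>x. \<psi> x * \<zeta> x \<partial>M) = 0"
  shows "(\<lambda>n. of_nat n * (\<integral>x. tilt_rest t r n (\<psi> x) (\<zeta> x) \<partial>M)) \<longlonglongrightarrow> of_real (- (t\<^sup>2 * (\<integral>x. (\<psi> x)\<^sup>2 \<partial>M) / 2))"
    and "(\<integral>x. tilt t r n (\<psi> x) (\<zeta> x) \<partial>M) = 1 + (\<integral>x. tilt_rest t r n (\<psi> x) (\<zeta> x) \<partial>M)"
proof -
  have L1: "integrable M \<psi>" "integrable M \<zeta>"
    by (rule square_integrable_imp_integrable; use L2 in simp)+
  have c: "integrable M (\<lambda>x. complex_of_real (\<psi> x))" "integrable M (\<lambda>x. complex_of_real (\<zeta> x))"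
    using L1 by auto
  have meas: "(\<lambda>x. tilt_rest t r n (\<psi> x) (\<zeta> x)) \<in> borel_measurable M" for n
    unfolding tilt_rest_def tilt_def by measurable
  have pz: "integrable M (\<lambda>x. \<psi> x * \<zeta> x)"
    using L2 by (intro integrable_mult_L2) auto
  have "(\<lambda>n. \<integral>x. of_nat n * tilt_rest t r n (\<psi> x) (\<zeta> x) \<partial>M)
    \<longlonglongrightarrow> (\<integral>x. of_real (- (t\<^sup>2 * (\<psi> x)\<^sup>2 / 2)) + \<i> * t * r * (\<psi> x * \<zeta> x) \<partial>M)"
  proof (rule integral_dominated_convergence)
    show "integrable M (\<lambda>x. t\<^sup>2 * (\<psi> x)\<^sup>2 / 2 + \<bar>t\<bar> * cmod r * \<bar>\<psi> x * \<zeta> x\<bar>)"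
      using L2 pz by (auto intro!: integrable_divide simp del: abs_mult)
    show "AE x in M. norm (of_nat n * tilt_rest t r n (\<psi> x) (\<zeta> x)) \<le> t\<^sup>2 * (\<psi> x)\<^sup>2 / 2 + \<bar>t\<bar> * cmod r * \<bar>\<psi> x * \<zeta> x\<bar>" for n
      using norm_tilt_rest_le[of n] by (simp add: norm_mult)
    show "AE x in M. (\<lambda>n. of_nat n * tilt_rest t r n (\<psi> x) (\<zeta> x))
        \<longlonglongrightarrow> of_real (- (t\<^sup>2 * (\<psi> x)\<^sup>2 / 2)) + \<i> * t * r * (\<psi> x * \<zeta> x)"
      using tilt_rest_tendsto by simp
  qed (use meas in measurable)
  also have "(\<integral>x. of_real (- (t\<^sup>2 * (\<psi> x)\<^sup>2 / 2)) + \<i> * t * r * (\<psi> x * \<zeta> x) \<partial>M)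
     = of_real (\<integral>x. - (t\<^sup>2 * (\<psi> x)\<^sup>2 / 2) \<partial>M) + \<i> * t * r * of_real (\<integral>x. \<psi> x * \<zeta> x \<partial>M)"
  proof -
    have 1: "integrable M (\<lambda>x. complex_of_real (- (t\<^sup>2 * (\<psi> x)\<^sup>2 / 2)))"
      using L2 by (auto intro!: integrable_of_real simp del: of_real_minus)
    have 2: "integrable M (\<lambda>x. complex_of_real (\<psi> x * \<zeta> x))"
      using pz by (simp del: of_real_mult)
    have "integrable M (\<lambda>x. \<i> * t * r * complex_of_real (\<psi> x * \<zeta> x))"
      using 2 by (rule integrable_mult_right)
    then show ?thesis
      using 1 2 by (simp del: of_real_mult of_real_minus of_real_divide)
  qed
  finally show "(\<lambda>n. of_nat n * (\<integral>x. tilt_rest t r n (\<psi> x) (\<zeta> x) \<partial>M)) \<longlonglongrightarrow> of_real (- (t\<^sup>2 * (\<integral>x. (\<psi> x)\<^sup>2 \<partial>M) / 2))"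
    using L2 by (simp add: orth)
  show "(\<integral>x. tilt t r n (\<psi> x) (\<zeta> x) \<partial>M) = 1 + (\<integral>x. tilt_rest t r n (\<psi> x) (\<zeta> x) \<partial>M)"
  proof -
    have lin: "integrable M (\<lambda>x. (\<i> * t * \<psi> x + r * \<zeta> x) / sqrt n)"
      "(\<integral>x. (\<i> * t * \<psi> x + r * \<zeta> x) / sqrt n \<partial>M) = 0"
      using c mean by simp_all
    have t1: "tilt t r n (\<psi> x) (\<zeta> x) = 1 + (tilt_rest t r n (\<psi> x) (\<zeta> x) + (\<i> * t * \<psi> x + r * \<zeta> x) / sqrt n)" for x
      by (simp add: tilt_rest_def)
    show ?thesis
      unfolding t1 using lin tilt_integrable(2)[OF _ _ L2, of t r n] by (simp add: prob_space)
  qed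
qed

text \<open>Pointwise the rest is O(1/n), so n times its square is O(1/n) as well; the majorant has
  degree two.\<close>

lemma (in prob_space) tilt_rest_L2:
  fixes \<psi> \<zeta> :: "'a \<Rightarrow> real"
  assumes [measurable]: "\<psi> \<in> borel_measurable M" "\<zeta> \<in> borel_measurable M"
    and L2: "integrable M (\<lambda>x. (\<psi> x)\<^sup>2)" "integrable M (\<lambda>x. (\<zeta> x)\<^sup>2)"
  shows "(\<lambda>n. real n * (\<integral>x. (cmod (tilt_rest t r n (\<psi> x) (\<zeta> x)))\<^sup>2 \<partial>M)) \<longlonglongrightarrow> 0"
proof -
  have meas: "(\<lambda>x. tilt_rest t r n (\<psi> x) (\<zeta> x)) \<in> borel_measurable M" for n
    unfolding tilt_rest_def tilt_def by measurable
  have "(\<lambda>n. \<integral>x. real n * (cmod (tilt_rest t r n (\<psi> x) (\<zeta> x)))\<^sup>2 \<partial>M) \<longlonglongrightarrow> (\<integral>x. 0 \<partial>M)"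
  proof (rule integral_dominated_convergence)
    show "integrable M (\<lambda>x. 8 * t\<^sup>2 * (\<psi> x)\<^sup>2 + 8 * (cmod r)\<^sup>2 * (\<zeta> x)\<^sup>2)"
      using L2 by simp
    show "AE x in M. norm (real n * (cmod (tilt_rest t r n (\<psi> x) (\<zeta> x)))\<^sup>2) \<le> 8 * t\<^sup>2 * (\<psi> x)\<^sup>2 + 8 * (cmod r)\<^sup>2 * (\<zeta> x)\<^sup>2" for n
      using norm_tilt_rest_square_le[of n] by simp
    show "AE x in M. (\<lambda>n. real n * (cmod (tilt_rest t r n (\<psi> x) (\<zeta> x)))\<^sup>2) \<longlonglongrightarrow> 0"
    proof (rule AE_I2)
      fix x
      have "(\<lambda>n. (cmod (of_nat n * tilt_rest t r n (\<psi> x) (\<zeta> x)))\<^sup>2 * inverse (real n))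
         \<longlonglongrightarrow> (cmod (of_real (- (t\<^sup>2 * (\<psi> x)\<^sup>2 / 2)) + \<i> * t * r * (\<psi> x * \<zeta> x)))\<^sup>2 * 0"
        by (intro tendsto_intros tilt_rest_tendsto lim_inverse_n)
      moreover have "(cmod (of_nat n * tilt_rest t r n (\<psi> x) (\<zeta> x)))\<^sup>2 * inverse (real n)
        = real n * (cmod (tilt_rest t r n (\<psi> x) (\<zeta> x)))\<^sup>2" for n
        by (cases "n = 0") (auto simp: norm_mult power_mult_distrib field_simps power2_eq_square)
      ultimately show "(\<lambda>n. real n * (cmod (tilt_rest t r n (\<psi> x) (\<zeta> x)))\<^sup>2) \<longlonglongrightarrow> 0"
        by simp
    qed
  qed (use meas in measurable)
  then show ?thesis by simp
qed

section \<open>The convolution theorem\<close>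

text \<open>If convergence failed at z, a subsequence would stay away from c there. By Montel it has
  a further subsequence with an entire limit, equal to c on the real axis and hence everywhere. A
  bound depending on the modulus alone gives local boundedness.\<close>

lemma Vitali_real_axis:
  fixes H :: "nat \<Rightarrow> complex \<Rightarrow> complex"
  assumes hol: "\<And>n. H n holomorphic_on UNIV"
    and bound: "\<And>n z. cmod (H n z) \<le> b (cmod z)" and mono: "mono b"
    and lim: "\<And>r::real. (\<lambda>n. H n (of_real r)) \<longlonglongrightarrow> c"
  shows "(\<lambda>n. H n z) \<longlonglongrightarrow> c"
proof (rule ccontr)
  assume "\<not> ?thesis"
  then obtain e where e: "e > 0" "\<not> (\<forall>\<^sub>F n in sequentially. dist (H n z) c < e)"
    unfolding tendsto_iff by blast
  then have "\<exists>\<^sub>F n in sequentially. e \<le> dist (H n z) c"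
    unfolding frequently_def by (simp add: not_le)
  then have "infinite {n. e \<le> dist (H n z) c}"
    by (simp add: frequently_cofinite[symmetric] cofinite_eq_sequentially)
  then obtain f :: "nat \<Rightarrow> nat" where f: "strict_mono f" "\<And>n. f n \<in> {n. e \<le> dist (H n z) c}"
    using infinite_enumerate by blast
  obtain G s where G: "G holomorphic_on UNIV" and s: "strict_mono (s :: nat \<Rightarrow> nat)"
    and conv: "\<And>x. x \<in> UNIV \<Longrightarrow> (\<lambda>n. (H \<circ> f) (s n) x) \<longlonglongrightarrow> G x"
  proof (rule Montel[of UNIV "range H" "H \<circ> f"])
    show "open (UNIV :: complex set)" "range (H \<circ> f) \<subseteq> range H" by auto
    show "h holomorphic_on UNIV" if "h \<in> range H" for h using that hol by auto
    fix K :: "complex set" assume "compact K"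
    then obtain B where B: "\<And>x. x \<in> K \<Longrightarrow> cmod x \<le> B"
      using compact_imp_bounded bounded_iff by metis
    have "cmod (h x) \<le> b B" if h: "h \<in> range H" and x: "x \<in> K" for h x
    proof -
      have "cmod (h x) \<le> b (cmod x)" using h bound by auto
      also have "\<dots> \<le> b B" using monoD[OF mono] B[OF x] by blast
      finally show ?thesis .
    qed
    then show "\<exists>B. \<forall>h\<in>range H. \<forall>z\<in>K. cmod (h z) \<le> B" by blast
  qed blast
  have "G (of_real r) = c" for r
  proof (rule LIMSEQ_unique)
    show "(\<lambda>n. (H \<circ> f) (s n) (of_real r)) \<longlonglongrightarrow> G (of_real r)" by (rule conv) simp
    have "strict_mono (f \<circ> s)" using f(1) s by (rule strict_mono_o)
    from LIMSEQ_subseq_LIMSEQ[OF lim this] show "(\<lambda>n. (H \<circ> f) (s n) (of_real r)) \<longlonglongrightarrow> c"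
      by (simp add: o_def)
  qed
  then have zero: "G w - c = 0" if "w \<in> range complex_of_real" for w
    using that by auto
  have islim: "(0::complex) islimpt range complex_of_real"
    unfolding islimpt_approachable
  proof (intro allI impI)
    fix e :: real assume "e > 0"
    then show "\<exists>x'\<in>range complex_of_real. x' \<noteq> 0 \<and> dist x' 0 < e"
      using rangeI[of complex_of_real "e / 2"] by (intro bexI[of _ "complex_of_real (e / 2)"]) auto
  qed
  have "G z - c = 0"
    by (rule analytic_continuation[of "\<lambda>w. G w - c" UNIV "range complex_of_real" 0])
      (use G islim zero in \<open>auto intro!: holomorphic_intros\<close>)
  then have "(\<lambda>n. (H \<circ> f) (s n) z) \<longlonglongrightarrow> c"
    using conv[of z] by simp
  from tendstoD[OF this e(1)] obtain n where "dist ((H \<circ> f) (s n) z) c < e"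
    using eventually_happens' by force
  moreover have "e \<le> dist ((H \<circ> f) (s n) z) c"
    using f(2)[of "s n"] by simp
  ultimately show False by simp
qed

text \<open>Expanding the product over the set \<open>A\<close> of coordinates that contribute the
  factor with \<open>r\<close> shows a polynomial in \<open>r\<close>, so that no differentiation
  under the integral occurs.\<close>

lemma (in prob_space) tilted_integral_holomorphic:
  fixes \<psi> \<zeta> :: "'a \<Rightarrow> real" and F :: "(nat \<Rightarrow> 'a) \<Rightarrow> complex"
  assumes [measurable]: "\<psi> \<in> borel_measurable M" "\<zeta> \<in> borel_measurable M"
    and F[measurable]: "F \<in> borel_measurable (\<Pi>\<^sub>M i\<in>{..<n}. M)" and F1: "\<And>\<omega>. cmod (F \<omega>) \<le> 1"
    and z1: "integrable M \<zeta>"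
  shows "(\<lambda>r. \<integral>\<omega>. F \<omega> * (\<Prod>j<n. tilt t r n (\<psi> (\<omega> j)) (\<zeta> (\<omega> j))) \<partial>(\<Pi>\<^sub>M i\<in>{..<n}. M)) holomorphic_on UNIV"
proof -
  interpret P: product_sigma_finite "\<lambda>_. M"
    by (rule product_sigma_finite_const)
  let ?P = "\<Pi>\<^sub>M i\<in>{..<n}. M"
  let ?e = "\<lambda>x. iexp (t * \<psi> x / sqrt n)" and ?d = "\<lambda>x. iexp (t * \<psi> x / sqrt n) * (\<zeta> x / sqrt n)"
  let ?T = "\<lambda>A \<omega>. F \<omega> * ((\<Prod>j\<in>A. ?d (\<omega> j)) * (\<Prod>j\<in>{..<n} - A. ?e (\<omega> j)))"
  have d: "integrable M ?d"
  proof (rule Bochner_Integration.integrable_bound)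
    show "integrable M (\<lambda>x. \<zeta> x / sqrt n)" using z1 by simp
  qed (auto simp: norm_mult norm_divide)
  have e: "integrable M ?e"
    by (rule integrable_const_bound[where B=1]) auto
  have T: "integrable ?P (?T A)" if "A \<subseteq> {..<n}" for A
  proof -
    have fin: "finite A" using that finite_subset by blast
    have "integrable ?P (\<lambda>\<omega>. \<Prod>j<n. (if j \<in> A then ?d else ?e) (\<omega> j))"
      using d e by (intro P.product_integrable_prod) auto
    also have "(\<lambda>\<omega>. \<Prod>j<n. (if j \<in> A then ?d else ?e) (\<omega> j)) = (\<lambda>\<omega>. (\<Prod>j\<in>A. ?d (\<omega> j)) * (\<Prod>j\<in>{..<n} - A. ?e (\<omega> j)))"
    proof
      fix \<omega> :: "nat \<Rightarrow> 'a"
      have "(\<Prod>j<n. (if j \<in> A then ?d else ?e) (\<omega> j)) = (\<Prod>j<n. if j \<in> A then ?d (\<omega> j) else ?e (\<omega> j))"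
        by (intro prod.cong) auto
      also have "\<dots> = (\<Prod>j\<in>{..<n} \<inter> A. ?d (\<omega> j)) * (\<Prod>j\<in>{..<n} - A. ?e (\<omega> j))"
        by (subst prod.If_cases) (auto simp: Diff_eq)
      finally show "(\<Prod>j<n. (if j \<in> A then ?d else ?e) (\<omega> j)) = (\<Prod>j\<in>A. ?d (\<omega> j)) * (\<Prod>j\<in>{..<n} - A. ?e (\<omega> j))"
        using that by (simp add: Int_absorb1)
    qed
    finally have int: "integrable ?P (\<lambda>\<omega>. (\<Prod>j\<in>A. ?d (\<omega> j)) * (\<Prod>j\<in>{..<n} - A. ?e (\<omega> j)))" .
    then have "(\<lambda>\<omega>. (\<Prod>j\<in>A. ?d (\<omega> j)) * (\<Prod>j\<in>{..<n} - A. ?e (\<omega> j))) \<in> borel_measurable ?P" by auto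
    then show ?thesis
      using F1 by (intro Bochner_Integration.integrable_bound[OF int]) (auto simp only: norm_mult[of "F _"] intro!: mult_left_le_one_le borel_measurable_times F AE_I2 norm_ge_zero)
  qed
  have prod_eq: "(\<Prod>j<n. tilt t r n (\<psi> (\<omega> j)) (\<zeta> (\<omega> j)))
      = (\<Sum>A\<in>Pow {..<n}. r ^ card A * ((\<Prod>j\<in>A. ?d (\<omega> j)) * (\<Prod>j\<in>{..<n} - A. ?e (\<omega> j))))" for r and \<omega> :: "nat \<Rightarrow> 'a"
  proof -
    have "(\<Prod>j<n. tilt t r n (\<psi> (\<omega> j)) (\<zeta> (\<omega> j))) = (\<Prod>j<n. r * ?d (\<omega> j) + ?e (\<omega> j))"
      by (intro prod.cong refl) (simp add: tilt_def algebra_simps)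
    also have "\<dots> = (\<Sum>A\<in>Pow {..<n}. (\<Prod>j\<in>A. r * ?d (\<omega> j)) * (\<Prod>j\<in>{..<n} - A. ?e (\<omega> j)))"
      by (rule prod_add) simp
    finally show ?thesis
      by (simp only: prod.distrib prod_constant mult.assoc)
  qed
  have "(\<integral>\<omega>. F \<omega> * (\<Prod>j<n. tilt t r n (\<psi> (\<omega> j)) (\<zeta> (\<omega> j))) \<partial>?P)
      = (\<Sum>A\<in>Pow {..<n}. r ^ card A * (\<integral>\<omega>. ?T A \<omega> \<partial>?P))" for r
  proof -
    have "(\<integral>\<omega>. F \<omega> * (\<Prod>j<n. tilt t r n (\<psi> (\<omega> j)) (\<zeta> (\<omega> j))) \<partial>?P) = (\<integral>\<omega>. (\<Sum>A\<in>Pow {..<n}. r ^ card A * ?T A \<omega>) \<partial>?P)"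
      unfolding prod_eq sum_distrib_left by (simp only: mult_ac)
    also have "\<dots> = (\<Sum>A\<in>Pow {..<n}. \<integral>\<omega>. r ^ card A * ?T A \<omega> \<partial>?P)"
      by (rule Bochner_Integration.integral_sum) (use T in \<open>auto intro!: integrable_mult_right simp only: Pow_iff\<close>)
    also have "\<dots> = (\<Sum>A\<in>Pow {..<n}. r ^ card A * (\<integral>\<omega>. ?T A \<omega> \<partial>?P))"
      by (simp only: integral_mult_right_zero)
    finally show ?thesis .
  qed
  then show ?thesis
    by (simp only:) (intro holomorphic_intros)
qed

text \<open>The bound must not depend on n. By 2|w| at most 1 + |w|^2 the modulus is replaced by its
  square, whose linear term integrates to 0; each factor costs 1 + O(1/n).\<close>

lemma (in prob_space) tilted_integral_bound:
  fixes \<psi> \<zeta> :: "'a \<Rightarrow> real" and F :: "(nat \<Rightarrow> 'a) \<Rightarrow> complex"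
  assumes [measurable]: "\<psi> \<in> borel_measurable M" "\<zeta> \<in> borel_measurable M"
    and F[measurable]: "F \<in> borel_measurable (\<Pi>\<^sub>M i\<in>{..<n}. M)" and F1: "\<And>\<omega>. cmod (F \<omega>) \<le> 1"
    and z2: "integrable M (\<lambda>x. (\<zeta> x)\<^sup>2)" and z0: "(\<integral>x. \<zeta> x \<partial>M) = 0"
  shows "cmod (\<integral>\<omega>. F \<omega> * (\<Prod>j<n. tilt t r n (\<psi> (\<omega> j)) (\<zeta> (\<omega> j))) \<partial>(\<Pi>\<^sub>M i\<in>{..<n}. M))
    \<le> exp ((cmod r)\<^sup>2 * (\<integral>x. (\<zeta> x)\<^sup>2 \<partial>M))"
proof -
  let ?P = "\<Pi>\<^sub>M i\<in>{..<n}. M"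
  let ?\<kappa> = "\<integral>x. (\<zeta> x)\<^sup>2 \<partial>M"
  have z1: "integrable M \<zeta>" by (rule square_integrable_imp_integrable) (use z2 in auto)
  have zc: "integrable M (\<lambda>x. complex_of_real (\<zeta> x))" using z1 by auto
  let ?l = "\<lambda>x. cmod (1 + r * \<zeta> x / sqrt n)"
  have l: "integrable M ?l" using zc by auto
  have l_le: "(\<integral>x. ?l x \<partial>M) \<le> exp ((cmod r)\<^sup>2 * ?\<kappa> / n)" if "n > 0"
  proof -
    have sq: "(?l x)\<^sup>2 = 1 + 2 * Re r * \<zeta> x / sqrt n + (cmod r)\<^sup>2 * (\<zeta> x)\<^sup>2 / n" for x
    proof -
      define s where "s = sqrt (real n)"
      have s: "s > 0" "real n = s * s" using that by (auto simp: s_def)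
      have "(?l x)\<^sup>2 = (1 + Re r * \<zeta> x / s)\<^sup>2 + (Im r * \<zeta> x / s)\<^sup>2"
        by (simp add: cmod_power2 s_def)
      also have "\<dots> = 1 + 2 * Re r * \<zeta> x / s + (cmod r)\<^sup>2 * (\<zeta> x)\<^sup>2 / (s * s)"
        using s(1) unfolding cmod_power2[of r] by (simp add: power2_eq_square field_simps)
      finally show ?thesis unfolding s(2)[symmetric] s_def[symmetric] .
    qed
    have "(\<integral>x. ?l x \<partial>M) \<le> (\<integral>x. (1 + (1 + 2 * Re r * \<zeta> x / sqrt n + (cmod r)\<^sup>2 * (\<zeta> x)\<^sup>2 / n)) / 2 \<partial>M)"
    proof (rule integral_mono[OF l])
      show "integrable M (\<lambda>x. (1 + (1 + 2 * Re r * \<zeta> x / sqrt n + (cmod r)\<^sup>2 * (\<zeta> x)\<^sup>2 / n)) / 2)"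
        using z1 z2 by simp
      fix x
      have "2 * ?l x \<le> 1 + (?l x)\<^sup>2" using sum_squares_bound[of "?l x" 1] by simp
      then show "?l x \<le> (1 + (1 + 2 * Re r * \<zeta> x / sqrt n + (cmod r)\<^sup>2 * (\<zeta> x)\<^sup>2 / n)) / 2"
        unfolding sq by simp
    qed
    also have "\<dots> = 1 + (cmod r)\<^sup>2 * ?\<kappa> / n / 2"
      using z1 z2 z0 by (simp add: prob_space add_divide_distrib)
    also have "\<dots> \<le> 1 + (cmod r)\<^sup>2 * ?\<kappa> / n"
    proof -
      have "0 \<le> (cmod r)\<^sup>2 * ?\<kappa> / n" by simp
      moreover have "a / 2 \<le> a" if "0 \<le> a" for a :: real using that by simp
      ultimately show ?thesis by (intro add_left_mono)
    qed
    also have "\<dots> \<le> exp ((cmod r)\<^sup>2 * ?\<kappa> / n)" by (rule exp_ge_add_one_self)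
    finally show ?thesis .
  qed
  have "cmod (\<integral>\<omega>. F \<omega> * (\<Prod>j<n. tilt t r n (\<psi> (\<omega> j)) (\<zeta> (\<omega> j))) \<partial>?P)
      \<le> (\<integral>\<omega>. cmod (F \<omega> * (\<Prod>j<n. tilt t r n (\<psi> (\<omega> j)) (\<zeta> (\<omega> j)))) \<partial>?P)"
    by (rule integral_norm_bound)
  also have "\<dots> \<le> (\<integral>\<omega>. (\<Prod>j<n. ?l (\<omega> j)) \<partial>?P)"
  proof (rule integral_mono_AE')
    show "integrable ?P (\<lambda>\<omega>. \<Prod>j<n. ?l (\<omega> j))" using l by (intro PiM_integrable_prod) auto
    have "cmod (F \<omega> * (\<Prod>j<n. tilt t r n (\<psi> (\<omega> j)) (\<zeta> (\<omega> j)))) \<le> (\<Prod>j<n. ?l (\<omega> j))" for \<omega>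
    proof -
      have "cmod (\<Prod>j<n. tilt t r n (\<psi> (\<omega> j)) (\<zeta> (\<omega> j))) = (\<Prod>j<n. ?l (\<omega> j))"
        unfolding prod_norm[symmetric] by (intro prod.cong refl) (simp add: tilt_def norm_mult)
      then show ?thesis
        using F1[of \<omega>] by (simp add: norm_mult mult_left_le_one_le prod_nonneg)
    qed
    then show "AE \<omega> in ?P. cmod (F \<omega> * (\<Prod>j<n. tilt t r n (\<psi> (\<omega> j)) (\<zeta> (\<omega> j)))) \<le> (\<Prod>j<n. ?l (\<omega> j))"
      by simp
    show "AE \<omega> in ?P. 0 \<le> (\<Prod>j<n. ?l (\<omega> j))"
      by (simp add: prod_nonneg)
  qed
  also have "\<dots> = (\<integral>x. ?l x \<partial>M) ^ n"
    using PiM_integral_prod[OF _ l, of "{..<n}"] by simp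
  also have "\<dots> \<le> exp ((cmod r)\<^sup>2 * ?\<kappa>)"
  proof (cases "n = 0")
    case False
    then have "(\<integral>x. ?l x \<partial>M) ^ n \<le> exp ((cmod r)\<^sup>2 * ?\<kappa> / n) ^ n"
      using l_le by (intro power_mono) auto
    also have "\<dots> = exp ((cmod r)\<^sup>2 * ?\<kappa>)"
      using False by (simp add: exp_of_nat_mult[symmetric])
    finally show ?thesis .
  qed simp
  finally show ?thesis .
qed

text \<open>Here \<zeta> is the score in the least favourable direction, \<open>reg\<close> is
  regularity along all its real multiples, and the conclusion has divided the limit by the Gaussian
  factor.\<close>

theorem (in prob_space) convolution_limit:
  fixes \<psi> \<zeta> :: "'a \<Rightarrow> real" and R :: "nat \<Rightarrow> (nat \<Rightarrow> 'x) \<Rightarrow> real"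
  assumes X[measurable]: "X \<in> measurable M N"
    and \<psi>[measurable]: "\<psi> \<in> borel_measurable M" and \<zeta>[measurable]: "\<zeta> \<in> borel_measurable M"
    and L2: "integrable M (\<lambda>x. (\<psi> x)\<^sup>2)" "integrable M (\<lambda>x. (\<zeta> x)\<^sup>2)"
    and mean: "(\<integral>x. \<psi> x \<partial>M) = 0" "(\<integral>x. \<zeta> x \<partial>M) = 0"
    and orth: "(\<integral>x. \<psi> x * \<zeta> x \<partial>M) = 0"
    and cond: "\<And>F :: 'x \<Rightarrow> complex. F \<in> borel_measurable N \<Longrightarrow> (\<And>x. norm (F x) \<le> 1) \<Longrightarrow>
      (\<integral>z. F (X z) * of_real (\<psi> z) \<partial>M) = (\<integral>z. F (X z) * of_real (\<zeta> z) \<partial>M)"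
    and R[measurable]: "\<And>n. R n \<in> borel_measurable (\<Pi>\<^sub>M i\<in>{..<n}. N)"
    and reg: "\<And>r::real. (\<lambda>n. \<integral>\<omega>. iexp (t * R n (\<lambda>j\<in>{..<n}. X (\<omega> j)))
        * (\<Prod>j<n. tilt t (of_real r) n (\<psi> (\<omega> j)) (\<zeta> (\<omega> j))) \<partial>(\<Pi>\<^sub>M i\<in>{..<n}. M)) \<longlonglongrightarrow> \<phi>"
  shows "(\<lambda>n. \<integral>\<omega>. iexp (t * R n (\<lambda>j\<in>{..<n}. X (\<omega> j))) \<partial>(\<Pi>\<^sub>M i\<in>{..<n}. M))
    \<longlonglongrightarrow> \<phi> * exp (of_real (t\<^sup>2 * (\<integral>x. (\<psi> x)\<^sup>2 \<partial>M) / 2))"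
proof -
  let ?P = "\<lambda>n::nat. \<Pi>\<^sub>M i\<in>{..<n}. M"
  let ?O = "\<lambda>n \<omega>. \<lambda>j\<in>{..<n::nat}. X (\<omega> j)"
  define v where "v = t\<^sup>2 * (\<integral>x. (\<psi> x)\<^sup>2 \<partial>M) / 2"
  define q where "q = exp (- v)"
  define F where "F n x = iexp (t * R n x)" for n x
  have F[measurable]: "F n \<in> borel_measurable (\<Pi>\<^sub>M i\<in>{..<n}. N)" for n
    unfolding F_def by measurable
  have F1: "cmod (F n x) \<le> 1" for n x by (simp add: F_def)
  \<comment> \<open>For this value the first-order part of the tilt is a multiple of \<psi> -
    \<zeta>, which integrates to 0 against functions of X by \<open>cond\<close>.\<close>
  define r0 where "r0 = - (\<i> * complex_of_real t)"
  have L1: "integrable M \<psi>" "integrable M \<zeta>"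
    by (rule square_integrable_imp_integrable; use L2 in simp)+
  have cL1: "integrable M (\<lambda>x. complex_of_real (\<psi> x))" "integrable M (\<lambda>x. complex_of_real (\<zeta> x))"
    using L1 by auto
  have FO: "(\<lambda>\<omega>. F n (?O n \<omega>)) \<in> borel_measurable (?P n)" for n
    by (rule measurable_compose[OF _ F], rule measurable_restrict) simp

  have complex_reg: "(\<lambda>n. \<integral>\<omega>. F n (?O n \<omega>) * (\<Prod>j<n. tilt t r0 n (\<psi> (\<omega> j)) (\<zeta> (\<omega> j))) \<partial>?P n) \<longlonglongrightarrow> \<phi>"
  \<comment> \<open>The \<open>max 0\<close> makes the bound monotone on all reals, not only on the
    moduli where it is evaluated.\<close>
  proof (rule Vitali_real_axis[where b="\<lambda>x. exp ((max 0 x)\<^sup>2 * (\<integral>x. (\<zeta> x)\<^sup>2 \<partial>M))"])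
    show "(\<lambda>r. \<integral>\<omega>. F n (?O n \<omega>) * (\<Prod>j<n. tilt t r n (\<psi> (\<omega> j)) (\<zeta> (\<omega> j))) \<partial>?P n) holomorphic_on UNIV" for n
      by (rule tilted_integral_holomorphic[OF \<psi> \<zeta> FO F1 L1(2)])
    show "cmod (\<integral>\<omega>. F n (?O n \<omega>) * (\<Prod>j<n. tilt t r n (\<psi> (\<omega> j)) (\<zeta> (\<omega> j))) \<partial>?P n)
        \<le> exp ((max 0 (cmod r))\<^sup>2 * (\<integral>x. (\<zeta> x)\<^sup>2 \<partial>M))" for n r
      using tilted_integral_bound[OF \<psi> \<zeta> FO F1 L2(2) mean(2), of n t r] by (simp add: max_absorb2)
    show "mono (\<lambda>x. exp ((max 0 x)\<^sup>2 * (\<integral>x. (\<zeta> x)\<^sup>2 \<partial>M)))"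
      by (intro monoI) (auto intro!: mult_right_mono power_mono)
    show "(\<lambda>n. \<integral>\<omega>. F n (?O n \<omega>) * (\<Prod>j<n. tilt t (of_real r) n (\<psi> (\<omega> j)) (\<zeta> (\<omega> j))) \<partial>?P n) \<longlonglongrightarrow> \<phi>" for r
      using reg[of r] by (simp add: F_def)
  qed

  let ?\<epsilon> = "\<lambda>n z. tilt_rest t r0 n (\<psi> z) (\<zeta> z)"
  note tilt_int = tilt_integrable[OF \<psi> \<zeta> L2, of t r0]
  have \<epsilon>_meas: "(\<lambda>z. ?\<epsilon> n z) \<in> borel_measurable M" for n
    using tilt_int(2) by auto
  \<comment> \<open>Bundling the properties of a conditional expectation of the rest allows one
    version to be chosen for every n at once.\<close>
  define version where "version n k \<longleftrightarrow> k \<in> borel_measurable N \<and> integrable M (\<lambda>z. k (X z)) \<and>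
    (\<integral>z. k (X z) \<partial>M) = (\<integral>z. ?\<epsilon> n z \<partial>M) \<and>
    integrable M (\<lambda>z. (cmod (k (X z)))\<^sup>2) \<and> (\<integral>z. (cmod (k (X z)))\<^sup>2 \<partial>M) \<le> (\<integral>z. (cmod (?\<epsilon> n z))\<^sup>2 \<partial>M) \<and>
    (\<forall>F. F \<in> borel_measurable N \<longrightarrow> (\<forall>x. norm (F x) \<le> 1) \<longrightarrow>
      (\<integral>z. F (X z) * ?\<epsilon> n z \<partial>M) = (\<integral>z. F (X z) * k (X z) \<partial>M))" for n k
  have "\<exists>k. version n k" for n
    by (rule complex_cond_exp_exists[OF X \<epsilon>_meas tilt_int(3)]) (auto simp: version_def)
  then obtain k where version: "\<And>n. version n (k n)"
    by metis
  have k[measurable]: "k n \<in> borel_measurable N"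
    and k_int: "integrable M (\<lambda>z. k n (X z))"
    and k_mean: "(\<integral>z. k n (X z) \<partial>M) = (\<integral>z. ?\<epsilon> n z \<partial>M)"
    and k_int2: "integrable M (\<lambda>z. (cmod (k n (X z)))\<^sup>2)"
    and k_sq: "(\<integral>z. (cmod (k n (X z)))\<^sup>2 \<partial>M) \<le> (\<integral>z. (cmod (?\<epsilon> n z))\<^sup>2 \<partial>M)" for n
    using version[of n] by (auto simp: version_def)
  have k_cond: "(\<integral>z. F (X z) * ?\<epsilon> n z \<partial>M) = (\<integral>z. F (X z) * k n (X z) \<partial>M)"
    if "F \<in> borel_measurable N" "\<And>x. norm (F x) \<le> 1" for n F
    using version[of n] that by (auto simp: version_def)

  have replace: "(\<integral>\<omega>. F n (?O n \<omega>) * (\<Prod>j<n. tilt t r0 n (\<psi> (\<omega> j)) (\<zeta> (\<omega> j))) \<partial>?P n)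
      = (\<integral>\<omega>. F n (?O n \<omega>) * (\<Prod>j<n. 1 + k n (X (\<omega> j))) \<partial>?P n)" for n
  proof (rule PiM_integral_replace[OF _ X F F1])
    show "integrable M (\<lambda>z. tilt t r0 n (\<psi> z) (\<zeta> z))" by (rule tilt_int)
    show "integrable M (\<lambda>z. 1 + k n (X z))" using k_int by simp
    fix G :: "'x \<Rightarrow> complex" assume G[measurable]: "G \<in> borel_measurable N" and G1: "\<And>x. cmod (G x) \<le> 1"
    have bd: "integrable M (\<lambda>z. G (X z) * v z)" if "integrable M v" for v :: "'a \<Rightarrow> complex"
      using that G1 by (intro Bochner_Integration.integrable_bound[OF that]) (auto simp: norm_mult intro!: mult_left_le_one_le)
    have tilt_eq: "tilt t r0 n p z = 1 + \<i> * t / sqrt n * (p - z) + tilt_rest t r0 n p z" for p z :: real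
      by (simp add: tilt_rest_def r0_def algebra_simps diff_divide_distrib add_divide_distrib)
    have "(\<integral>z. G (X z) * tilt t r0 n (\<psi> z) (\<zeta> z) \<partial>M)
      = (\<integral>z. G (X z) * 1 + \<i> * t / sqrt n * (G (X z) * \<psi> z - G (X z) * \<zeta> z) + G (X z) * ?\<epsilon> n z \<partial>M)"
      unfolding tilt_eq by (simp add: algebra_simps diff_divide_distrib)
    also have "\<dots> = (\<integral>z. G (X z) * 1 \<partial>M) + \<i> * t / sqrt n * ((\<integral>z. G (X z) * \<psi> z \<partial>M) - (\<integral>z. G (X z) * \<zeta> z \<partial>M))
        + (\<integral>z. G (X z) * ?\<epsilon> n z \<partial>M)"
    proof -
      have i: "integrable M (\<lambda>z. G (X z) * 1)" by (rule bd) simp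
      have d: "integrable M (\<lambda>z. G (X z) * \<psi> z - G (X z) * \<zeta> z)"
        using bd[OF cL1(1)] bd[OF cL1(2)] by (rule Bochner_Integration.integrable_diff)
      have d': "integrable M (\<lambda>z. \<i> * t / sqrt n * (G (X z) * \<psi> z - G (X z) * \<zeta> z))"
        using d by (rule integrable_mult_right)
      show ?thesis
        unfolding Bochner_Integration.integral_add[OF Bochner_Integration.integrable_add[OF i d'] bd[OF tilt_int(2)]]
          Bochner_Integration.integral_add[OF i d'] integral_mult_right_zero
          Bochner_Integration.integral_diff[OF bd[OF cL1(1)] bd[OF cL1(2)]] ..
    qed
    also have "\<dots> = (\<integral>z. G (X z) * 1 \<partial>M) + (\<integral>z. G (X z) * k n (X z) \<partial>M)"
      using cond[OF G G1] k_cond[OF G G1] by simp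
    also have "\<dots> = (\<integral>z. G (X z) * (1 + k n (X z)) \<partial>M)"
      using bd[OF k_int[of n]] bd[of "\<lambda>_. 1"] by (simp add: algebra_simps)
    finally show "(\<integral>z. G (X z) * tilt t r0 n (\<psi> z) (\<zeta> z) \<partial>M) = (\<integral>z. G (X z) * (1 + k n (X z)) \<partial>M)" .
  qed simp

  \<comment> \<open>\<open>K n\<close> acts as the conditional expectation of the tilted product
    given the observations. Its mean tends to \<open>q\<close> and its second moment to
    \<open>q\<close> squared, so it converges in L2 to a constant and separates from the factor
    \<open>F\<close>.\<close>
  define K where "K n \<omega> = (\<Prod>j<n. 1 + k n (X (\<omega> j)))" for n and \<omega> :: "nat \<Rightarrow> 'a"
  have K1_int: "integrable M (\<lambda>z. 1 + k n (X z))" for n using k_int by simp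
  have sq: "(cmod (1 + w))\<^sup>2 = 1 + 2 * Re w + (cmod w)\<^sup>2" for w
    unfolding cmod_power2 by (simp add: power2_eq_square algebra_simps)
  have re_int: "integrable M (\<lambda>z. Re (k n (X z)))" for n using k_int by (rule integrable_Re)
  have K2_int: "integrable M (\<lambda>z. (cmod (1 + k n (X z)))\<^sup>2)" for n
    unfolding sq using re_int k_int2 by simp
  have K_int: "integrable (?P n) (K n)" for n
    unfolding K_def[abs_def] using PiM_integrable_prod[OF _ K1_int, of "{..<n}" n] by simp
  have K_norm2: "(cmod (K n \<omega>))\<^sup>2 = (\<Prod>j<n. (cmod (1 + k n (X (\<omega> j))))\<^sup>2)" for n \<omega>
    by (simp add: K_def prod_norm[symmetric] prod_power_distrib)
  have K_sq_int: "integrable (?P n) (\<lambda>\<omega>. (cmod (K n \<omega>))\<^sup>2)" for n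
    unfolding K_norm2 using PiM_integrable_prod[OF _ K2_int, of "{..<n}" n] by simp
  have \<epsilon>_mean: "(\<lambda>n. of_nat n * (\<integral>z. ?\<epsilon> n z \<partial>M)) \<longlonglongrightarrow> of_real (- v)"
    using tilt_mean(1)[OF \<psi> \<zeta> L2 mean orth, of t r0] by (simp add: v_def)
  have K_mean: "(\<lambda>n. \<integral>\<omega>. K n \<omega> \<partial>?P n) \<longlonglongrightarrow> of_real q"
  proof -
    have "(\<integral>\<omega>. K n \<omega> \<partial>?P n) = (1 + (\<integral>z. ?\<epsilon> n z \<partial>M)) ^ n" for n
      unfolding K_def using PiM_integral_prod[OF _ K1_int, of "{..<n}" n] k_int by (simp add: prob_space k_mean)
    then show ?thesis
      using power_tendsto_exp[of "\<lambda>n. 1 + (\<integral>z. ?\<epsilon> n z \<partial>M)"] \<epsilon>_mean by (simp add: q_def exp_of_real[symmetric])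
  qed
  have K_sq: "(\<lambda>n. \<integral>\<omega>. (cmod (K n \<omega>))\<^sup>2 \<partial>?P n) \<longlonglongrightarrow> q\<^sup>2"
  proof -
    define a where "a n = 2 * Re (\<integral>z. ?\<epsilon> n z \<partial>M) + (\<integral>z. (cmod (k n (X z)))\<^sup>2 \<partial>M)" for n
    have "(\<integral>\<omega>. (cmod (K n \<omega>))\<^sup>2 \<partial>?P n) = (1 + a n) ^ n" for n
      unfolding K_norm2 using PiM_integral_prod[OF _ K2_int, of "{..<n}" n] re_int k_int2 k_int
      by (simp add: sq prob_space a_def k_mean[symmetric] add.assoc)
    moreover have "(\<lambda>n. (1 + a n) ^ n) \<longlonglongrightarrow> exp (- 2 * v)"
    proof (rule power_tendsto_exp_real)
      \<comment> \<open>By contraction \<open>k n\<close> inherits the L2 smallness of the rest, so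
        second-order terms of \<open>K\<close> do not affect its second moment in the limit.\<close>
      have "(\<lambda>n. real n * (\<integral>z. (cmod (k n (X z)))\<^sup>2 \<partial>M)) \<longlonglongrightarrow> 0"
      proof (rule real_tendsto_sandwich[where f="\<lambda>_. 0", OF _ _ _ tilt_rest_L2[OF \<psi> \<zeta> L2, of t r0]])
        show "\<forall>\<^sub>F n in sequentially. real n * (\<integral>z. (cmod (k n (X z)))\<^sup>2 \<partial>M) \<le> real n * (\<integral>z. (cmod (?\<epsilon> n z))\<^sup>2 \<partial>M)"
          using k_sq by (intro always_eventually allI mult_left_mono) auto
      qed simp_all
      moreover have "(\<lambda>n. Re (of_nat n * (\<integral>z. ?\<epsilon> n z \<partial>M))) \<longlonglongrightarrow> Re (of_real (- v))"
        by (intro tendsto_Re \<epsilon>_mean)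
      ultimately have "(\<lambda>n. 2 * Re (of_nat n * (\<integral>z. ?\<epsilon> n z \<partial>M)) + real n * (\<integral>z. (cmod (k n (X z)))\<^sup>2 \<partial>M)) \<longlonglongrightarrow> 2 * Re (of_real (- v)) + 0"
        by (intro tendsto_add tendsto_mult tendsto_const)
      then show "(\<lambda>n. real n * (1 + a n - 1)) \<longlonglongrightarrow> - 2 * v"
        by (simp add: a_def algebra_simps)
    qed
    moreover have "exp (- 2 * v) = q\<^sup>2"
      by (simp add: q_def power2_eq_square exp_add[symmetric])
    ultimately show ?thesis by simp
  qed
  have Kq_int: "integrable (?P n) (\<lambda>\<omega>. (cmod (K n \<omega> - of_real q))\<^sup>2)"
    and Kq_eq: "(\<integral>\<omega>. (cmod (K n \<omega> - of_real q))\<^sup>2 \<partial>?P n)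
      = (\<integral>\<omega>. (cmod (K n \<omega>))\<^sup>2 \<partial>?P n) - 2 * q * Re (\<integral>\<omega>. K n \<omega> \<partial>?P n) + q\<^sup>2" for n
  proof -
    interpret P: prob_space "?P n" by (rule prob_space_PiM_const)
    have e: "(cmod (w - of_real q))\<^sup>2 = (cmod w)\<^sup>2 - 2 * q * Re w + q\<^sup>2" for w
      unfolding cmod_power2 by (simp add: power2_eq_square algebra_simps)
    have r: "integrable (?P n) (\<lambda>\<omega>. Re (K n \<omega>))" using K_int by (rule integrable_Re)
    show "integrable (?P n) (\<lambda>\<omega>. (cmod (K n \<omega> - of_real q))\<^sup>2)"
      unfolding e using r K_sq_int by simp
    show "(\<integral>\<omega>. (cmod (K n \<omega> - of_real q))\<^sup>2 \<partial>?P n)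
      = (\<integral>\<omega>. (cmod (K n \<omega>))\<^sup>2 \<partial>?P n) - 2 * q * Re (\<integral>\<omega>. K n \<omega> \<partial>?P n) + q\<^sup>2"
      unfolding e using r K_sq_int K_int by (simp add: P.prob_space)
  qed
  have Kq_lim: "(\<lambda>n. \<integral>\<omega>. (cmod (K n \<omega> - of_real q))\<^sup>2 \<partial>?P n) \<longlonglongrightarrow> 0"
  proof -
    have "(\<lambda>n. (\<integral>\<omega>. (cmod (K n \<omega>))\<^sup>2 \<partial>?P n) - 2 * q * Re (\<integral>\<omega>. K n \<omega> \<partial>?P n) + q\<^sup>2)
      \<longlonglongrightarrow> q\<^sup>2 - 2 * q * Re (of_real q) + q\<^sup>2"
      by (intro tendsto_intros K_sq tendsto_Re K_mean)
    then show ?thesis unfolding Kq_eq by (simp add: power2_eq_square)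
  qed
  have diff: "(\<lambda>n. \<integral>\<omega>. F n (?O n \<omega>) * (K n \<omega> - of_real q) \<partial>?P n) \<longlonglongrightarrow> 0"
  proof (rule Lim_null_comparison)
    show "\<forall>\<^sub>F n in sequentially. norm (\<integral>\<omega>. F n (?O n \<omega>) * (K n \<omega> - of_real q) \<partial>?P n)
       \<le> sqrt (\<integral>\<omega>. (cmod (K n \<omega> - of_real q))\<^sup>2 \<partial>?P n)"
    proof (intro always_eventually allI)
      fix n
      interpret P: prob_space "?P n" by (rule prob_space_PiM_const)
      have Kd: "integrable (?P n) (\<lambda>\<omega>. K n \<omega> - of_real q)" using K_int by simp
      have "norm (\<integral>\<omega>. F n (?O n \<omega>) * (K n \<omega> - of_real q) \<partial>?P n) \<le> (\<integral>\<omega>. norm (F n (?O n \<omega>) * (K n \<omega> - of_real q)) \<partial>?P n)"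
        by (rule integral_norm_bound)
      also have "\<dots> = (\<integral>\<omega>. \<bar>cmod (K n \<omega> - of_real q) * 1\<bar> \<partial>?P n)"
        by (simp add: F_def norm_mult)
      also have "\<dots> \<le> sqrt (\<integral>\<omega>. (cmod (K n \<omega> - of_real q))\<^sup>2 \<partial>?P n) * sqrt (\<integral>\<omega>. 1\<^sup>2 \<partial>?P n)"
        by (rule integral_Cauchy_Schwarz) (use Kd Kq_int in auto)
      finally show "norm (\<integral>\<omega>. F n (?O n \<omega>) * (K n \<omega> - of_real q) \<partial>?P n)
       \<le> sqrt (\<integral>\<omega>. (cmod (K n \<omega> - of_real q))\<^sup>2 \<partial>?P n)"
        by (simp add: P.prob_space)
    qed
    show "(\<lambda>n. sqrt (\<integral>\<omega>. (cmod (K n \<omega> - of_real q))\<^sup>2 \<partial>?P n)) \<longlonglongrightarrow> 0"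
      using tendsto_real_sqrt[OF Kq_lim] by simp
  qed
  \<comment> \<open>Subtracting the negligible part leaves \<open>q\<close> times the wanted
    integral; \<open>q\<close> is an exponential, so division by it is safe.\<close>
  have "(\<lambda>n. ((\<integral>\<omega>. F n (?O n \<omega>) * K n \<omega> \<partial>?P n) - (\<integral>\<omega>. F n (?O n \<omega>) * (K n \<omega> - of_real q) \<partial>?P n)) / of_real q)
    \<longlonglongrightarrow> (\<phi> - 0) / of_real q"
    using complex_reg unfolding replace K_def[symmetric] by (intro tendsto_intros diff) (auto simp: q_def)
  moreover have "((\<integral>\<omega>. F n (?O n \<omega>) * K n \<omega> \<partial>?P n) - (\<integral>\<omega>. F n (?O n \<omega>) * (K n \<omega> - of_real q) \<partial>?P n)) / of_real q
     = (\<integral>\<omega>. F n (?O n \<omega>) \<partial>?P n)" for n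
  proof -
    interpret P: prob_space "?P n" by (rule prob_space_PiM_const)
    have Km: "K n \<in> borel_measurable (?P n)" using K_int by auto
    have FK: "integrable (?P n) (\<lambda>\<omega>. F n (?O n \<omega>) * K n \<omega>)"
      using F1 FO Km by (intro Bochner_Integration.integrable_bound[OF K_int[of n]]) (auto simp: norm_mult intro!: mult_left_le_one_le)
    have F': "integrable (?P n) (\<lambda>\<omega>. F n (?O n \<omega>))"
      using F1 FO by (intro P.integrable_const_bound[where B=1]) auto
    have "(\<integral>\<omega>. F n (?O n \<omega>) * (K n \<omega> - of_real q) \<partial>?P n) = (\<integral>\<omega>. F n (?O n \<omega>) * K n \<omega> \<partial>?P n) - (\<integral>\<omega>. F n (?O n \<omega>) \<partial>?P n) * of_real q"
      using FK F' by (simp add: right_diff_distrib)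
    then show ?thesis by (simp add: q_def)
  qed
  moreover have "(\<phi> - 0) / of_real q = \<phi> * exp (of_real v)"
    by (simp add: q_def exp_minus divide_inverse exp_of_real)
  ultimately show ?thesis
    by (simp add: F_def v_def)
qed

section \<open>Characteristic functions and second moments\<close>

lemma one_minus_cos_le: "1 - cos y \<le> y\<^sup>2 / 2" for y :: real
proof -
  have "cmod (iexp y - 1 - \<i> * y) \<ge> \<bar>Re (iexp y - 1 - \<i> * y)\<bar>" by (rule abs_Re_le_cmod)
  then show ?thesis using norm_iexp_diff_le(3)[of y] by (simp add: Re_exp)
qed

lemma (in prob_space) Re_integral_iexp_ge:
  fixes Y :: "'a \<Rightarrow> real"
  assumes [measurable]: "Y \<in> borel_measurable M" and Y2: "integrable M (\<lambda>x. (Y x)\<^sup>2)"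
  shows "1 - t\<^sup>2 * (\<integral>x. (Y x)\<^sup>2 \<partial>M) / 2 \<le> Re (\<integral>x. iexp (t * Y x) \<partial>M)"
proof -
  have int: "integrable M (\<lambda>x. iexp (t * Y x))"
    by (rule integrable_const_bound[where B=1]) auto
  have "1 - t\<^sup>2 * (\<integral>x. (Y x)\<^sup>2 \<partial>M) / 2 = (\<integral>x. 1 - t\<^sup>2 * (Y x)\<^sup>2 / 2 \<partial>M)"
    using Y2 by (simp add: prob_space)
  also have "\<dots> \<le> (\<integral>x. Re (iexp (t * Y x)) \<partial>M)"
  proof (rule integral_mono)
    show "integrable M (\<lambda>x. Re (iexp (t * Y x)))" using int by (rule integrable_Re)
    show "1 - t\<^sup>2 * (Y x)\<^sup>2 / 2 \<le> Re (iexp (t * Y x))" for x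
      using one_minus_cos_le[of "t * Y x"] by (simp add: Re_exp power_mult_distrib)
  qed (use Y2 in simp)
  also have "\<dots> = Re (\<integral>x. iexp (t * Y x) \<partial>M)"
    using int by (rule integral_Re)
  finally show ?thesis .
qed

text \<open>Centring changes the characteristic function by a unimodular factor only, so 1 - t^2 V /
  2 lies below exp(-v t^2 / 2) for every t, which is impossible near 0 when V < v.\<close>

lemma ext_variance_ge:
  assumes L: "real_distribution L" and v: "0 \<le> v"
    and le: "\<And>t. cmod (char L t) \<le> exp (- (v * t\<^sup>2 / 2))"
  shows "ennreal v \<le> ext_variance L"
proof (cases "ext_variance L = \<infinity>")
  case False
  interpret L: real_distribution L by fact
  define m where "m = (\<integral>y. y \<partial>L)"
  define V where "V = (\<integral>x. (x - m)\<^sup>2 \<partial>L)"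
  \<comment> \<open>Finite \<open>ext_variance\<close> gives integrability around \<open>m\<close>
    whatever the Bochner integral \<open>m\<close> is; nothing else about \<open>m\<close> is
    used.\<close>
  have int: "integrable L (\<lambda>x. (x - m)\<^sup>2)"
    using False by (intro integrableI_nonneg) (auto simp: ext_variance_def m_def top.not_eq_extremum)
  have ev: "ext_variance L = ennreal V"
    unfolding ext_variance_def V_def m_def[symmetric] by (rule nn_integral_eq_integral[OF int]) simp
  have V0: "0 \<le> V" by (simp add: V_def)
  have bound: "1 - t\<^sup>2 * V / 2 \<le> exp (- (v * t\<^sup>2 / 2))" for t
  proof -
    have "iexp (t * (x - m)) = iexp (- (t * m)) * iexp (t * x)" for x
      by (simp add: exp_add[symmetric] algebra_simps)
    then have "(\<integral>x. iexp (t * (x - m)) \<partial>L) = iexp (- (t * m)) * char L t"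
      unfolding char_def by (simp only: integral_mult_right_zero)
    then have "cmod (\<integral>x. iexp (t * (x - m)) \<partial>L) = cmod (char L t)"
      by (simp add: norm_mult)
    moreover have "1 - t\<^sup>2 * V / 2 \<le> Re (\<integral>x. iexp (t * (x - m)) \<partial>L)"
      unfolding V_def by (rule L.Re_integral_iexp_ge) (use int in auto)
    moreover have "Re (\<integral>x. iexp (t * (x - m)) \<partial>L) \<le> cmod (\<integral>x. iexp (t * (x - m)) \<partial>L)"
      by (rule complex_Re_le_cmod)
    ultimately show ?thesis using le[of t] by linarith
  qed
  have "v \<le> V"
  proof (rule ccontr)
    assume "\<not> v \<le> V"
    then have lt: "V < v" by simp
    \<comment> \<open>\<open>T\<close> plays the role of t^2. It is chosen so that
      \<open>V * v * T + T\<close> equals \<open>v - V\<close>, contradicting the bound of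
      \<open>v - V\<close> by half of \<open>V * v * T\<close>; the summand 1 keeps the denominator
      positive when \<open>V\<close> is 0.\<close>
    define T where "T = (v - V) / (V * v + 1)"
    have den: "0 < V * v + 1" using V0 v by (simp add: add_nonneg_pos)
    have T: "0 < T" using lt den by (simp add: T_def)
    have "1 - T * V / 2 \<le> exp (- (v * T / 2))"
      using bound[of "sqrt T"] T by simp
    then have "(1 - T * V / 2) * (1 + v * T / 2) \<le> exp (- (v * T / 2)) * exp (v * T / 2)"
      using exp_ge_add_one_self[of "v * T / 2"] T v by (intro mult_mono) auto
    also have "\<dots> = 1" by (simp add: exp_add[symmetric])
    finally have "T / 2 * (v - V) \<le> T / 2 * (V * v * T / 2)"
      by (simp add: algebra_simps)
    then have "v - V \<le> V * v * T / 2"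
      using T by (simp add: mult_le_cancel_left_pos)
    also have "\<dots> < V * v * T + T" using T V0 v by (smt (verit) field_sum_of_halves mult_nonneg_nonneg zero_le_mult_iff)
    also have "V * v * T + T = T * (V * v + 1)"
      by (simp add: algebra_simps)
    also have "\<dots> = v - V"
      using den by (simp add: T_def)
    finally show False by simp
  qed
  then show ?thesis unfolding ev by (rule ennreal_leI)
qed simp

text \<open>Integrate 1 - cos 2y = 2 (1 - cos y)(1 + cos y), where the last factor is at most
  2.\<close>

lemma char_doubling:
  assumes "real_distribution D"
  shows "1 - Re (char D (2 * t)) \<le> 4 * (1 - Re (char D t))"
proof -
  interpret D: real_distribution D by fact
  have mass: "measure D UNIV = 1" using D.prob_space by simp
  have int: "integrable D (\<lambda>x. iexp (s * x))" for s
    by (rule D.integrable_const_bound[where B=1]) auto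
  have c: "integrable D (\<lambda>x. cos (s * x))" and Re: "Re (char D s) = (\<integral>x. cos (s * x) \<partial>D)" for s
    using integrable_Re[OF int[of s]] integral_Re[OF int[of s]] by (simp_all add: char_def Re_exp)
  have "1 - Re (char D (2 * t)) = (\<integral>x. 1 - cos (2 * t * x) \<partial>D)"
    using c by (simp add: Re mass)
  also have "\<dots> \<le> (\<integral>x. 4 * (1 - cos (t * x)) \<partial>D)"
  proof (rule integral_mono)
    show "integrable D (\<lambda>x. 4 * (1 - cos (t * x)))" "integrable D (\<lambda>x. 1 - cos (2 * t * x))"
      using c by auto
    fix x
    have "1 - cos (2 * (t * x)) = 2 * (1 - cos (t * x)) * (1 + cos (t * x))"
      unfolding cos_double_cos by (simp add: power2_eq_square algebra_simps)
    also have "\<dots> \<le> 2 * (1 - cos (t * x)) * 2"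
      using cos_le_one[of "t * x"] by (intro mult_left_mono) auto
    finally show "1 - cos (2 * t * x) \<le> 4 * (1 - cos (t * x))"
      by (simp add: mult.assoc)
  qed
  also have "\<dots> = 4 * (1 - Re (char D t))"
    using c by (simp add: Re mass)
  finally show ?thesis .
qed

text \<open>The defect \<open>1 - Re \<rho>\<close> of the limit \<open>\<rho>\<close> grows at most fourfold when the argument is doubled, but
  the second moment condition makes it of order \<open>t\<^sup>4\<close> at the origin.\<close>

lemma char_factor_trivial:
  assumes D: "\<And>n. real_distribution (D n)" and L: "real_distribution L"
    and lim: "\<And>t. (\<lambda>n. char (D n) t) \<longlonglongrightarrow> char L t * exp (of_real (v * t\<^sup>2 / 2))"
    and v: "0 \<le> v" and m2: "(\<integral>\<^sup>+x. ennreal (x\<^sup>2) \<partial>L) = ennreal v"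
  shows "(\<lambda>n. char (D n) t) \<longlonglongrightarrow> 1"
proof -
  interpret L: real_distribution L by fact
  define \<rho> where "\<rho> t = char L t * exp (of_real (v * t\<^sup>2 / 2))" for t
  define d where "d t = 1 - Re (\<rho> t)" for t
  have norm: "cmod (\<rho> t) \<le> 1" for t
  proof (rule LIMSEQ_le_const2[OF tendsto_norm[OF lim[of t], folded \<rho>_def]])
    show "\<exists>N. \<forall>n\<ge>N. cmod (char (D n) t) \<le> 1"
      using real_distribution.cmod_char_le_1[OF D] by blast
  qed
  have double: "d (2 * t) \<le> 4 * d t" for t
    unfolding d_def
  proof (rule LIMSEQ_le)
    show "(\<lambda>n. 1 - Re (char (D n) (2 * t))) \<longlonglongrightarrow> 1 - Re (\<rho> (2 * t))"
      unfolding \<rho>_def by (intro tendsto_diff tendsto_const tendsto_Re lim)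
    show "(\<lambda>n. 4 * (1 - Re (char (D n) t))) \<longlonglongrightarrow> 4 * (1 - Re (\<rho> t))"
      unfolding \<rho>_def by (intro tendsto_mult tendsto_diff tendsto_const tendsto_Re lim)
    show "\<exists>N. \<forall>n\<ge>N. 1 - Re (char (D n) (2 * t)) \<le> 4 * (1 - Re (char (D n) t))"
      using char_doubling[OF D] by blast
  qed
  have int: "integrable L (\<lambda>x. x\<^sup>2)"
    using m2 by (intro integrableI_nonneg) auto
  have "(\<integral>x. x\<^sup>2 \<partial>L) = v"
    using nn_integral_eq_integral[OF int] m2 v by simp
  then have Re_ge: "1 - v * t\<^sup>2 / 2 \<le> Re (char L t)" for t
    using L.Re_integral_iexp_ge[of "\<lambda>x. x" t] int by (simp add: char_def mult.commute)
  \<comment> \<open>With s = v t^2 / 2 the product (1 - s)(1 + s) is 1 - s^2: the second moment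
    being exactly \<open>v\<close>, the first-order terms of \<open>char L\<close> and of the
    Gaussian factor cancel. The condition s at most 1 keeps 1 - s nonnegative.\<close>
  have small: "d t \<le> (v * t\<^sup>2 / 2)\<^sup>2" if "v * t\<^sup>2 / 2 \<le> 1" for t
  proof -
    let ?s = "v * t\<^sup>2 / 2"
    have s: "0 \<le> ?s" using v by simp
    have "(1 - ?s) * (1 + ?s) \<le> (1 - ?s) * exp ?s"
      using that by (intro mult_left_mono) auto
    also have "\<dots> \<le> Re (char L t) * exp ?s"
      using Re_ge by (intro mult_right_mono) auto
    also have "\<dots> = Re (\<rho> t)"
      unfolding \<rho>_def exp_of_real by simp
    finally show ?thesis by (simp add: d_def power2_eq_square algebra_simps)
  qed
  have iter: "d t \<le> 4 ^ k * d (t / 2 ^ k)" for t k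
  proof (induction k)
    case (Suc k)
    have "d (t / 2 ^ k) \<le> 4 * d (t / 2 ^ Suc k)"
      using double[of "t / 2 ^ Suc k"] by simp
    then have "4 ^ k * d (t / 2 ^ k) \<le> 4 ^ k * (4 * d (t / 2 ^ Suc k))"
      by (intro mult_left_mono) auto
    from order_trans[OF Suc this] show ?case by (simp only: power_Suc2 mult.assoc)
  qed simp
  have d0: "d t \<le> 0" for t
  proof (rule LIMSEQ_le_const)
    have pow: "(\<lambda>k. (1 / 4 :: real) ^ k) \<longlonglongrightarrow> 0"
      by (rule LIMSEQ_realpow_zero) auto
    show "(\<lambda>k. (v * t\<^sup>2 / 2)\<^sup>2 * (1 / 4) ^ k) \<longlonglongrightarrow> 0"
      using tendsto_mult[OF tendsto_const pow] by simp
    have s: "v * (t / 2 ^ k)\<^sup>2 / 2 = v * t\<^sup>2 / 2 * (1 / 4) ^ k" for k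
      by (simp add: power_divide power_mult_distrib[symmetric] power2_eq_square)
    have "(\<lambda>k. v * t\<^sup>2 / 2 * (1 / 4) ^ k) \<longlonglongrightarrow> 0"
      using tendsto_mult[OF tendsto_const pow] by simp
    then have "\<forall>\<^sub>F k in sequentially. v * t\<^sup>2 / 2 * (1 / 4) ^ k < 1"
      by (rule order_tendstoD) simp
    then obtain N where N: "\<And>k. k \<ge> N \<Longrightarrow> v * t\<^sup>2 / 2 * (1 / 4) ^ k < 1"
      unfolding eventually_sequentially by blast
    \<comment> \<open>Undoing k halvings costs 4^k, while the quartic bound at t / 2^k gains
      16^-k.\<close>
    have "d t \<le> (v * t\<^sup>2 / 2)\<^sup>2 * (1 / 4) ^ k" if "k \<ge> N" for k
    proof -
      have "d (t / 2 ^ k) \<le> (v * t\<^sup>2 / 2 * (1 / 4) ^ k)\<^sup>2"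
        using small[of "t / 2 ^ k"] N[OF that] unfolding s by simp
      then have "4 ^ k * d (t / 2 ^ k) \<le> 4 ^ k * (v * t\<^sup>2 / 2 * (1 / 4) ^ k)\<^sup>2"
        by (intro mult_left_mono) auto
      also have "\<dots> = (v * t\<^sup>2 / 2)\<^sup>2 * (1 / 4) ^ k * (4 ^ k * (1 / 4) ^ k)"
        by (simp add: power2_eq_square mult_ac)
      also have "(4 :: real) ^ k * (1 / 4) ^ k = 1"
        by (simp add: power_mult_distrib[symmetric])
      finally show ?thesis using iter[of t k] by simp
    qed
    then show "\<exists>N. \<forall>k\<ge>N. d t \<le> (v * t\<^sup>2 / 2)\<^sup>2 * (1 / 4) ^ k" by blast
  qed
  have "\<rho> t = 1"
  \<comment> \<open>A point of the closed unit disc with real part at least 1 must be 1.\<close>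
  proof -
    have "Re (\<rho> t) \<ge> 1" using d0[of t] by (simp add: d_def)
    moreover have "(Re (\<rho> t))\<^sup>2 + (Im (\<rho> t))\<^sup>2 \<le> 1"
      using norm[of t] by (simp add: cmod_def)
    moreover have "(Re (\<rho> t))\<^sup>2 \<ge> 1" using calculation(1) by (simp add: one_le_power)
    ultimately have im: "(Im (\<rho> t))\<^sup>2 \<le> 0" and "(Re (\<rho> t))\<^sup>2 \<le> 1"
      using zero_le_power2[of "Im (\<rho> t)"] by linarith+
    then have "Re (\<rho> t) \<le> 1" by (simp add: abs_square_le_1)
    then show ?thesis
      using im \<open>Re (\<rho> t) \<ge> 1\<close> by (simp add: complex_eq_iff)
  qed
  then show ?thesis using lim[of t] by (simp add: \<rho>_def)
qed

text \<open>By Levy continuity the laws converge to the point mass at 0, whose distribution function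
  is continuous at both \<epsilon> and -\<epsilon>; the two tails are read off there.\<close>

lemma char_tendsto_1_imp_measure:
  assumes D: "\<And>n. real_distribution (D n)"
    and lim: "\<And>t. (\<lambda>n. char (D n) t) \<longlonglongrightarrow> 1" and \<epsilon>: "0 < \<epsilon>"
  shows "(\<lambda>n. measure (D n) {x. \<epsilon> < \<bar>x\<bar>}) \<longlonglongrightarrow> 0"
proof -
  define Z where "Z = return borel (0::real)"
  interpret Z: real_distribution Z
    by (simp add: Z_def real_distribution_def real_distribution_axioms_def prob_space_return)
  have "char Z t = 1" for t
    unfolding char_def Z_def by (subst integral_return) auto
  then have "weak_conv_m D Z"
    using lim by (intro levy_continuity D) (auto simp: Z.real_distribution_axioms)
  moreover have "isCont (cdf Z) x" if "x \<noteq> 0" for x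
    using that unfolding Z.isCont_cdf by (simp add: Z_def measure_return)
  ultimately have c: "(\<lambda>n. cdf (D n) x) \<longlonglongrightarrow> cdf Z x" if "x \<noteq> 0" for x
    using that by (auto simp: weak_conv_m_def weak_conv_def)
  have cdfZ: "cdf Z x = (if 0 \<le> x then 1 else 0)" for x
    by (simp add: cdf_def Z_def measure_return)
  have "(\<lambda>n. cdf (D n) (- \<epsilon>) + (1 - cdf (D n) \<epsilon>)) \<longlonglongrightarrow> cdf Z (- \<epsilon>) + (1 - cdf Z \<epsilon>)"
    using \<epsilon> by (intro tendsto_intros c) auto
  then have lim0: "(\<lambda>n. cdf (D n) (- \<epsilon>) + (1 - cdf (D n) \<epsilon>)) \<longlonglongrightarrow> 0"
    using \<epsilon> by (simp add: cdfZ)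
  show ?thesis
  proof (rule real_tendsto_sandwich[OF _ _ tendsto_const lim0])
    show "\<forall>\<^sub>F n in sequentially. measure (D n) {x. \<epsilon> < \<bar>x\<bar>} \<le> cdf (D n) (- \<epsilon>) + (1 - cdf (D n) \<epsilon>)"
    proof (intro always_eventually allI)
      fix n
      interpret D: real_distribution "D n" by (rule D)
      have "measure (D n) {x. \<epsilon> < \<bar>x\<bar>} \<le> measure (D n) ({..- \<epsilon>} \<union> {\<epsilon><..})"
        by (intro D.finite_measure_mono) auto
      also have "\<dots> \<le> measure (D n) {..- \<epsilon>} + measure (D n) {\<epsilon><..}"
        by (rule measure_Un_le) auto
      also have "measure (D n) {\<epsilon><..} = 1 - measure (D n) {..\<epsilon>}"
        using D.prob_compl[of "{..\<epsilon>}"] by (simp add: Compl_eq_Diff_UNIV[symmetric] Compl_atMost)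
      finally show "measure (D n) {x. \<epsilon> < \<bar>x\<bar>} \<le> cdf (D n) (- \<epsilon>) + (1 - cdf (D n) \<epsilon>)"
        by (simp add: cdf_def)
    qed
  qed simp
qed

text \<open>The square is what Cauchy-Schwarz needs when this factor is later paired with tilted
  products bounded in L2.\<close>

lemma measure_tendsto_0_imp_iexp:
  fixes R :: "nat \<Rightarrow> 'w \<Rightarrow> real"
  assumes Q: "\<And>n. prob_space (Q n)" and R[measurable]: "\<And>n. R n \<in> borel_measurable (Q n)"
    and lim: "\<And>\<epsilon>. 0 < \<epsilon> \<Longrightarrow> (\<lambda>n. measure (Q n) {\<omega>\<in>space (Q n). \<epsilon> < \<bar>R n \<omega>\<bar>}) \<longlonglongrightarrow> 0"
  shows "(\<lambda>n. \<integral>\<omega>. (cmod (iexp (t * R n \<omega>) - 1))\<^sup>2 \<partial>Q n) \<longlonglongrightarrow> 0"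
proof (rule tendstoI)
  fix e :: real assume e: "0 < e"
  \<comment> \<open>The 1 in the denominator covers t = 0. Off the exceptional set the integrand is
    at most e/2; on it at most 4, which is why its probability is kept below e/8.\<close>
  define \<epsilon> where "\<epsilon> = sqrt (e / 2) / (\<bar>t\<bar> + 1)"
  have \<epsilon>: "0 < \<epsilon>" using e by (simp add: \<epsilon>_def add_nonneg_pos)
  have t\<epsilon>: "(\<bar>t\<bar> * \<epsilon>)\<^sup>2 \<le> e / 2"
  proof -
    have "\<bar>t\<bar> * \<epsilon> = \<bar>t\<bar> / (\<bar>t\<bar> + 1) * sqrt (e / 2)" by (simp add: \<epsilon>_def)
    also have "\<dots> \<le> 1 * sqrt (e / 2)"
      using e by (intro mult_right_mono) auto
    finally have "(\<bar>t\<bar> * \<epsilon>)\<^sup>2 \<le> (sqrt (e / 2))\<^sup>2"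
      using \<epsilon> by (intro power_mono) auto
    then show ?thesis using e by simp
  qed
  have "\<forall>\<^sub>F n in sequentially. measure (Q n) {\<omega>\<in>space (Q n). \<epsilon> < \<bar>R n \<omega>\<bar>} < e / 8"
    using e by (intro order_tendstoD(2)[OF lim[OF \<epsilon>]]) auto
  then show "\<forall>\<^sub>F n in sequentially. dist (\<integral>\<omega>. (cmod (iexp (t * R n \<omega>) - 1))\<^sup>2 \<partial>Q n) 0 < e"
  proof eventually_elim
    case (elim n)
    interpret Q: prob_space "Q n" by (rule Q)
    let ?A = "{\<omega>\<in>space (Q n). \<epsilon> < \<bar>R n \<omega>\<bar>}"
    have A: "integrable (Q n) (indicat_real ?A)"
      by (rule integrable_real_indicator) (simp_all add: less_top[symmetric])
    have le4: "(cmod (iexp y - 1))\<^sup>2 \<le> 4" for y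
      using power_mono[OF norm_iexp_diff_le(2)[of y], of 2] by simp
    have "(\<integral>\<omega>. (cmod (iexp (t * R n \<omega>) - 1))\<^sup>2 \<partial>Q n) \<le> (\<integral>\<omega>. 4 * indicator ?A \<omega> + e / 2 \<partial>Q n)"
    proof (rule integral_mono)
      show "integrable (Q n) (\<lambda>\<omega>. (cmod (iexp (t * R n \<omega>) - 1))\<^sup>2)"
        using le4[of "t * R n _"] by (intro Q.integrable_const_bound[where B=4] AE_I2) auto
      show "integrable (Q n) (\<lambda>\<omega>. 4 * indicator ?A \<omega> + e / 2)"
        using A by (intro Bochner_Integration.integrable_add integrable_mult_right) auto
      fix \<omega> assume \<omega>: "\<omega> \<in> space (Q n)"
      show "(cmod (iexp (t * R n \<omega>) - 1))\<^sup>2 \<le> 4 * indicator ?A \<omega> + e / 2"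
      proof (cases "\<omega> \<in> ?A")
        case True
        then show ?thesis using le4[of "t * R n \<omega>"] e by simp
      next
        case False
        then have "\<bar>R n \<omega>\<bar> \<le> \<epsilon>" using \<omega> by auto
        have "cmod (iexp (t * R n \<omega>) - 1) \<le> \<bar>t\<bar> * \<bar>R n \<omega>\<bar>"
          using norm_iexp_diff_le(1)[of "t * R n \<omega>"] by (simp add: abs_mult)
        also have "\<dots> \<le> \<bar>t\<bar> * \<epsilon>"
          using \<open>\<bar>R n \<omega>\<bar> \<le> \<epsilon>\<close> by (rule mult_left_mono) simp
        finally have "(cmod (iexp (t * R n \<omega>) - 1))\<^sup>2 \<le> (\<bar>t\<bar> * \<epsilon>)\<^sup>2"
          by (rule power_mono) simp
        then show ?thesis using False t\<epsilon> by simp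
      qed
    qed
    also have "\<dots> = 4 * measure (Q n) ?A + e / 2"
      using A by (subst Bochner_Integration.integral_add) (auto simp: Q.prob_space)
    also have "\<dots> < e" using elim by simp
    finally show ?case by simp
  qed
qed

text \<open>A rescaled standard normal instead of a density, so that variance 0 yields the point
  mass at 0.\<close>

definition normal_law :: "real \<Rightarrow> real measure" where
  "normal_law v = distr std_normal_distribution borel (\<lambda>x. sqrt v * x)"

lemma normal_law:
  assumes v: "0 \<le> v"
  shows "real_distribution (normal_law v)"
    and "char (normal_law v) t = of_real (exp (- (v * t\<^sup>2 / 2)))"
    and "(\<integral>\<^sup>+x. ennreal (x\<^sup>2) \<partial>normal_law v) = ennreal v"
    and "ext_variance (normal_law v) = ennreal v"
proof -
  interpret N: real_distribution std_normal_distribution by (rule real_dist_normal_dist)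
  show "real_distribution (normal_law v)"
    unfolding normal_law_def by (rule N.real_distribution_distr) simp
  have "char (normal_law v) t = char std_normal_distribution (t * sqrt v)"
    unfolding normal_law_def char_def by (subst integral_distr) (simp_all add: mult_ac)
  then show "char (normal_law v) t = of_real (exp (- (v * t\<^sup>2 / 2)))"
    using v by (simp add: char_std_normal_distribution power_mult_distrib mult.commute)
  have i2: "integrable std_normal_distribution (\<lambda>x. x\<^sup>2)" "(\<integral>x. x\<^sup>2 \<partial>std_normal_distribution) = 1"
    using std_normal_distribution_even_moments[of 1] by simp_all
  have "(\<integral>\<^sup>+x. ennreal (x\<^sup>2) \<partial>normal_law v) = (\<integral>\<^sup>+x. ennreal (v * x\<^sup>2) \<partial>std_normal_distribution)"
    unfolding normal_law_def using v by (subst nn_integral_distr) (simp_all add: power_mult_distrib)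
  also have "\<dots> = ennreal (\<integral>x. v * x\<^sup>2 \<partial>std_normal_distribution)"
    using v i2 by (intro nn_integral_eq_integral) auto
  finally show m2: "(\<integral>\<^sup>+x. ennreal (x\<^sup>2) \<partial>normal_law v) = ennreal v"
    using i2 by simp
  have "(\<integral>y. y \<partial>normal_law v) = 0"
    unfolding normal_law_def using integral_std_normal_distribution_moment_odd[of 1] by (subst integral_distr) simp_all
  then show "ext_variance (normal_law v) = ennreal v"
    using m2 by (simp add: ext_variance_def)
qed

section \<open>Lebesgue decomposition and the joint law\<close>

text \<open>By exhaustion: \<open>A\<close> is a union of M-null sets and has the largest N-mass
  among M-null sets. The singular part is N on \<open>A\<close>, the other part N off
  \<open>A\<close>. This justifies the choice in \<open>ac_part\<close>.\<close>

lemma Lebesgue_decomposition: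
  fixes M N :: "'a measure"
  assumes N: "finite_measure N" and sets_eq: "sets N = sets M"
  shows "\<exists>K. sets K = sets M \<and> absolutely_continuous M K \<and>
     (\<exists>L. mutually_singular M L \<and> (\<forall>A\<in>sets M. emeasure N A = emeasure K A + emeasure L A))"
proof -
  interpret N: finite_measure N by fact
  have sp: "space N = space M" using sets_eq by (rule sets_eq_imp_space_eq)
  obtain f :: "nat \<Rightarrow> ennreal" where f: "range f \<subseteq> emeasure N ` null_sets M"
    and sup: "Sup (emeasure N ` null_sets M) = Sup (range f)"
  proof -
    have "null_sets M \<noteq> {}" using null_sets.empty_sets by blast
    from ennreal_SUP_countable_SUP[OF this, of "emeasure N"] show thesis
      using that by blast
  qed
  have "\<forall>i. \<exists>E. E \<in> null_sets M \<and> f i = emeasure N E"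
    using f by blast
  then obtain B where B: "\<And>i. B i \<in> null_sets M" "\<And>i. f i = emeasure N (B i)"
    by metis
  define A where "A = (\<Union>i::nat. B i)"
  have A: "A \<in> null_sets M" unfolding A_def using B(1) by (intro null_sets_UN) auto
  then have [measurable]: "A \<in> sets M" "A \<in> sets N" using sets_eq by auto
  have max: "emeasure N E \<le> emeasure N A" if "E \<in> null_sets M" for E
  proof -
    have "emeasure N E \<le> Sup (range f)" unfolding sup[symmetric] using that by (rule SUP_upper)
    also have "\<dots> \<le> emeasure N A"
      using B \<open>A \<in> sets N\<close> by (intro SUP_least) (auto simp: A_def intro!: emeasure_mono)
    finally show ?thesis .
  qed
  define K where "K = density N (indicator (space M - A))"
  define L where "L = density N (indicator A)"
  have K: "emeasure K E = emeasure N ((space M - A) \<inter> E)" if "E \<in> sets M" for E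
    unfolding K_def using that sets_eq by (intro emeasure_restricted) auto
  have L: "emeasure L E = emeasure N (A \<inter> E)" if "E \<in> sets M" for E
    unfolding L_def using that sets_eq by (intro emeasure_restricted) auto
  have split: "emeasure N E = emeasure N ((space M - A) \<inter> E) + emeasure N (A \<inter> E)" if [measurable]: "E \<in> sets M" for E
  proof -
    have "E = ((space M - A) \<inter> E) \<union> (A \<inter> E)"
      using sets.sets_into_space[OF that] by auto
    moreover have "emeasure N (((space M - A) \<inter> E) \<union> (A \<inter> E)) = emeasure N ((space M - A) \<inter> E) + emeasure N (A \<inter> E)"
      by (rule plus_emeasure[symmetric]) (auto simp: sets_eq)
    ultimately show ?thesis by simp
  qed
  show ?thesis
  proof (rule exI[of _ K], intro conjI exI[of _ L] ballI)
    show "sets K = sets M" using sets_eq by (simp add: K_def)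
    show "absolutely_continuous M K"
      unfolding absolutely_continuous_def
    proof
      fix E assume E: "E \<in> null_sets M"
      then have [measurable]: "E \<in> sets M" by auto
      \<comment> \<open>An M-null set charged outside \<open>A\<close> would make
        \<open>E \<union> A\<close> exceed the maximal mass; finiteness of \<open>N\<close> allows
        the cancellation.\<close>
      have "emeasure N ((space M - A) \<inter> (E \<union> A)) + emeasure N (A \<inter> (E \<union> A)) \<le> emeasure N A"
        using max[of "E \<union> A"] E A split[of "E \<union> A"] by auto
      moreover have "A \<inter> (E \<union> A) = A" by auto
      moreover have "(space M - A) \<inter> (E \<union> A) = (space M - A) \<inter> E" by auto
      ultimately have "emeasure N ((space M - A) \<inter> E) + emeasure N A \<le> 0 + emeasure N A"
        by simp
      then have "emeasure N ((space M - A) \<inter> E) = 0"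
        using N.emeasure_finite[of A] by (simp add: ennreal_add_left_cancel_le add.commute[of _ "emeasure N A"])
      then show "E \<in> null_sets K"
        using K[of E] by (simp add: null_sets_def K_def sets_eq)
    qed
    show "mutually_singular M L"
      unfolding mutually_singular_def
    proof (intro conjI bexI[of _ A])
      show "sets L = sets M" using sets_eq by (simp add: L_def)
      show "emeasure M A = 0" using A by auto
      show "emeasure L (space M - A) = 0" by (subst L) auto
    qed simp
    show "emeasure N E = emeasure K E + emeasure L E" if "E \<in> sets M" for E
      unfolding K[OF that] L[OF that] by (rule split[OF that])
  qed
qed

text \<open>Whatever decomposition was chosen, its absolutely continuous part is the alternative
  restricted to the complement \<open>C\<close> of an M-null carrier of the singular part. Only this
  description of the derivative is used for changes of measure.\<close>

lemma ac_deriv_density: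
  fixes G :: "'p::plus \<Rightarrow> 't measure"
  assumes M: "finite_measure (G \<tau>)" and N: "finite_measure (G (\<tau> + \<Delta>))"
    and sets_eq: "sets (G (\<tau> + \<Delta>)) = sets (G \<tau>)"
  shows "\<exists>C\<in>sets (G \<tau>). density (G \<tau>) (\<lambda>t. ennreal (ac_deriv G \<tau> \<Delta> t)) = density (G (\<tau> + \<Delta>)) (indicator C)"
    and "integrable (G \<tau>) (ac_deriv G \<tau> \<Delta>)"
proof -
  define M N where "M = G \<tau>" and "N = G (\<tau> + \<Delta>)"
  interpret M: finite_measure M unfolding M_def by fact
  interpret N: finite_measure N unfolding N_def by fact
  have sets_eq: "sets N = sets M" using sets_eq by (simp add: M_def N_def)
  define K where "K = ac_part M N"
  from someI_ex[OF Lebesgue_decomposition[OF N.finite_measure_axioms sets_eq]]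
  have sK: "sets K = sets M" and ac: "absolutely_continuous M K"
    and "\<exists>L. mutually_singular M L \<and> (\<forall>A\<in>sets M. emeasure N A = emeasure K A + emeasure L A)"
    unfolding K_def ac_part_def by blast+
  then obtain L A where N_eq: "\<And>E. E \<in> sets M \<Longrightarrow> emeasure N E = emeasure K E + emeasure L E"
    and sL: "sets L = sets M" and A[measurable]: "A \<in> sets M" and MA: "emeasure M A = 0" and LA: "emeasure L (space M - A) = 0"
    unfolding mutually_singular_def by blast
  define C where "C = space M - A"
  have C[measurable]: "C \<in> sets M" by (simp add: C_def)
  \<comment> \<open>\<open>K\<close> does not charge the M-null set \<open>A\<close>, and
    \<open>L\<close> does not charge its complement \<open>C\<close>; so \<open>N\<close> and
    \<open>K\<close> agree inside \<open>C\<close>.\<close>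
  have K_eq: "K = density N (indicator C)"
  proof (rule measure_eqI)
    show "sets K = sets (density N (indicator C))" using sK sets_eq by simp
    fix E assume "E \<in> sets K"
    then have [measurable]: "E \<in> sets M" using sK by simp
    have "A \<inter> E \<in> null_sets M"
      using MA by (intro null_set_Int2[of A M E, simplified Int_commute] null_setsI) auto
    then have "A \<inter> E \<in> null_sets K"
      using ac unfolding absolutely_continuous_def by auto
    then have KA: "emeasure K (A \<inter> E) = 0" by auto
    have "E = (C \<inter> E) \<union> (A \<inter> E)"
      using sets.sets_into_space[OF \<open>E \<in> sets M\<close>] by (auto simp: C_def)
    moreover have "emeasure K ((C \<inter> E) \<union> (A \<inter> E)) = emeasure K (C \<inter> E) + emeasure K (A \<inter> E)"
      by (rule plus_emeasure[symmetric]) (auto simp: sK C_def)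
    ultimately have "emeasure K E = emeasure K (C \<inter> E)" using KA by simp
    moreover have "emeasure L (C \<inter> E) \<le> emeasure L C"
      by (rule emeasure_mono) (auto simp: sL)
    then have "emeasure L (C \<inter> E) = 0" using LA by (simp add: C_def)
    ultimately have "emeasure K E = emeasure N (C \<inter> E)"
      using N_eq[of "C \<inter> E"] by simp
    also have "\<dots> = emeasure (density N (indicator C)) E"
      using sets_eq by (intro emeasure_restricted[symmetric]) auto
    finally show "emeasure K E = emeasure (density N (indicator C)) E" .
  qed
  have fin: "emeasure K (space K) \<noteq> \<infinity>"
  proof -
    have "space K = space M" using sK by (rule sets_eq_imp_space_eq)
    moreover have "emeasure K (space M) \<le> emeasure N (space M)"
      using N_eq[of "space M"] by simp
    ultimately show ?thesis
      using N.emeasure_finite[of "space M"] by (auto simp: top_unique)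
  qed
  interpret K: finite_measure K by (rule finite_measureI) fact
  have dens: "density M (RN_deriv M K) = K"
    by (rule M.density_RN_deriv[OF ac sK])
  have ae: "AE t in M. RN_deriv M K t \<noteq> \<infinity>"
    by (rule M.RN_deriv_finite[OF K.sigma_finite_measure_axioms ac sK])
  have g: "ac_deriv G \<tau> \<Delta> = (\<lambda>t. enn2real (RN_deriv M K t))"
    by (simp add: ac_deriv_def[abs_def] M_def N_def K_def)
  \<comment> \<open>\<open>enn2real\<close> changes the derivative only where it is infinite, a null
    set because \<open>K\<close> is finite.\<close>
  have ae': "AE t in M. ennreal (ac_deriv G \<tau> \<Delta> t) = RN_deriv M K t"
    using ae by eventually_elim (simp add: g less_top)
  have meas: "ac_deriv G \<tau> \<Delta> \<in> borel_measurable M" unfolding g by measurable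
  have "density M (\<lambda>t. ennreal (ac_deriv G \<tau> \<Delta> t)) = density M (RN_deriv M K)"
    by (rule density_cong) (use ae' meas in auto)
  then show "\<exists>C\<in>sets (G \<tau>). density (G \<tau>) (\<lambda>t. ennreal (ac_deriv G \<tau> \<Delta> t)) = density (G (\<tau> + \<Delta>)) (indicator C)"
    using C dens K_eq unfolding M_def N_def by auto
  have "(\<integral>\<^sup>+t. ennreal (ac_deriv G \<tau> \<Delta> t) \<partial>M) = (\<integral>\<^sup>+t. RN_deriv M K t \<partial>M)"
    using ae' by (rule nn_integral_cong_AE)
  also have "\<dots> = emeasure (density M (RN_deriv M K)) (space M)"
    by (simp add: emeasure_density)
  also have "\<dots> < \<infinity>"
    unfolding dens by (simp add: less_top[symmetric])
  finally have "integrable M (ac_deriv G \<tau> \<Delta>)"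
    by (intro integrableI_nonneg meas) (simp_all add: g)
  then show "integrable (G \<tau>) (ac_deriv G \<tau> \<Delta>)" by (simp add: M_def)
qed

text \<open>Integrating out x first gives 1 for every t, so the second marginal is \<open>G\<close>;
  total mass 1 is then inherited from the marginal.\<close>

lemma
  assumes \<nu>: "sigma_finite_measure \<nu>" and G: "prob_space G"
    and f[measurable]: "(\<lambda>(x, t). f x t) \<in> borel_measurable (\<nu> \<Otimes>\<^sub>M G)"
    and f1: "\<And>t. t \<in> space G \<Longrightarrow> (\<integral>\<^sup>+ x. ennreal (f x t) \<partial>\<nu>) = 1"
  shows sets_joint_law: "sets (joint_law \<nu> f G) = sets (\<nu> \<Otimes>\<^sub>M G)"
    and distr_joint_law_snd: "distr (joint_law \<nu> f G) G snd = G"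
    and prob_space_joint_law: "prob_space (joint_law \<nu> f G)"
proof -
  interpret \<nu>: sigma_finite_measure \<nu> by fact
  interpret G: prob_space G by fact
  interpret pair_sigma_finite \<nu> G
    by (simp add: pair_sigma_finite_def \<nu>.sigma_finite_measure_axioms G.sigma_finite_measure_axioms)
  have fe[measurable]: "(\<lambda>(x, t). ennreal (f x t)) \<in> borel_measurable (\<nu> \<Otimes>\<^sub>M G)"
    using f by (simp add: split_def)
  show s: "sets (joint_law \<nu> f G) = sets (\<nu> \<Otimes>\<^sub>M G)" by (simp add: joint_law_def)
  have snd[measurable]: "snd \<in> measurable (joint_law \<nu> f G) G"
    unfolding measurable_cong_sets[OF s refl] by simp
  show d: "distr (joint_law \<nu> f G) G snd = G"
  proof (rule measure_eqI)
    fix B assume "B \<in> sets (distr (joint_law \<nu> f G) G snd)"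
    then have B[measurable]: "B \<in> sets G" by simp
    have "emeasure (distr (joint_law \<nu> f G) G snd) B = emeasure (joint_law \<nu> f G) (space \<nu> \<times> B)"
      using sets.sets_into_space[OF B]
      by (subst emeasure_distr) (auto simp: joint_law_def space_pair_measure intro!: arg_cong[where f="emeasure _"])
    also have "\<dots> = (\<integral>\<^sup>+z. (case z of (x, t) \<Rightarrow> ennreal (f x t)) * indicator (space \<nu> \<times> B) z \<partial>(\<nu> \<Otimes>\<^sub>M G))"
      unfolding joint_law_def by (rule emeasure_density) auto
    also have "\<dots> = (\<integral>\<^sup>+t. (\<integral>\<^sup>+x. (case (x, t) of (x, t) \<Rightarrow> ennreal (f x t)) * indicator (space \<nu> \<times> B) (x, t) \<partial>\<nu>) \<partial>G)"
      by (rule nn_integral_snd[symmetric]) measurable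
    also have "\<dots> = (\<integral>\<^sup>+t. indicator B t \<partial>G)"
    proof (rule nn_integral_cong)
      fix t assume t: "t \<in> space G"
      then have [measurable]: "(\<lambda>x. ennreal (f x t)) \<in> borel_measurable \<nu>"
        using measurable_Pair1[OF fe, of t] by simp
      have "(\<integral>\<^sup>+x. (case (x, t) of (x, t) \<Rightarrow> ennreal (f x t)) * indicator (space \<nu> \<times> B) (x, t) \<partial>\<nu>)
         = (\<integral>\<^sup>+x. ennreal (f x t) * indicator B t \<partial>\<nu>)"
        by (rule nn_integral_cong) (simp add: indicator_def)
      also have "\<dots> = indicator B t"
        using f1[OF t] by (simp add: nn_integral_multc)
      finally show "(\<integral>\<^sup>+x. (case (x, t) of (x, t) \<Rightarrow> ennreal (f x t)) * indicator (space \<nu> \<times> B) (x, t) \<partial>\<nu>) = indicator B t" .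
    qed
    finally show "emeasure (distr (joint_law \<nu> f G) G snd) B = emeasure G B" by simp
  qed simp
  have "prob_space (distr (joint_law \<nu> f G) G snd)" using d G by simp
  then show "prob_space (joint_law \<nu> f G)"
    by (rule prob_space_distrD[OF snd])
qed

text \<open>The kernel f(x|t) is shared by both laws and cancels from their likelihood ratio, which
  therefore depends on t only. In the Fubini argument \<phi> is the inner integral over x, common to
  both sides.\<close>

lemma joint_law_density_snd:
  assumes \<nu>: "sigma_finite_measure \<nu>" and G: "prob_space G" "prob_space G'" and sets_eq: "sets G' = sets G"
    and f[measurable]: "(\<lambda>(x, t). f x t) \<in> borel_measurable (\<nu> \<Otimes>\<^sub>M G)"
    and g[measurable]: "g \<in> borel_measurable G" and C[measurable]: "C \<in> sets G"
    and dens: "density G g = density G' (indicator C)"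
  shows "density (joint_law \<nu> f G) (\<lambda>z. g (snd z)) = density (joint_law \<nu> f G') (indicator (space \<nu> \<times> C))"
proof -
  interpret \<nu>: sigma_finite_measure \<nu> by fact
  interpret G: prob_space G by fact
  interpret G': prob_space G' by fact
  interpret p: pair_sigma_finite \<nu> G
    by (simp add: pair_sigma_finite_def \<nu>.sigma_finite_measure_axioms G.sigma_finite_measure_axioms)
  interpret p': pair_sigma_finite \<nu> G'
    by (simp add: pair_sigma_finite_def \<nu>.sigma_finite_measure_axioms G'.sigma_finite_measure_axioms)
  have sp: "sets (\<nu> \<Otimes>\<^sub>M G') = sets (\<nu> \<Otimes>\<^sub>M G)"
    using sets_eq by (intro sets_pair_measure_cong) auto
  have m: "borel_measurable (\<nu> \<Otimes>\<^sub>M G') = borel_measurable (\<nu> \<Otimes>\<^sub>M G)" "borel_measurable G' = borel_measurable G"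
    using sp sets_eq by (auto intro!: measurable_cong_sets)
  have fe': "(\<lambda>(x, t). ennreal (f x t)) \<in> borel_measurable (\<nu> \<Otimes>\<^sub>M G')"
    unfolding m using f by (simp add: split_def)
  have C': "C \<in> sets G'" using C sets_eq by simp
  then have SC: "space \<nu> \<times> C \<in> sets (\<nu> \<Otimes>\<^sub>M G')" by auto
  show ?thesis
  proof (rule measure_eqI)
    show "sets (density (joint_law \<nu> f G) (\<lambda>z. g (snd z))) = sets (density (joint_law \<nu> f G') (indicator (space \<nu> \<times> C)))"
      using sp by (simp add: joint_law_def)
    fix E assume "E \<in> sets (density (joint_law \<nu> f G) (\<lambda>z. g (snd z)))"
    then have E[measurable]: "E \<in> sets (\<nu> \<Otimes>\<^sub>M G)" by (simp add: joint_law_def)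
    then have E': "E \<in> sets (\<nu> \<Otimes>\<^sub>M G')" using sp by simp
    define k where "k z = ennreal (f (fst z) (snd z)) * indicator E z" for z
    have k[measurable]: "k \<in> borel_measurable (\<nu> \<Otimes>\<^sub>M G)"
      using f unfolding k_def by (simp add: split_def)
    define \<phi> where "\<phi> t = (\<integral>\<^sup>+x. k (x, t) \<partial>\<nu>)" for t
    have \<phi>[measurable]: "\<phi> \<in> borel_measurable G"
      unfolding \<phi>_def using k by measurable
    have slice: "(\<lambda>x. k (x, t)) \<in> borel_measurable \<nu>" if "t \<in> space G" for t
      using measurable_Pair1[OF k] that by simp
    have "emeasure (density (joint_law \<nu> f G) (\<lambda>z. g (snd z))) E
       = (\<integral>\<^sup>+z. g (snd z) * indicator E z \<partial>joint_law \<nu> f G)"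
      by (rule emeasure_density) (simp_all add: joint_law_def)
    also have "\<dots> = (\<integral>\<^sup>+z. (case z of (x, t) \<Rightarrow> ennreal (f x t)) * (g (snd z) * indicator E z) \<partial>(\<nu> \<Otimes>\<^sub>M G))"
      unfolding joint_law_def using f by (intro nn_integral_density) (simp_all add: split_def)
    also have "\<dots> = (\<integral>\<^sup>+z. g (snd z) * k z \<partial>(\<nu> \<Otimes>\<^sub>M G))"
      by (simp add: k_def split_def mult_ac)
    also have "\<dots> = (\<integral>\<^sup>+t. (\<integral>\<^sup>+x. g (snd (x, t)) * k (x, t) \<partial>\<nu>) \<partial>G)"
      by (rule p.nn_integral_snd[symmetric]) measurable
    also have "\<dots> = (\<integral>\<^sup>+t. g t * \<phi> t \<partial>G)"
      unfolding \<phi>_def using slice by (intro nn_integral_cong) (simp add: nn_integral_cmult)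
    also have "\<dots> = (\<integral>\<^sup>+t. \<phi> t \<partial>density G g)"
      by (rule nn_integral_density[symmetric]) measurable
    also have "\<dots> = (\<integral>\<^sup>+t. indicator C t * \<phi> t \<partial>G')"
      unfolding dens using C' \<phi> m by (intro nn_integral_density) auto
    also have "\<dots> = (\<integral>\<^sup>+t. (\<integral>\<^sup>+x. indicator C (snd (x, t)) * k (x, t) \<partial>\<nu>) \<partial>G')"
      unfolding \<phi>_def using slice sets_eq_imp_space_eq[OF sets_eq] by (intro nn_integral_cong) (simp add: nn_integral_cmult)
    also have "\<dots> = (\<integral>\<^sup>+z. indicator C (snd z) * k z \<partial>(\<nu> \<Otimes>\<^sub>M G'))"
      by (rule p'.nn_integral_snd) (unfold m, measurable)
    also have "\<dots> = (\<integral>\<^sup>+z. (case z of (x, t) \<Rightarrow> ennreal (f x t)) * (indicator (space \<nu> \<times> C) z * indicator E z) \<partial>(\<nu> \<Otimes>\<^sub>M G'))"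
      by (rule nn_integral_cong) (auto simp: k_def space_pair_measure indicator_def)
    also have "\<dots> = (\<integral>\<^sup>+z. indicator (space \<nu> \<times> C) z * indicator E z \<partial>joint_law \<nu> f G')"
      unfolding joint_law_def using fe' E' SC by (intro nn_integral_density[symmetric]) simp_all
    also have "\<dots> = emeasure (density (joint_law \<nu> f G') (indicator (space \<nu> \<times> C))) E"
      using E' SC by (intro emeasure_density[symmetric]) (simp_all add: joint_law_def)
    finally show "emeasure (density (joint_law \<nu> f G) (\<lambda>z. g (snd z))) E
      = emeasure (density (joint_law \<nu> f G') (indicator (space \<nu> \<times> C))) E" .
  qed
qed

section \<open>The model at a fixed parameter\<close>

locale local_mixture =
  fixes \<nu> :: "'x measure" and f :: "'x \<Rightarrow> 't \<Rightarrow> real" and \<Theta> :: "'t measure"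
    and T :: "(real^'k) set" and G :: "real^'k \<Rightarrow> 't measure"
    and u :: "'x \<Rightarrow> 't \<Rightarrow> real" and \<tau> :: "real^'k" and s :: "'t \<Rightarrow> real^'k"
  assumes open_T: "open T" and model: "mixture_model \<nu> f \<Theta> T G"
    and u_meas: "(\<lambda>(x, t). u x t) \<in> borel_measurable (\<nu> \<Otimes>\<^sub>M \<Theta>)"
    and tau: "\<tau> \<in> T" and score: "score_at \<Theta> G \<tau> s"
    and u_square: "(\<integral>\<^sup>+ z. ennreal ((u (fst z) (snd z))\<^sup>2) \<partial>joint_law \<nu> f (G \<tau>)) < \<infinity>"
    and full_rank: "rank (fisher_info \<nu> (joint_law \<nu> f (G \<tau>)) s) = CARD('k)"
begin

abbreviation P :: "real^'k \<Rightarrow> ('x \<times> 't) measure" where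
  "P \<tau>' \<equiv> joint_law \<nu> f (G \<tau>')"

abbreviation Q :: "('x \<times> 't) measure" where
  "Q \<equiv> P \<tau>"

abbreviation path :: "real^'k \<Rightarrow> nat \<Rightarrow> real^'k" where
  "path a n \<equiv> \<tau> + (1 / sqrt (real n)) *\<^sub>R a"

lemma sigma_finite_\<nu>: "sigma_finite_measure \<nu>"
  using model by (simp add: mixture_model_def)

lemma prob_G: "\<tau>' \<in> T \<Longrightarrow> prob_space (G \<tau>')" and sets_G: "\<tau>' \<in> T \<Longrightarrow> sets (G \<tau>') = sets \<Theta>"
  using model by (auto simp: mixture_model_def)

lemma f_meas:
  assumes "\<tau>' \<in> T"
  shows "(\<lambda>(x, t). f x t) \<in> borel_measurable (\<nu> \<Otimes>\<^sub>M G \<tau>')"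
proof -
  have "sets (\<nu> \<Otimes>\<^sub>M G \<tau>') = sets (\<nu> \<Otimes>\<^sub>M \<Theta>)"
    using sets_G[OF assms] by (intro sets_pair_measure_cong) auto
  note eq = measurable_cong_sets[OF this refl]
  show ?thesis
    unfolding eq using model unfolding mixture_model_def by blast
qed

lemma f_density: "\<tau>' \<in> T \<Longrightarrow> t \<in> space (G \<tau>') \<Longrightarrow> (\<integral>\<^sup>+ x. ennreal (f x t) \<partial>\<nu>) = 1"
  using model sets_eq_imp_space_eq[OF sets_G[of \<tau>']] by (auto simp: mixture_model_def)

lemma sets_P: "\<tau>' \<in> T \<Longrightarrow> sets (P \<tau>') = sets (\<nu> \<Otimes>\<^sub>M \<Theta>)"
  using sets_G[of \<tau>'] by (auto simp: joint_law_def intro!: sets_pair_measure_cong)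

lemma prob_P: "\<tau>' \<in> T \<Longrightarrow> prob_space (P \<tau>')"
  by (rule prob_space_joint_law[OF sigma_finite_\<nu> prob_G f_meas f_density])

lemma distr_P_snd: "\<tau>' \<in> T \<Longrightarrow> distr (P \<tau>') (G \<tau>') snd = G \<tau>'"
  by (rule distr_joint_law_snd[OF sigma_finite_\<nu> prob_G f_meas f_density])

sublocale Q: prob_space Q
  by (rule prob_P[OF tau])

sublocale G\<tau>: prob_space "G \<tau>"
  by (rule prob_G[OF tau])

lemma fst_meas [measurable]: "fst \<in> measurable Q \<nu>"
  unfolding measurable_cong_sets[OF sets_P[OF tau] refl] by simp

lemma snd_meas [measurable]: "snd \<in> measurable Q (G \<tau>)"
  unfolding measurable_cong_sets[OF sets_P[OF tau] sets_G[OF tau]] by simp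

lemma s_meas [measurable]: "s \<in> borel_measurable (G \<tau>)"
  using score unfolding measurable_cong_sets[OF sets_G[OF tau] refl] by (simp add: score_at_def)

lemma inner_s_meas [measurable]: "(\<lambda>t. a \<bullet> s t) \<in> borel_measurable (G \<tau>)"
  by measurable

lemma integral_snd:
  fixes h :: "'t \<Rightarrow> real"
  assumes [measurable]: "h \<in> borel_measurable (G \<tau>)"
  shows "(\<integral>z. h (snd z) \<partial>Q) = (\<integral>t. h t \<partial>G \<tau>)"
    and "integrable Q (\<lambda>z. h (snd z)) \<longleftrightarrow> integrable (G \<tau>) h"
proof -
  have "(\<integral>t. h t \<partial>G \<tau>) = (\<integral>t. h t \<partial>distr Q (G \<tau>) snd)" by (simp add: distr_P_snd[OF tau])
  also have "\<dots> = (\<integral>z. h (snd z) \<partial>Q)" by (rule integral_distr) measurable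
  finally show "(\<integral>z. h (snd z) \<partial>Q) = (\<integral>t. h t \<partial>G \<tau>)" ..
  have "integrable (G \<tau>) h \<longleftrightarrow> integrable (distr Q (G \<tau>) snd) h" by (simp add: distr_P_snd[OF tau])
  also have "\<dots> \<longleftrightarrow> integrable Q (\<lambda>z. h (snd z))" by (rule integrable_distr_eq) measurable
  finally show "integrable Q (\<lambda>z. h (snd z)) \<longleftrightarrow> integrable (G \<tau>) h" ..
qed

section \<open>Local paths, the score, and change of measure along a path\<close>

lemma inverse_sqrt_tendsto: "(\<lambda>n. 1 / sqrt (real n)) \<longlonglongrightarrow> 0"
proof -
  have "(\<lambda>n. inverse (sqrt (real n))) \<longlonglongrightarrow> 0"
    by (intro tendsto_inverse_0_at_top filterlim_compose[OF sqrt_at_top] filterlim_real_sequentially)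
  then show ?thesis by (simp add: inverse_eq_divide)
qed

lemma scaled_tendsto: "(\<lambda>n. (1 / sqrt (real n)) *\<^sub>R (a :: real^'k)) \<longlonglongrightarrow> 0"
  using tendsto_scaleR[OF inverse_sqrt_tendsto tendsto_const[of a]] by simp

lemma eventually_path: "\<forall>\<^sub>F n in sequentially. path a n \<in> T"
proof -
  have "(\<lambda>n. path a n) \<longlonglongrightarrow> \<tau> + 0"
    by (intro tendsto_add tendsto_const scaled_tendsto)
  then show ?thesis
    using open_T tau by (intro topological_tendstoD) auto
qed

text \<open>The filter \<open>at 0\<close> leaves out 0 itself, hence a nonzero direction; results
  built on this treat a = 0 apart.\<close>

lemma filterlim_scaled: "a \<noteq> 0 \<Longrightarrow> filterlim (\<lambda>n. (1 / sqrt (real n)) *\<^sub>R (a :: real^'k)) (at 0) sequentially"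
  unfolding filterlim_at using scaled_tendsto[of a] eventually_gt_at_top[of "0::nat"]
  by (auto elim!: eventually_mono)

abbreviation g :: "real^'k \<Rightarrow> nat \<Rightarrow> 't \<Rightarrow> real" where
  "g a n \<equiv> ac_deriv G \<tau> ((1 / sqrt (real n)) *\<^sub>R a)"

lemma g_meas [measurable]: "ac_deriv G \<tau> \<Delta> \<in> borel_measurable (G \<tau>)"
  unfolding ac_deriv_def[abs_def] by measurable

lemma g_nonneg [simp]: "0 \<le> ac_deriv G \<tau> \<Delta> t"
  by (simp add: ac_deriv_def)

lemma g_density:
  assumes "path a n \<in> T"
  shows "\<exists>C\<in>sets (G \<tau>). density (G \<tau>) (\<lambda>t. ennreal (g a n t)) = density (G (path a n)) (indicator C)"
    and "integrable (G \<tau>) (g a n)"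
  using ac_deriv_density[of G \<tau> "(1 / sqrt (real n)) *\<^sub>R a"] prob_G[OF assms] sets_G[OF assms] sets_G[OF tau]
    G\<tau>.finite_measure_axioms prob_space.finite_measure by auto

text \<open>One sufficiently large n is enough: a . s/(2 sqrt n) is the difference of sqrt g - 1,
  square integrable since g is integrable, and the remainder that \<open>score_at\<close> makes
  square integrable.\<close>

lemma score_square_integrable: "integrable (G \<tau>) (\<lambda>t. (a \<bullet> s t)\<^sup>2)"
proof (cases "a = 0")
  case False
  have "\<forall>\<^sub>F \<Delta> in at 0. integrable (G \<tau>) (\<lambda>t. (sqrt (ac_deriv G \<tau> \<Delta> t) - 1 - (\<Delta> \<bullet> s t) / 2)\<^sup>2)"
    using score by (simp add: score_at_def)
  then have "\<forall>\<^sub>F n in sequentially. integrable (G \<tau>) (\<lambda>t. (sqrt (g a n t) - 1 - ((1 / sqrt (real n)) *\<^sub>R a \<bullet> s t) / 2)\<^sup>2)"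
    using filterlim_scaled[OF False] by (rule eventually_compose_filterlim)
  moreover note eventually_path[of a] eventually_gt_at_top[of "0::nat"]
  ultimately have "\<forall>\<^sub>F n in sequentially. integrable (G \<tau>) (\<lambda>t. (sqrt (g a n t) - 1 - ((1 / sqrt (real n)) *\<^sub>R a \<bullet> s t) / 2)\<^sup>2)
     \<and> path a n \<in> T \<and> 0 < n"
    by eventually_elim blast
  from eventually_happens'[OF sequentially_bot this] obtain n where int: "integrable (G \<tau>) (\<lambda>t. (sqrt (g a n t) - 1 - ((1 / sqrt (real n)) *\<^sub>R a \<bullet> s t) / 2)\<^sup>2)"
    and path: "path a n \<in> T" and n: "0 < n"
    by blast
  let ?r = "\<lambda>t. sqrt (g a n t) - 1 - ((1 / sqrt (real n)) *\<^sub>R a \<bullet> s t) / 2"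
  have root: "integrable (G \<tau>) (\<lambda>t. (sqrt (g a n t))\<^sup>2)"
    using g_density(2)[OF path] by simp
  have root1: "integrable (G \<tau>) (\<lambda>t. (sqrt (g a n t) - 1)\<^sup>2)"
    by (rule integrable_square_diff[OF _ _ root]) simp_all
  have "integrable (G \<tau>) (\<lambda>t. ((sqrt (g a n t) - 1) - ?r t)\<^sup>2)"
    by (rule integrable_square_diff[OF _ _ root1 int]) simp_all
  from integrable_square_cmult[OF this, of "2 * sqrt (real n)"]
  show ?thesis using n by simp
qed simp

lemma score_integrable: "integrable (G \<tau>) (\<lambda>t. a \<bullet> s t)"
  by (rule G\<tau>.square_integrable_imp_integrable) (simp_all add: score_square_integrable)

lemma small_o_path:
  assumes a: "a \<noteq> 0" and o: "F \<in> o[at 0](\<lambda>\<Delta>. (norm \<Delta>)\<^sup>2)"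
  shows "(\<lambda>n. real n * F ((1 / sqrt (real n)) *\<^sub>R (a :: real^'k))) \<longlonglongrightarrow> (0::real)"
proof -
  have "((\<lambda>\<Delta>. F \<Delta> / (norm \<Delta>)\<^sup>2) \<longlongrightarrow> 0) (at 0)"
    using o by (rule smalloD_tendsto)
  then have "(\<lambda>n. F ((1 / sqrt (real n)) *\<^sub>R a) / (norm ((1 / sqrt (real n)) *\<^sub>R a))\<^sup>2) \<longlonglongrightarrow> 0"
    using filterlim_scaled[OF a] by (rule filterlim_compose)
  from tendsto_mult[OF this tendsto_const[of "(norm a)\<^sup>2"]]
  have "(\<lambda>n. F ((1 / sqrt (real n)) *\<^sub>R a) / (norm ((1 / sqrt (real n)) *\<^sub>R a))\<^sup>2 * (norm a)\<^sup>2) \<longlonglongrightarrow> 0"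
    by simp
  moreover have "\<forall>\<^sub>F n in sequentially. F ((1 / sqrt (real n)) *\<^sub>R a) / (norm ((1 / sqrt (real n)) *\<^sub>R a))\<^sup>2 * (norm a)\<^sup>2
      = real n * F ((1 / sqrt (real n)) *\<^sub>R a)"
    using eventually_gt_at_top[of "0::nat"] by eventually_elim (use a in \<open>simp add: power_divide\<close>)
  ultimately show ?thesis by (simp add: tendsto_cong)
qed

lemma hellinger:
  assumes "a \<noteq> 0"
  shows "(\<lambda>n. real n * (\<integral>t. (sqrt (g a n t) - 1 - (a \<bullet> s t) / (2 * sqrt n))\<^sup>2 \<partial>G \<tau>)) \<longlonglongrightarrow> 0"
proof -
  have "(\<lambda>\<Delta>. \<integral>t. (sqrt (ac_deriv G \<tau> \<Delta> t) - 1 - (\<Delta> \<bullet> s t) / 2)\<^sup>2 \<partial>G \<tau>) \<in> o[at 0](\<lambda>\<Delta>. (norm \<Delta>)\<^sup>2)"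
    using score by (simp add: score_at_def)
  from small_o_path[OF assms this] show ?thesis
    by (simp add: mult.commute[of 2])
qed

lemma mass: "a \<noteq> 0 \<Longrightarrow> (\<lambda>n. real n * ((\<integral>t. g a n t \<partial>G \<tau>) - 1)) \<longlonglongrightarrow> 0"
  using score by (intro small_o_path) (auto simp: score_at_def)

text \<open>Write g = (1 + x + r)^2 with x = a . s/(2 sqrt n), integrate and multiply by sqrt n. The
  linear term is the mean itself; the mass defect and the quadratic term are O(1/sqrt n), and sqrt n
  times the integral of r is at most the root of n times that of r^2, which tends to 0.\<close>

lemma score_mean: "(\<integral>t. a \<bullet> s t \<partial>G \<tau>) = 0"
proof (cases "a = 0")
  case False
  define x where "x n t = (a \<bullet> s t) / (2 * sqrt (real n))" for n t
  define r where "r n t = sqrt (g a n t) - 1 - x n t" for n t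
  have [measurable]: "r n \<in> borel_measurable (G \<tau>)" "x n \<in> borel_measurable (G \<tau>)" for n
    unfolding r_def[abs_def] x_def[abs_def] by measurable
  have x2: "integrable (G \<tau>) (\<lambda>t. (x n t)\<^sup>2)" for n
    using score_square_integrable[of a] by (simp add: x_def power_divide)
  have x1: "integrable (G \<tau>) (x n)" for n
    using score_integrable[of a] by (simp add: x_def[abs_def])
  have hell: "(\<lambda>n. real n * (\<integral>t. (r n t)\<^sup>2 \<partial>G \<tau>)) \<longlonglongrightarrow> 0"
    using hellinger[OF False] by (simp add: r_def x_def)
  let ?m = "\<integral>t. a \<bullet> s t \<partial>G \<tau>" and ?v = "\<integral>t. (a \<bullet> s t)\<^sup>2 \<partial>G \<tau>"
  have bound: "\<forall>\<^sub>F n in sequentially. norm (?m)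
     \<le> \<bar>real n * ((\<integral>t. g a n t \<partial>G \<tau>) - 1)\<bar> * (1 / sqrt n) + 2 * sqrt (real n * (\<integral>t. (r n t)\<^sup>2 \<partial>G \<tau>))
       + (?v / 2 + 2 * (real n * (\<integral>t. (r n t)\<^sup>2 \<partial>G \<tau>))) * (1 / sqrt n)"
    using eventually_path[of a] eventually_gt_at_top[of "0::nat"]
  proof eventually_elim
    case (elim n)
    define q where "q = sqrt (real n)"
    have q: "q > 0" "real n = q * q" using elim by (auto simp: q_def)
    have g1: "integrable (G \<tau>) (g a n)" by (rule g_density) (rule elim)
    then have root: "integrable (G \<tau>) (\<lambda>t. (sqrt (g a n t))\<^sup>2)" by simp
    have r2: "integrable (G \<tau>) (\<lambda>t. (r n t)\<^sup>2)"
      unfolding r_def using root x2[of n] by (intro integrable_square_diff) auto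
    have r1: "integrable (G \<tau>) (r n)" by (rule G\<tau>.square_integrable_imp_integrable) (simp_all add: r2)
    have e2: "integrable (G \<tau>) (\<lambda>t. (x n t + r n t)\<^sup>2)"
      using x2 r2 by (intro integrable_square_add) auto
    define R where "R = (\<integral>t. (r n t)\<^sup>2 \<partial>G \<tau>)"
    have g_eq: "g a n t = 1 + (2 * x n t + 2 * r n t) + (x n t + r n t)\<^sup>2" for t
    proof -
      have "g a n t = (sqrt (g a n t))\<^sup>2" by simp
      also have "sqrt (g a n t) = 1 + (x n t + r n t)" by (simp add: r_def)
      finally show ?thesis by (simp add: power2_sum algebra_simps)
    qed
    have "(\<integral>t. g a n t \<partial>G \<tau>) = 1 + (2 * (\<integral>t. x n t \<partial>G \<tau>) + 2 * (\<integral>t. r n t \<partial>G \<tau>)) + (\<integral>t. (x n t + r n t)\<^sup>2 \<partial>G \<tau>)"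
      unfolding g_eq using x1 r1 e2 by (simp add: G\<tau>.prob_space)
    moreover have "(\<integral>t. x n t \<partial>G \<tau>) = ?m / (2 * q)" by (simp add: x_def q_def)
    ultimately have "?m / q = ((\<integral>t. g a n t \<partial>G \<tau>) - 1) - 2 * (\<integral>t. r n t \<partial>G \<tau>) - (\<integral>t. (x n t + r n t)\<^sup>2 \<partial>G \<tau>)"
      by simp
    then have m: "?m = q * ((\<integral>t. g a n t \<partial>G \<tau>) - 1) - 2 * (q * (\<integral>t. r n t \<partial>G \<tau>)) - q * (\<integral>t. (x n t + r n t)\<^sup>2 \<partial>G \<tau>)"
      using q(1) by (simp add: field_simps)
    have "\<bar>\<integral>t. r n t \<partial>G \<tau>\<bar> \<le> (\<integral>t. \<bar>r n t * 1\<bar> \<partial>G \<tau>)"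
      using integral_norm_bound[of "G \<tau>" "r n"] by simp
    also have "\<dots> \<le> sqrt R * sqrt (\<integral>t. 1\<^sup>2 \<partial>G \<tau>)"
      unfolding R_def using r2 by (intro integral_Cauchy_Schwarz) auto
    finally have "q * \<bar>\<integral>t. r n t \<partial>G \<tau>\<bar> \<le> q * sqrt R"
      using q(1) by (simp add: G\<tau>.prob_space)
    also have "\<dots> = sqrt (real n * R)" by (simp add: q_def real_sqrt_mult)
    finally have 1: "\<bar>q * (\<integral>t. r n t \<partial>G \<tau>)\<bar> \<le> sqrt (real n * R)"
      using q(1) by (simp add: abs_mult)
    have "(\<integral>t. (x n t + r n t)\<^sup>2 \<partial>G \<tau>) \<le> (\<integral>t. 2 * (x n t)\<^sup>2 + 2 * (r n t)\<^sup>2 \<partial>G \<tau>)"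
    proof (rule integral_mono[OF e2])
      show "integrable (G \<tau>) (\<lambda>t. 2 * (x n t)\<^sup>2 + 2 * (r n t)\<^sup>2)" using x2 r2 by simp
      have "(b + c)\<^sup>2 \<le> 2 * b\<^sup>2 + 2 * c\<^sup>2" for b c :: real
        using zero_le_power2[of "b - c"] by (simp add: power2_sum power2_diff)
      then show "(x n t + r n t)\<^sup>2 \<le> 2 * (x n t)\<^sup>2 + 2 * (r n t)\<^sup>2" for t .
    qed
    also have "\<dots> = 2 * (\<integral>t. (x n t)\<^sup>2 \<partial>G \<tau>) + 2 * R"
      using x2 r2 by (simp add: R_def)
    also have "(\<integral>t. (x n t)\<^sup>2 \<partial>G \<tau>) = ?v / (4 * (q * q))"
      by (simp add: x_def power_divide power_mult_distrib q_def)
    finally have "q * (\<integral>t. (x n t + r n t)\<^sup>2 \<partial>G \<tau>) \<le> q * (2 * (?v / (4 * (q * q))) + 2 * R)"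
      using q(1) by (intro mult_left_mono) auto
    also have "\<dots> = (?v / 2 + 2 * (real n * R)) * (1 / q)"
      using q by (simp add: field_simps)
    finally have 2: "\<bar>q * (\<integral>t. (x n t + r n t)\<^sup>2 \<partial>G \<tau>)\<bar> \<le> (?v / 2 + 2 * (real n * R)) * (1 / q)"
      using q(1) by (simp add: abs_mult)
    have 3: "\<bar>q * ((\<integral>t. g a n t \<partial>G \<tau>) - 1)\<bar> = \<bar>real n * ((\<integral>t. g a n t \<partial>G \<tau>) - 1)\<bar> * (1 / q)"
      using q by (simp add: abs_mult)
    have gen: "w = A - 2 * B - C \<Longrightarrow> \<bar>B\<bar> \<le> B' \<Longrightarrow> \<bar>C\<bar> \<le> C' \<Longrightarrow> \<bar>A\<bar> = A' \<Longrightarrow> \<bar>w\<bar> \<le> A' + 2 * B' + C'"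
      for w A B C A' B' C' :: real by linarith
    show ?case
      using gen[OF m 1 2 3] unfolding R_def q_def real_norm_def .
  qed
  have "(\<lambda>n. \<bar>real n * ((\<integral>t. g a n t \<partial>G \<tau>) - 1)\<bar> * (1 / sqrt n) + 2 * sqrt (real n * (\<integral>t. (r n t)\<^sup>2 \<partial>G \<tau>))
       + (?v / 2 + 2 * (real n * (\<integral>t. (r n t)\<^sup>2 \<partial>G \<tau>))) * (1 / sqrt n)) \<longlonglongrightarrow> \<bar>0\<bar> * 0 + 2 * sqrt 0 + (?v / 2 + 2 * 0) * 0"
    by (intro tendsto_intros tendsto_rabs mass[OF False] hell inverse_sqrt_tendsto)
  then have "(\<lambda>n. \<bar>real n * ((\<integral>t. g a n t \<partial>G \<tau>) - 1)\<bar> * (1 / sqrt n) + 2 * sqrt (real n * (\<integral>t. (r n t)\<^sup>2 \<partial>G \<tau>))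
       + (?v / 2 + 2 * (real n * (\<integral>t. (r n t)\<^sup>2 \<partial>G \<tau>))) * (1 / sqrt n)) \<longlonglongrightarrow> 0"
    by simp
  from Lim_null_comparison[OF bound this] have "(\<lambda>n::nat. ?m) \<longlonglongrightarrow> 0" .
  then show ?thesis by (simp add: LIMSEQ_const_iff)
qed simp

text \<open>The ratio of the pair laws depends on \<theta> only, so the expansions of the mixing
  distributions carry over to the pairs unchanged.\<close>

theorem alternatives:
  fixes F :: "nat \<Rightarrow> (nat \<Rightarrow> 'x \<times> 't) \<Rightarrow> complex"
  assumes F: "\<And>n. F n \<in> borel_measurable (\<Pi>\<^sub>M i\<in>{..<n}. Q)" "\<And>n \<omega>. norm (F n \<omega>) \<le> 1"
  shows "(\<lambda>n. (\<integral>\<omega>. F n \<omega> \<partial>(\<Pi>\<^sub>M i\<in>{..<n}. P (path a n)))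
      - (\<integral>\<omega>. F n \<omega> * of_real (\<Prod>j<n. 1 + (a \<bullet> s (snd (\<omega> j))) / sqrt n) \<partial>(\<Pi>\<^sub>M i\<in>{..<n}. Q))) \<longlonglongrightarrow> 0"
proof (cases "a = 0")
  case False
  obtain N where N: "\<And>n. n \<ge> N \<Longrightarrow> path a n \<in> T"
    using eventually_path[of a] unfolding eventually_sequentially by blast
  \<comment> \<open>For the finitely many n whose path point may lie outside \<open>T\<close> the
    law is replaced by \<open>Q\<close> with density 1, because the general limit theorem wants its
    assumptions at every n.\<close>
  define M' where "M' n = (if n \<ge> N then P (path a n) else Q)" for n
  define g' where "g' n z = (if n \<ge> N then g a n (snd z) else 1)" for n and z :: "'x \<times> 't"
  have "\<exists>C. C \<in> sets Q \<and> density Q (\<lambda>z. ennreal (g' n z)) = density (M' n) (indicator C)" for n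
  proof (cases "n \<ge> N")
    case True
    obtain C where C: "C \<in> sets (G \<tau>)" "density (G \<tau>) (\<lambda>t. ennreal (g a n t)) = density (G (path a n)) (indicator C)"
      using g_density(1)[OF N[OF True]] by blast
    have "density Q (\<lambda>z. ennreal (g a n (snd z))) = density (P (path a n)) (indicator (space \<nu> \<times> C))"
      using sets_G[OF N[OF True]] sets_G[OF tau] C
      by (intro joint_law_density_snd sigma_finite_\<nu> prob_G tau N True f_meas) auto
    moreover have "space \<nu> \<times> C \<in> sets Q"
      using C(1) by (simp add: joint_law_def)
    ultimately show ?thesis using True by (auto simp: g'_def M'_def)
  next
    case False
    have "density Q (\<lambda>z. 1) = density Q (indicator (space Q))"
      by (rule density_cong) auto
    then show ?thesis using False by (intro exI[of _ "space Q"]) (simp add: g'_def M'_def)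
  qed
  then obtain C where C: "\<And>n. C n \<in> sets Q" "\<And>n. density Q (\<lambda>z. ennreal (g' n z)) = density (M' n) (indicator (C n))"
    by metis
  have ev: "\<forall>\<^sub>F n in sequentially. N \<le> n" by (rule eventually_ge_at_top)
  have "(\<lambda>n. (\<integral>\<omega>. F n \<omega> \<partial>(\<Pi>\<^sub>M i\<in>{..<n}. M' n))
      - (\<integral>\<omega>. F n \<omega> * of_real (\<Prod>j<n. 1 + (a \<bullet> s (snd (\<omega> j))) / sqrt n) \<partial>(\<Pi>\<^sub>M i\<in>{..<n}. Q))) \<longlonglongrightarrow> 0"
  proof (rule Q.local_alternative_limit[OF _ _ C _ _ _ _ _ _ _ _ F])
    show "prob_space (M' n)" for n
      using prob_P[OF N] Q.prob_space_axioms by (simp add: M'_def)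
    show "sets (M' n) = sets Q" for n
      using sets_P[OF N] sets_P[OF tau] by (simp add: M'_def)
    show meas: "g' n \<in> borel_measurable Q" for n
      unfolding g'_def[abs_def] by (cases "n \<ge> N") simp_all
    show "0 \<le> g' n x" for n x by (simp add: g'_def)
    show "integrable Q (g' n)" for n
      unfolding g'_def[abs_def] using g_density(2)[OF N, of n] integral_snd(2)[of "g a n"]
      by (cases "n \<ge> N") auto
    show "(\<lambda>z. a \<bullet> s (snd z)) \<in> borel_measurable Q" by measurable
    show "integrable Q (\<lambda>z. (a \<bullet> s (snd z))\<^sup>2)"
      using integral_snd(2)[of "\<lambda>t. (a \<bullet> s t)\<^sup>2"] score_square_integrable by simp
    show "(\<integral>z. a \<bullet> s (snd z) \<partial>Q) = 0"
      using integral_snd(1)[of "\<lambda>t. a \<bullet> s t"] score_mean by simp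
    have "\<forall>\<^sub>F n in sequentially. real n * ((\<integral>t. g a n t \<partial>G \<tau>) - 1) = real n * ((\<integral>z. g' n z \<partial>Q) - 1)"
      using ev by eventually_elim (simp add: g'_def integral_snd)
    with mass[OF False] show "(\<lambda>n. real n * ((\<integral>z. g' n z \<partial>Q) - 1)) \<longlonglongrightarrow> 0"
      by (rule Lim_transform_eventually)
    have "\<forall>\<^sub>F n in sequentially. real n * (\<integral>t. (sqrt (g a n t) - 1 - (a \<bullet> s t) / (2 * sqrt n))\<^sup>2 \<partial>G \<tau>)
      = real n * (\<integral>z. (sqrt (g' n z) - 1 - (a \<bullet> s (snd z)) / (2 * sqrt n))\<^sup>2 \<partial>Q)"
      using ev
    proof eventually_elim
      case (elim n)
      then show ?case
        using integral_snd(1)[of "\<lambda>t. (sqrt (g a n t) - 1 - (a \<bullet> s t) / (2 * sqrt n))\<^sup>2"] by (simp add: g'_def)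
    qed
    with hellinger[OF False]
    show "(\<lambda>n. real n * (\<integral>z. (sqrt (g' n z) - 1 - (a \<bullet> s (snd z)) / (2 * sqrt n))\<^sup>2 \<partial>Q)) \<longlonglongrightarrow> 0"
      by (rule Lim_transform_eventually)
  qed
  then show ?thesis
    by (rule Lim_transform_eventually) (use ev in \<open>eventually_elim, simp add: M'_def\<close>)
qed simp

end

lemma integrable_square_sum:
  fixes F :: "'i \<Rightarrow> 'a \<Rightarrow> real"
  assumes "finite I" "\<And>i. i \<in> I \<Longrightarrow> F i \<in> borel_measurable M" "\<And>i. i \<in> I \<Longrightarrow> integrable M (\<lambda>x. (F i x)\<^sup>2)"
  shows "integrable M (\<lambda>x. (\<Sum>i\<in>I. F i x)\<^sup>2)"
  using assms
proof (induction I)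
  case (insert i I)
  then have "integrable M (\<lambda>x. (F i x + (\<Sum>i\<in>I. F i x))\<^sup>2)"
    by (intro integrable_square_add) auto
  then show ?case using insert by simp
qed simp

section \<open>Conditional moments and the efficient influence function\<close>

context local_mixture
begin

lemma
  shows cond_exp_X_meas [measurable]: "cond_exp_X \<nu> Q Z \<in> borel_measurable \<nu>"
    and cond_exp_X_AE: "AE z in Q. real_cond_exp Q (vimage_algebra (space Q) fst \<nu>) Z z = cond_exp_X \<nu> Q Z (fst z)"
  using someI_ex[OF Q.cond_exp_factor[OF fst_meas, of Z]] unfolding cond_exp_X_def by blast+

lemma cond_exp_X_fst_meas [measurable]: "(\<lambda>z. cond_exp_X \<nu> Q Z (fst z)) \<in> borel_measurable Q"
  by (rule measurable_compose[OF fst_meas cond_exp_X_meas])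

lemma cond_exp_X_square:
  assumes [measurable]: "Z \<in> borel_measurable Q" and Z2: "integrable Q (\<lambda>z. (Z z)\<^sup>2)"
  shows "integrable Q (\<lambda>z. (cond_exp_X \<nu> Q Z (fst z))\<^sup>2)"
  by (rule Q.cond_exp_version_square(1)[OF fst_meas _ Z2 cond_exp_X_meas cond_exp_X_AE]) simp

lemma cond_exp_X_integral:
  assumes "integrable Q Z"
  shows "integrable Q (\<lambda>z. cond_exp_X \<nu> Q Z (fst z))" "(\<integral>z. cond_exp_X \<nu> Q Z (fst z) \<partial>Q) = (\<integral>z. Z z \<partial>Q)"
  by (rule Q.cond_exp_version_integral[OF fst_meas assms cond_exp_X_meas cond_exp_X_AE])+

lemma cond_exp_X_test:
  fixes F :: "'x \<Rightarrow> complex"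
  assumes "integrable Q Z" "F \<in> borel_measurable \<nu>" "\<And>x. norm (F x) \<le> 1"
  shows "(\<integral>z. F (fst z) * of_real (cond_exp_X \<nu> Q Z (fst z)) \<partial>Q) = (\<integral>z. F (fst z) * of_real (Z z) \<partial>Q)"
  by (rule Q.cond_exp_version_integral(3)[OF fst_meas assms(1) cond_exp_X_meas cond_exp_X_AE assms(2,3), symmetric])

text \<open>Conditioning is an orthogonal projection in L2: against a function of X,
  \<open>W\<close> and its conditional expectation are indistinguishable.\<close>

lemma cond_exp_X_project:
  assumes Z[measurable]: "Z \<in> borel_measurable Q" and Z2: "integrable Q (\<lambda>z. (Z z)\<^sup>2)"
    and W[measurable]: "W \<in> borel_measurable Q" and W2: "integrable Q (\<lambda>z. (W z)\<^sup>2)"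
  shows "(\<integral>z. cond_exp_X \<nu> Q Z (fst z) * W z \<partial>Q) = (\<integral>z. cond_exp_X \<nu> Q Z (fst z) * cond_exp_X \<nu> Q W (fst z) \<partial>Q)"
proof -
  have "integrable Q W" by (rule Q.square_integrable_imp_integrable) (use W2 in simp_all)
  moreover have "integrable Q (\<lambda>z. cond_exp_X \<nu> Q Z (fst z) * W z)"
    using cond_exp_X_square[OF Z Z2] W2 by (intro integrable_mult_L2) auto
  ultimately show ?thesis
    using Q.cond_exp_version_integral(4)[OF fst_meas _ cond_exp_X_meas cond_exp_X_AE cond_exp_X_meas] by blast
qed

text \<open>Each cross term equals the product term by projection, so one copy survives with a minus
  sign. This identifies the two expressions for \<gamma>.\<close>

lemma cond_cov_X_integral:
  assumes Z[measurable]: "Z \<in> borel_measurable Q" and Z2: "integrable Q (\<lambda>z. (Z z)\<^sup>2)"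
    and W[measurable]: "W \<in> borel_measurable Q" and W2: "integrable Q (\<lambda>z. (W z)\<^sup>2)"
  shows "(\<integral>z. cond_cov_X \<nu> Q Z W (fst z) \<partial>Q)
    = (\<integral>z. Z z * W z - cond_exp_X \<nu> Q Z (fst z) * cond_exp_X \<nu> Q W (fst z) \<partial>Q)"
proof -
  let ?z = "\<lambda>z. cond_exp_X \<nu> Q Z (fst z)" and ?w = "\<lambda>z. cond_exp_X \<nu> Q W (fst z)"
  note z2 = cond_exp_X_square[OF Z Z2] and w2 = cond_exp_X_square[OF W W2]
  have i: "integrable Q (\<lambda>z. Z z * W z)" "integrable Q (\<lambda>z. ?z z * W z)" "integrable Q (\<lambda>z. ?w z * Z z)" "integrable Q (\<lambda>z. ?z z * ?w z)"
    using Z2 W2 z2 w2 by (auto intro!: integrable_mult_L2)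
  have "integrable Q (\<lambda>z. (Z z - ?z z) * (W z - ?w z))"
    using Z2 W2 z2 w2 by (intro integrable_mult_L2 integrable_square_diff) auto
  then have "(\<integral>z. cond_cov_X \<nu> Q Z W (fst z) \<partial>Q) = (\<integral>z. (Z z - ?z z) * (W z - ?w z) \<partial>Q)"
    unfolding cond_cov_X_def by (rule cond_exp_X_integral)
  also have "\<dots> = (\<integral>z. Z z * W z - ?z z * W z - ?w z * Z z + ?z z * ?w z \<partial>Q)"
    by (simp add: algebra_simps)
  also have "\<dots> = (\<integral>z. Z z * W z \<partial>Q) - (\<integral>z. ?z z * W z \<partial>Q) - (\<integral>z. ?w z * Z z \<partial>Q) + (\<integral>z. ?z z * ?w z \<partial>Q)"
    using i by simp
  also have "(\<integral>z. ?z z * W z \<partial>Q) = (\<integral>z. ?z z * ?w z \<partial>Q)"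
    by (rule cond_exp_X_project[OF Z Z2 W W2])
  also have "(\<integral>z. ?w z * Z z \<partial>Q) = (\<integral>z. ?w z * ?z z \<partial>Q)"
    by (rule cond_exp_X_project[OF W W2 Z Z2])
  finally show ?thesis
    using i by (simp add: mult.commute)
qed

abbreviation U :: "'x \<times> 't \<Rightarrow> real" where
  "U z \<equiv> u (fst z) (snd z)"

abbreviation \<rho> :: "'x \<Rightarrow> real^'k" where
  "\<rho> \<equiv> score_X \<nu> Q s"

abbreviation \<gamma> :: "real^'k" where
  "\<gamma> \<equiv> gamma_vec \<nu> Q u s"

abbreviation \<phi> :: "'x \<Rightarrow> real" where
  "\<phi> \<equiv> phi_star \<nu> Q u s"

text \<open>The least favourable direction \<open>I\<^sup>-\<^sup>1 \<gamma>\<close>.\<close>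

definition h :: "real^'k" where
  "h = matrix_inv (fisher_info \<nu> Q s) *v \<gamma>"

text \<open>The mean \<mu> cancels between \<mu> and \<phi>, so it does not show here.\<close>

definition \<psi> :: "'x \<times> 't \<Rightarrow> real" where
  "\<psi> z = u_bar \<nu> Q u (fst z) - U z + \<rho> (fst z) \<bullet> h"

lemma U_meas [measurable]: "U \<in> borel_measurable Q"
  unfolding measurable_cong_sets[OF sets_P[OF tau] refl] using u_meas by (simp add: split_def)

lemma U_square: "integrable Q (\<lambda>z. (U z)\<^sup>2)"
  using u_square by (intro integrableI_nonneg) auto

lemma U_integrable: "integrable Q U"
  by (rule Q.square_integrable_imp_integrable) (simp_all add: U_square)

lemma inner_s_Q [measurable]: "(\<lambda>z. a \<bullet> s (snd z)) \<in> borel_measurable Q"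
  by (rule measurable_compose[OF snd_meas inner_s_meas])

lemma inner_s_Q_L2: "integrable Q (\<lambda>z. (a \<bullet> s (snd z))\<^sup>2)"
  using integral_snd(2)[of "\<lambda>t. (a \<bullet> s t)\<^sup>2"] score_square_integrable by simp

lemma inner_s_Q_mean: "(\<integral>z. a \<bullet> s (snd z) \<partial>Q) = 0"
  using integral_snd(1)[of "\<lambda>t. a \<bullet> s t"] score_mean by simp

lemma nth_s: "s t $ i = axis i 1 \<bullet> s t"
  by (simp add: inner_axis')

lemma nth_s_Q [measurable]: "(\<lambda>z. s (snd z) $ i) \<in> borel_measurable Q"
  and nth_s_Q_L2: "integrable Q (\<lambda>z. (s (snd z) $ i)\<^sup>2)"
  and nth_s_Q_mean: "(\<integral>z. s (snd z) $ i \<partial>Q) = 0"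
  unfolding nth_s using inner_s_Q_L2 inner_s_Q_mean by simp_all

lemma nth_s_Q_integrable: "integrable Q (\<lambda>z. s (snd z) $ i)"
  by (rule Q.square_integrable_imp_integrable) (simp_all add: nth_s_Q_L2)

lemma nth_\<rho>: "\<rho> x $ i = cond_exp_X \<nu> Q (\<lambda>z. s (snd z) $ i) x"
  by (simp add: score_X_def)

lemma nth_\<rho>_meas [measurable]: "(\<lambda>x. \<rho> x $ i) \<in> borel_measurable \<nu>"
  unfolding nth_\<rho> by measurable

lemma nth_\<rho>_fst [measurable]: "(\<lambda>z. \<rho> (fst z) $ i) \<in> borel_measurable Q"
  unfolding nth_\<rho> by measurable

lemma nth_\<rho>_L2: "integrable Q (\<lambda>z. (\<rho> (fst z) $ i)\<^sup>2)"
  unfolding nth_\<rho> by (rule cond_exp_X_square) (simp_all add: nth_s_Q_L2)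

lemma nth_\<rho>_integrable: "integrable Q (\<lambda>z. \<rho> (fst z) $ i)"
  and nth_\<rho>_mean: "(\<integral>z. \<rho> (fst z) $ i \<partial>Q) = 0"
  unfolding nth_\<rho> using cond_exp_X_integral[OF nth_s_Q_integrable] nth_s_Q_mean by simp_all

lemma inner_\<rho>: "\<rho> x \<bullet> a = (\<Sum>i\<in>UNIV. a $ i * \<rho> x $ i)"
  by (simp add: inner_vec_def mult.commute)

lemma inner_\<rho>_meas [measurable]: "(\<lambda>x. \<rho> x \<bullet> a) \<in> borel_measurable \<nu>"
  unfolding inner_\<rho> by measurable

lemma inner_\<rho>_fst [measurable]: "(\<lambda>z. \<rho> (fst z) \<bullet> a) \<in> borel_measurable Q"
  by (rule measurable_compose[OF fst_meas inner_\<rho>_meas])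

lemma inner_\<rho>_L2: "integrable Q (\<lambda>z. (\<rho> (fst z) \<bullet> a)\<^sup>2)"
  unfolding inner_\<rho> by (intro integrable_square_sum integrable_square_cmult nth_\<rho>_L2) auto

lemma u_bar_meas [measurable]: "u_bar \<nu> Q u \<in> borel_measurable \<nu>"
  unfolding u_bar_def by measurable

lemma u_bar_fst [measurable]: "(\<lambda>z. u_bar \<nu> Q u (fst z)) \<in> borel_measurable Q"
  by (rule measurable_compose[OF fst_meas u_bar_meas])

lemma u_bar_L2: "integrable Q (\<lambda>z. (u_bar \<nu> Q u (fst z))\<^sup>2)"
  unfolding u_bar_def by (rule cond_exp_X_square) (simp_all add: U_square)

lemma u_bar_integrable: "integrable Q (\<lambda>z. u_bar \<nu> Q u (fst z))"
  and u_bar_mean: "(\<integral>z. u_bar \<nu> Q u (fst z) \<partial>Q) = (\<integral>z. U z \<partial>Q)"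
  unfolding u_bar_def using cond_exp_X_integral[OF U_integrable] by simp_all

lemma gamma_nth: "\<gamma> $ i = (\<integral>z. U z * s (snd z) $ i - u_bar \<nu> Q u (fst z) * \<rho> (fst z) $ i \<partial>Q)"
  unfolding gamma_vec_def u_bar_def nth_\<rho>
  using cond_cov_X_integral[OF U_meas U_square nth_s_Q nth_s_Q_L2, of i] by simp

text \<open>As \<rho> has mean 0 the covariance is a product moment, and projection trades one
  \<rho> for the score \<open>s\<close>. In this form the information meets E \<psi> s
  directly.\<close>

lemma fisher_nth: "fisher_info \<nu> Q s $ i $ j = (\<integral>z. \<rho> (fst z) $ j * s (snd z) $ i \<partial>Q)"
proof -
  have "fisher_info \<nu> Q s $ i $ j = (\<integral>z. \<rho> (fst z) $ i * \<rho> (fst z) $ j \<partial>Q)"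
    by (simp add: fisher_info_def covariance_def nth_\<rho>_mean)
  also have "\<dots> = (\<integral>z. \<rho> (fst z) $ j * s (snd z) $ i \<partial>Q)"
    unfolding nth_\<rho>
    using cond_exp_X_project[OF nth_s_Q nth_s_Q_L2 nth_s_Q nth_s_Q_L2, of j i] by (simp add: mult.commute)
  finally show ?thesis .
qed

text \<open>Full rank turns the chosen \<open>matrix_inv\<close> into a true inverse.\<close>

lemma fisher_h: "fisher_info \<nu> Q s *v h = \<gamma>"
proof -
  have "inj ((*v) (fisher_info \<nu> Q s))"
    using full_rank full_rank_injective by blast
  then have "invertible (fisher_info \<nu> Q s)"
    using matrix_left_invertible_injective invertible_left_inverse by blast
  then have "fisher_info \<nu> Q s ** matrix_inv (fisher_info \<nu> Q s) = mat 1"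
    unfolding invertible_def matrix_inv_def by (rule someI2_ex) blast
  then show ?thesis
    unfolding h_def matrix_vector_mul_assoc by simp
qed

lemma \<psi>_meas [measurable]: "\<psi> \<in> borel_measurable Q"
  unfolding \<psi>_def[abs_def] by measurable

lemma \<psi>_L2: "integrable Q (\<lambda>z. (\<psi> z)\<^sup>2)"
  unfolding \<psi>_def using u_bar_L2 U_square inner_\<rho>_L2
  by (intro integrable_square_add integrable_square_diff) auto

lemma \<psi>_mean: "(\<integral>z. \<psi> z \<partial>Q) = 0"
proof -
  have i: "integrable Q (\<lambda>z. \<rho> (fst z) \<bullet> h)" "(\<integral>z. \<rho> (fst z) \<bullet> h \<partial>Q) = 0"
    unfolding inner_\<rho> using nth_\<rho>_integrable nth_\<rho>_mean by simp_all
  show ?thesis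
    unfolding \<psi>_def using u_bar_integrable U_integrable i u_bar_mean by simp
qed

text \<open>Coordinatewise, the part of \<psi> from u contributes -\<gamma> and the part \<rho> . h
  contributes I h, which is \<gamma>.\<close>

lemma \<psi>_orth: "(\<integral>z. \<psi> z * (a \<bullet> s (snd z)) \<partial>Q) = 0"
proof -
  have p: "integrable Q (\<lambda>z. \<psi> z * s (snd z) $ j)" for j
    using \<psi>_L2 nth_s_Q_L2 by (intro integrable_mult_L2) auto
  have "(\<integral>z. \<psi> z * s (snd z) $ j \<partial>Q) = 0" for j
  proof -
    let ?b = "\<lambda>z. u_bar \<nu> Q u (fst z)"
    have i1: "integrable Q (\<lambda>z. ?b z * s (snd z) $ j)" "integrable Q (\<lambda>z. U z * s (snd z) $ j)"
      "integrable Q (\<lambda>z. ?b z * \<rho> (fst z) $ j)" "integrable Q (\<lambda>z. \<rho> (fst z) $ i * s (snd z) $ j)" for i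
      using u_bar_L2 nth_s_Q_L2 U_square nth_\<rho>_L2 by (auto intro!: integrable_mult_L2)
    have "(\<integral>z. \<psi> z * s (snd z) $ j \<partial>Q)
      = (\<integral>z. ?b z * s (snd z) $ j - U z * s (snd z) $ j + (\<Sum>i\<in>UNIV. h $ i * (\<rho> (fst z) $ i * s (snd z) $ j)) \<partial>Q)"
      unfolding \<psi>_def inner_\<rho> by (simp add: algebra_simps sum_distrib_left)
    also have "\<dots> = (\<integral>z. ?b z * s (snd z) $ j \<partial>Q) - (\<integral>z. U z * s (snd z) $ j \<partial>Q)
        + (\<Sum>i\<in>UNIV. h $ i * (\<integral>z. \<rho> (fst z) $ i * s (snd z) $ j \<partial>Q))"
      using i1 by simp
    also have "(\<integral>z. ?b z * s (snd z) $ j \<partial>Q) = (\<integral>z. ?b z * \<rho> (fst z) $ j \<partial>Q)"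
      unfolding u_bar_def nth_\<rho> by (rule cond_exp_X_project[OF U_meas U_square nth_s_Q nth_s_Q_L2])
    also have "(\<Sum>i\<in>UNIV. h $ i * (\<integral>z. \<rho> (fst z) $ i * s (snd z) $ j \<partial>Q)) = (fisher_info \<nu> Q s *v h) $ j"
      by (simp add: matrix_vector_mult_def fisher_nth mult.commute)
    also have "\<dots> = (\<integral>z. U z * s (snd z) $ j \<partial>Q) - (\<integral>z. ?b z * \<rho> (fst z) $ j \<partial>Q)"
      unfolding fisher_h gamma_nth using i1 by simp
    finally show ?thesis by simp
  qed
  moreover have "(\<integral>z. \<psi> z * (a \<bullet> s (snd z)) \<partial>Q) = (\<Sum>j\<in>UNIV. a $ j * (\<integral>z. \<psi> z * s (snd z) $ j \<partial>Q))"
  proof -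
    have "\<psi> z * (a \<bullet> s (snd z)) = (\<Sum>j\<in>UNIV. a $ j * (\<psi> z * s (snd z) $ j))" for z
      by (simp add: inner_vec_def sum_distrib_left mult_ac)
    then show ?thesis using p by simp
  qed
  ultimately show ?thesis by simp
qed

text \<open>The part \<open>u_bar\<close> minus u has conditional mean 0 given X, and \<rho> . h is
  the conditional mean of h . s.\<close>

lemma \<psi>_cond:
  fixes F :: "'x \<Rightarrow> complex"
  assumes F[measurable]: "F \<in> borel_measurable \<nu>" and F1: "\<And>x. norm (F x) \<le> 1"
  shows "(\<integral>z. F (fst z) * of_real (\<psi> z) \<partial>Q) = (\<integral>z. F (fst z) * of_real (h \<bullet> s (snd z)) \<partial>Q)"
proof -
  have Fm[measurable]: "(\<lambda>z. F (fst z)) \<in> borel_measurable Q"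
    by (rule measurable_compose[OF fst_meas F])
  have bd: "integrable Q (\<lambda>z. F (fst z) * of_real (v z))" if "integrable Q v" for v :: "'x \<times> 't \<Rightarrow> real"
    using that F1 by (intro Bochner_Integration.integrable_bound[OF that]) (auto simp: norm_mult intro!: mult_left_le_one_le)
  let ?b = "\<lambda>z. u_bar \<nu> Q u (fst z)"
  have "(\<integral>z. F (fst z) * of_real (\<psi> z) \<partial>Q)
    = (\<integral>z. F (fst z) * of_real (?b z) - F (fst z) * of_real (U z)
        + (\<Sum>i\<in>UNIV. of_real (h $ i) * (F (fst z) * of_real (\<rho> (fst z) $ i))) \<partial>Q)"
    unfolding \<psi>_def inner_\<rho> by (simp add: algebra_simps sum_distrib_left)
  also have "\<dots> = (\<integral>z. F (fst z) * of_real (?b z) \<partial>Q) - (\<integral>z. F (fst z) * of_real (U z) \<partial>Q)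
        + (\<Sum>i\<in>UNIV. of_real (h $ i) * (\<integral>z. F (fst z) * of_real (\<rho> (fst z) $ i) \<partial>Q))"
    using bd[OF u_bar_integrable] bd[OF U_integrable] bd[OF nth_\<rho>_integrable] by simp
  also have "(\<integral>z. F (fst z) * of_real (?b z) \<partial>Q) = (\<integral>z. F (fst z) * of_real (U z) \<partial>Q)"
    unfolding u_bar_def by (rule cond_exp_X_test[OF U_integrable F F1])
  also have "(\<lambda>i. \<integral>z. F (fst z) * of_real (\<rho> (fst z) $ i) \<partial>Q) = (\<lambda>i. \<integral>z. F (fst z) * of_real (s (snd z) $ i) \<partial>Q)"
    unfolding nth_\<rho> using cond_exp_X_test[OF nth_s_Q_integrable F F1] by auto
  also have "(\<integral>z. F (fst z) * of_real (U z) \<partial>Q) - (\<integral>z. F (fst z) * of_real (U z) \<partial>Q)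
      + (\<Sum>i\<in>UNIV. of_real (h $ i) * (\<integral>z. F (fst z) * of_real (s (snd z) $ i) \<partial>Q))
    = (\<integral>z. (\<Sum>i\<in>UNIV. of_real (h $ i) * (F (fst z) * of_real (s (snd z) $ i))) \<partial>Q)"
    using bd[OF nth_s_Q_integrable] by simp
  also have "\<dots> = (\<integral>z. F (fst z) * of_real (h \<bullet> s (snd z)) \<partial>Q)"
    by (simp add: inner_vec_def sum_distrib_left mult_ac)
  finally show ?thesis .
qed

end

section \<open>Regular and efficient estimators\<close>

lemma measurable_coordinate:
  assumes "j \<in> I" "g \<in> measurable M L"
  shows "(\<lambda>\<omega>. g (\<omega> j)) \<in> measurable (\<Pi>\<^sub>M i\<in>I. M) L"
  by (rule measurable_compose[OF measurable_component_singleton[of j I "\<lambda>_. M"] assms(2)]) (rule assms(1))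

context local_mixture
begin

definition remainder :: "(nat \<Rightarrow> (nat \<Rightarrow> 'x) \<Rightarrow> real) \<Rightarrow> nat \<Rightarrow> (nat \<Rightarrow> 'x) \<Rightarrow> real" where
  "remainder S n x = (S n x - real n * mean_u Q u - (\<Sum>j<n. \<phi> (x j))) / sqrt (real n)"

definition error :: "(nat \<Rightarrow> (nat \<Rightarrow> 'x) \<Rightarrow> real) \<Rightarrow> nat \<Rightarrow> (nat \<Rightarrow> 'x \<times> 't) \<Rightarrow> real" where
  "error S n \<omega> = (S n (observed n \<omega>) - util_sum u n \<omega>) / sqrt (real n)"

abbreviation \<sigma>2 :: real where
  "\<sigma>2 \<equiv> \<integral>z. (\<psi> z)\<^sup>2 \<partial>Q"

abbreviation Qn :: "nat \<Rightarrow> (nat \<Rightarrow> 'x \<times> 't) measure" where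
  "Qn n \<equiv> \<Pi>\<^sub>M i\<in>{..<n}. Q"

lemma prob_Qn: "prob_space (Qn n)"
  by (rule Q.prob_space_PiM_const)

lemma \<phi>_meas [measurable]: "\<phi> \<in> borel_measurable \<nu>"
proof -
  have "\<phi> = (\<lambda>x. u_bar \<nu> Q u x - mean_u Q u + \<rho> x \<bullet> h)"
    by (simp add: fun_eq_iff phi_star_def h_def)
  then show ?thesis by simp
qed

lemma remainder_meas:
  assumes "estimator \<nu> S"
  shows "remainder S n \<in> borel_measurable (\<Pi>\<^sub>M i\<in>{..<n}. \<nu>)"
proof -
  have [measurable]: "S n \<in> borel_measurable (\<Pi>\<^sub>M i\<in>{..<n}. \<nu>)"
    using assms by (simp add: estimator_def)
  have [measurable]: "(\<lambda>x. \<phi> (x j)) \<in> borel_measurable (\<Pi>\<^sub>M i\<in>{..<n}. \<nu>)" if "j < n" for j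
    using that by (intro measurable_coordinate \<phi>_meas) simp
  show ?thesis unfolding remainder_def[abs_def] by measurable
qed

lemma error_eq: "error S n \<omega> = remainder S n (observed n \<omega>) + (\<Sum>j<n. \<psi> (\<omega> j)) / sqrt (real n)"
proof -
  have "\<psi> z = mean_u Q u + \<phi> (fst z) - U z" for z
    by (simp add: \<psi>_def phi_star_def h_def)
  then have "(\<Sum>j<n. \<psi> (\<omega> j)) = real n * mean_u Q u + (\<Sum>j<n. \<phi> (fst (\<omega> j))) - util_sum u n \<omega>"
    by (simp add: util_sum_def sum.distrib sum_subtractf)
  moreover have "(\<Sum>j<n. \<phi> (observed n \<omega> j)) = (\<Sum>j<n. \<phi> (fst (\<omega> j)))"
    by (intro sum.cong) (auto simp: observed_def)
  ultimately show ?thesis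
    by (simp add: error_def remainder_def add_divide_distrib[symmetric])
qed

lemma observed_meas:
  assumes "sets M = sets (\<nu> \<Otimes>\<^sub>M \<Theta>)"
  shows "observed n \<in> measurable (\<Pi>\<^sub>M i\<in>{..<n}. M) (\<Pi>\<^sub>M i\<in>{..<n}. \<nu>)"
proof -
  have "fst \<in> measurable M \<nu>" unfolding measurable_cong_sets[OF assms refl] by simp
  then have "(\<lambda>\<omega>. fst (\<omega> i)) \<in> measurable (\<Pi>\<^sub>M i\<in>{..<n}. M) \<nu>" if "i \<in> {..<n}" for i
    by (rule measurable_coordinate[OF that])
  then show ?thesis
    unfolding observed_def[abs_def] by (rule measurable_restrict)
qed

lemma error_meas:
  assumes S: "estimator \<nu> S" and M: "sets M = sets (\<nu> \<Otimes>\<^sub>M \<Theta>)"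
  shows "error S n \<in> borel_measurable (\<Pi>\<^sub>M i\<in>{..<n}. M)"
proof -
  have [measurable]: "(\<lambda>\<omega>. S n (observed n \<omega>)) \<in> borel_measurable (\<Pi>\<^sub>M i\<in>{..<n}. M)"
    using S by (intro measurable_compose[OF observed_meas[OF M]]) (simp add: estimator_def)
  have "U \<in> borel_measurable M"
    unfolding measurable_cong_sets[OF M refl] using u_meas by (simp add: split_def)
  then have [measurable]: "(\<lambda>\<omega>. U (\<omega> j)) \<in> borel_measurable (\<Pi>\<^sub>M i\<in>{..<n}. M)" if "j < n" for j
    using that by (intro measurable_coordinate) auto
  show ?thesis unfolding error_def[abs_def] util_sum_def by measurable
qed

lemma error_restrict: "error S n (restrict \<omega> {..<n}) = error S n \<omega>"
proof -
  have "observed n (restrict \<omega> {..<n}) = observed n \<omega>"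
    by (auto simp: observed_def fun_eq_iff)
  then show ?thesis by (simp add: error_def util_sum_def)
qed

lemma distr_iid_restrict:
  assumes "prob_space M"
  shows "distr (iid_law M) (\<Pi>\<^sub>M i\<in>{..<n}. M) (\<lambda>\<omega>. restrict \<omega> {..<n::nat}) = (\<Pi>\<^sub>M i\<in>{..<n}. M)"
proof -
  interpret M: prob_space M by fact
  interpret product_prob_space "\<lambda>_::nat. M" UNIV ..
  show ?thesis unfolding iid_law_def by (rule distr_PiM_restrict_finite) auto
qed

lemma restrict_meas: "(\<lambda>\<omega>. restrict \<omega> {..<n::nat}) \<in> measurable (iid_law M) (\<Pi>\<^sub>M i\<in>{..<n}. M)"
  unfolding iid_law_def by (rule measurable_restrict_subset) simp

text \<open>The error looks at the first n coordinates only, so the infinite product can be traded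
  for the finite one, on which densities exist.\<close>

lemma distr_error:
  assumes S: "estimator \<nu> S" and p: "\<tau>' \<in> T"
  shows "distr (iid_law (P \<tau>')) borel (error S n) = distr (\<Pi>\<^sub>M i\<in>{..<n}. P \<tau>') borel (error S n)"
proof -
  have "distr (\<Pi>\<^sub>M i\<in>{..<n}. P \<tau>') borel (error S n)
    = distr (distr (iid_law (P \<tau>')) (\<Pi>\<^sub>M i\<in>{..<n}. P \<tau>') (\<lambda>\<omega>. restrict \<omega> {..<n})) borel (error S n)"
    by (simp add: distr_iid_restrict[OF prob_P[OF p]])
  also have "\<dots> = distr (iid_law (P \<tau>')) borel (error S n \<circ> (\<lambda>\<omega>. restrict \<omega> {..<n}))"
    by (rule distr_distr[OF error_meas[OF S sets_P[OF p]] restrict_meas])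
  also have "error S n \<circ> (\<lambda>\<omega>. restrict \<omega> {..<n}) = error S n"
    by (simp add: fun_eq_iff error_restrict)
  finally show ?thesis ..
qed

abbreviation law :: "(nat \<Rightarrow> (nat \<Rightarrow> 'x) \<Rightarrow> real) \<Rightarrow> real^'k \<Rightarrow> nat \<Rightarrow> real measure" where
  "law S a n \<equiv> distr (iid_law (P (path a n))) borel (error S n)"

lemma real_distribution_law:
  assumes S: "estimator \<nu> S" and p: "path a n \<in> T"
  shows "real_distribution (law S a n)"
proof -
  have "prob_space (\<Pi>\<^sub>M i\<in>{..<n}. P (path a n))"
    by (rule prob_space.prob_space_PiM_const[OF prob_P[OF p]])
  then show ?thesis
    unfolding distr_error[OF S p]
    by (rule prob_space.real_distribution_distr) (rule error_meas[OF S sets_P[OF p]])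
qed

lemma tilt_scale: "tilt t (of_real r) n p z = tilt t 1 n p (r * z)"
  by (simp add: tilt_def)

abbreviation tilted :: "real \<Rightarrow> real^'k \<Rightarrow> nat \<Rightarrow> (nat \<Rightarrow> 'x \<times> 't) \<Rightarrow> complex" where
  "tilted t a n \<omega> \<equiv> (\<Prod>j<n. tilt t 1 n (\<psi> (\<omega> j)) (a \<bullet> s (snd (\<omega> j))))"

text \<open>Under \<open>Q\<close>, weighted by the surrogate ratio, the exponential of the error
  splits into a function of the observations and a product over coordinates; the weight merges with
  the latter into tilts.\<close>

lemma char_law:
  assumes S: "estimator \<nu> S"
  shows "(\<lambda>n. char (law S a n) t - (\<integral>\<omega>. iexp (t * remainder S n (observed n \<omega>)) * tilted t a n \<omega> \<partial>Qn n)) \<longlonglongrightarrow> 0"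
proof -
  have meas: "(\<lambda>\<omega>. iexp (t * error S n \<omega>)) \<in> borel_measurable (Qn n)" for n
    using error_meas[OF S sets_P[OF tau]] by measurable
  have lim: "(\<lambda>n. (\<integral>\<omega>. iexp (t * error S n \<omega>) \<partial>(\<Pi>\<^sub>M i\<in>{..<n}. P (path a n)))
      - (\<integral>\<omega>. iexp (t * error S n \<omega>) * of_real (\<Prod>j<n. 1 + (a \<bullet> s (snd (\<omega> j))) / sqrt n) \<partial>Qn n)) \<longlonglongrightarrow> 0"
    by (rule alternatives[OF meas]) simp
  have prod: "iexp (t * error S n \<omega>) * of_real (\<Prod>j<n. 1 + (a \<bullet> s (snd (\<omega> j))) / sqrt n)
      = iexp (t * remainder S n (observed n \<omega>)) * tilted t a n \<omega>" for n \<omega>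
  proof -
    have "iexp (t * error S n \<omega>) = iexp (t * remainder S n (observed n \<omega>)) * exp (\<Sum>j<n. \<i> * of_real (t * \<psi> (\<omega> j) / sqrt n))"
      unfolding error_eq exp_add[symmetric]
      by (intro arg_cong[where f=exp]) (simp add: algebra_simps sum_distrib_left sum_divide_distrib)
    also have "exp (\<Sum>j<n. \<i> * of_real (t * \<psi> (\<omega> j) / sqrt n)) = (\<Prod>j<n. iexp (t * \<psi> (\<omega> j) / sqrt n))"
      by (rule exp_sum) simp
    finally show ?thesis
      by (simp add: tilt_def prod.distrib mult.assoc)
  qed
  have "\<forall>\<^sub>F n in sequentially. (\<integral>\<omega>. iexp (t * error S n \<omega>) \<partial>(\<Pi>\<^sub>M i\<in>{..<n}. P (path a n)))
      - (\<integral>\<omega>. iexp (t * error S n \<omega>) * of_real (\<Prod>j<n. 1 + (a \<bullet> s (snd (\<omega> j))) / sqrt n) \<partial>Qn n)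
     = char (law S a n) t - (\<integral>\<omega>. iexp (t * remainder S n (observed n \<omega>)) * tilted t a n \<omega> \<partial>Qn n)"
    using eventually_path[of a]
  proof eventually_elim
    case (elim n)
    have "char (law S a n) t = (\<integral>\<omega>. iexp (t * error S n \<omega>) \<partial>(\<Pi>\<^sub>M i\<in>{..<n}. P (path a n)))"
      unfolding char_def distr_error[OF S elim] by (rule integral_distr[OF error_meas[OF S sets_P[OF elim]]]) simp
    then show ?case unfolding prod by simp
  qed
  with lim show ?thesis by (rule Lim_transform_eventually)
qed

lemma char_law_iff:
  assumes "estimator \<nu> S"
  shows "(\<lambda>n. char (law S a n) t) \<longlonglongrightarrow> c \<longleftrightarrow>
    (\<lambda>n. \<integral>\<omega>. iexp (t * remainder S n (observed n \<omega>)) * tilted t a n \<omega> \<partial>Qn n) \<longlonglongrightarrow> c"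
  using Lim_transform[OF _ char_law[OF assms, of a t]] Lim_transform2[OF _ char_law[OF assms, of a t]] by blast

text \<open>Levy's theorem wants probability laws at every index, while finitely many path points
  may lie outside \<open>T\<close>; hence the shift by \<open>N\<close>.\<close>

lemma weak_conv_law_iff:
  assumes S: "estimator \<nu> S" and L: "real_distribution L"
  shows "weak_conv_m (law S a) L \<longleftrightarrow> (\<forall>t. (\<lambda>n. char (law S a n) t) \<longlonglongrightarrow> char L t)"
proof -
  obtain N where N: "\<And>n. n \<ge> N \<Longrightarrow> path a n \<in> T"
    using eventually_path[of a] unfolding eventually_sequentially by blast
  have rd: "real_distribution (law S a (n + N))" for n
    by (intro real_distribution_law S N) simp
  have shift: "(\<lambda>n. f (n + N)) \<longlonglongrightarrow> c \<longleftrightarrow> f \<longlonglongrightarrow> c" for f :: "nat \<Rightarrow> 'c::topological_space" and c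
    using LIMSEQ_offset[of f N c] LIMSEQ_ignore_initial_segment[of f c N] by blast
  have "weak_conv_m (law S a) L \<longleftrightarrow> weak_conv_m (\<lambda>n. law S a (n + N)) L"
    unfolding weak_conv_m_def weak_conv_def using shift[of "\<lambda>n. cdf (law S a n) _"] by simp
  also have "\<dots> \<longleftrightarrow> (\<forall>t. (\<lambda>n. char (law S a (n + N)) t) \<longlonglongrightarrow> char L t)"
    using levy_continuity1[where M="\<lambda>n. law S a (n + N)", OF rd L]
      levy_continuity[where M="\<lambda>n. law S a (n + N)", OF rd L] by blast
  also have "\<dots> \<longleftrightarrow> (\<forall>t. (\<lambda>n. char (law S a n) t) \<longlonglongrightarrow> char L t)"
    using shift[of "\<lambda>n. char (law S a n) _"] by simp
  finally show ?thesis .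
qed

lemma regular_iff:
  "regular_with_limit \<nu> P u \<tau> S L \<longleftrightarrow>
    estimator \<nu> S \<and> real_distribution L \<and> (\<forall>a. weak_conv_m (law S a) L)"
  unfolding regular_with_limit_def error_def[abs_def] ..

section \<open>Limits of the remainder, the variance bound and its attainment\<close>

definition remainder_law :: "(nat \<Rightarrow> (nat \<Rightarrow> 'x) \<Rightarrow> real) \<Rightarrow> nat \<Rightarrow> real measure" where
  "remainder_law S n = distr (Qn n) borel (\<lambda>\<omega>. remainder S n (observed n \<omega>))"

lemma remainder_observed_meas:
  assumes "estimator \<nu> S"
  shows "(\<lambda>\<omega>. remainder S n (observed n \<omega>)) \<in> borel_measurable (Qn n)"
  by (rule measurable_compose[OF observed_meas[OF sets_P[OF tau]] remainder_meas[OF assms]])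

lemma real_distribution_remainder:
  assumes "estimator \<nu> S"
  shows "real_distribution (remainder_law S n)"
  unfolding remainder_law_def
  by (rule prob_space.real_distribution_distr[OF prob_Qn remainder_observed_meas[OF assms]])

lemma char_remainder:
  assumes "estimator \<nu> S"
  shows "char (remainder_law S n) t = (\<integral>\<omega>. iexp (t * remainder S n (observed n \<omega>)) \<partial>Qn n)"
  unfolding char_def remainder_law_def by (rule integral_distr[OF remainder_observed_meas[OF assms]]) simp

theorem convolution:
  assumes reg: "regular_with_limit \<nu> P u \<tau> S L"
  shows "(\<lambda>n. char (remainder_law S n) t) \<longlonglongrightarrow> char L t * exp (of_real (\<sigma>2 * t\<^sup>2 / 2))"
proof -
  have S: "estimator \<nu> S" and L: "real_distribution L" and w: "\<And>a. weak_conv_m (law S a) L"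
    using reg unfolding regular_iff by auto
  have obs: "observed n \<omega> = (\<lambda>j\<in>{..<n}. fst (\<omega> j))" for n and \<omega> :: "nat \<Rightarrow> 'x \<times> 't"
    by (simp add: observed_def)
  have "(\<lambda>n. \<integral>\<omega>. iexp (t * remainder S n (\<lambda>j\<in>{..<n}. fst (\<omega> j))) \<partial>Qn n)
    \<longlonglongrightarrow> char L t * exp (of_real (t\<^sup>2 * \<sigma>2 / 2))"
  proof (rule Q.convolution_limit[OF fst_meas \<psi>_meas inner_s_Q \<psi>_L2 inner_s_Q_L2 \<psi>_mean inner_s_Q_mean \<psi>_orth])
    show "(\<integral>z. F (fst z) * of_real (\<psi> z) \<partial>Q) = (\<integral>z. F (fst z) * of_real (h \<bullet> s (snd z)) \<partial>Q)"
      if "F \<in> borel_measurable \<nu>" "\<And>x. norm (F x) \<le> 1" for F :: "'x \<Rightarrow> complex"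
      using that by (rule \<psi>_cond)
    show "remainder S n \<in> borel_measurable (\<Pi>\<^sub>M i\<in>{..<n}. \<nu>)" for n
      by (rule remainder_meas[OF S])
    \<comment> \<open>Regularity is used along the multiples of h; \<open>tilt_scale\<close> moves
      the factor r from the direction into the tilt parameter, where it may become complex.\<close>
    show "(\<lambda>n. \<integral>\<omega>. iexp (t * remainder S n (\<lambda>j\<in>{..<n}. fst (\<omega> j)))
        * (\<Prod>j<n. tilt t (of_real r) n (\<psi> (\<omega> j)) (h \<bullet> s (snd (\<omega> j)))) \<partial>Qn n) \<longlonglongrightarrow> char L t" for r
      using w[of "r *\<^sub>R h"] unfolding weak_conv_law_iff[OF S L] char_law_iff[OF S] obs
      by (simp add: tilt_scale)
  qed
  then show ?thesis
    unfolding char_remainder[OF S] obs by (simp add: mult.commute)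
qed

text \<open>The limit of characteristic functions has modulus at most 1, so \<open>char L\<close> is
  dominated by the Gaussian one, and \<open>ext_variance_ge\<close> applies.\<close>

lemma regular_variance:
  assumes reg: "regular_with_limit \<nu> P u \<tau> S L"
  shows "ennreal \<sigma>2 \<le> ext_variance L"
proof (rule ext_variance_ge)
  have S: "estimator \<nu> S" using reg unfolding regular_iff by auto
  show "real_distribution L" using reg unfolding regular_iff by auto
  show "cmod (char L t) \<le> exp (- (\<sigma>2 * t\<^sup>2 / 2))" for t
  proof -
    have "cmod (char L t * exp (of_real (\<sigma>2 * t\<^sup>2 / 2))) \<le> 1"
    proof (rule LIMSEQ_le_const2[OF tendsto_norm[OF convolution[OF reg, of t]]])
      show "\<exists>N. \<forall>n\<ge>N. cmod (char (remainder_law S n) t) \<le> 1"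
        using real_distribution.cmod_char_le_1[OF real_distribution_remainder[OF S]] by blast
    qed
    then show ?thesis
      by (simp add: norm_mult exp_of_real exp_minus field_simps)
  qed
qed simp

lemma tilted_limit: "(\<lambda>n. \<integral>\<omega>. tilted t a n \<omega> \<partial>Qn n) \<longlonglongrightarrow> of_real (exp (- (\<sigma>2 * t\<^sup>2 / 2)))"
proof -
  note tm = Q.tilt_mean[OF \<psi>_meas inner_s_Q \<psi>_L2 inner_s_Q_L2 \<psi>_mean inner_s_Q_mean \<psi>_orth, of t 1]
  have "(\<integral>\<omega>. tilted t a n \<omega> \<partial>Qn n) = (1 + (\<integral>z. tilt_rest t 1 n (\<psi> z) (a \<bullet> s (snd z)) \<partial>Q)) ^ n" for n
    using Q.PiM_integral_prod[OF _ Q.tilt_integrable(1)[OF \<psi>_meas inner_s_Q \<psi>_L2 inner_s_Q_L2], of "{..<n}" t 1 n]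
    by (simp add: tm(2))
  moreover have "(\<lambda>n. (1 + (\<integral>z. tilt_rest t 1 n (\<psi> z) (a \<bullet> s (snd z)) \<partial>Q)) ^ n) \<longlonglongrightarrow> exp (of_real (- (t\<^sup>2 * \<sigma>2 / 2)))"
    using tm(1) by (intro power_tendsto_exp) simp
  ultimately show ?thesis by (simp add: exp_of_real[symmetric] mult.commute)
qed

lemma tilted_norm:
  shows "(cmod (tilted t a n \<omega>))\<^sup>2 = (\<Prod>j<n. (1 + (a \<bullet> s (snd (\<omega> j))) / sqrt n)\<^sup>2)"
proof -
  have "cmod (tilt t 1 n p z) = \<bar>1 + z / sqrt n\<bar>" for p z
  proof -
    have "tilt t 1 n p z = iexp (t * p / sqrt n) * of_real (1 + z / sqrt n)"
      by (simp add: tilt_def)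
    then show ?thesis by (simp only: norm_mult norm_exp_i_times norm_of_real mult_1_left)
  qed
  then show ?thesis
    by (simp add: prod_norm[symmetric] prod_power_distrib)
qed

text \<open>The exponential has modulus 1, and mean 0 of the score leaves (1 + k/n)^n, below exp k
  for every n.\<close>

lemma tilted_L2:
  shows "integrable (Qn n) (\<lambda>\<omega>. (cmod (tilted t a n \<omega>))\<^sup>2)"
    and "(\<integral>\<omega>. (cmod (tilted t a n \<omega>))\<^sup>2 \<partial>Qn n) \<le> exp (\<integral>z. (a \<bullet> s (snd z))\<^sup>2 \<partial>Q)"
proof -
  have s1: "integrable Q (\<lambda>z. a \<bullet> s (snd z))"
    by (rule Q.square_integrable_imp_integrable) (simp_all add: inner_s_Q_L2)
  have sq: "(1 + v / sqrt n)\<^sup>2 = 1 + 2 / sqrt n * v + (1 / sqrt n)\<^sup>2 * v\<^sup>2" for v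
    by (simp add: power2_sum power_divide)
  have i: "integrable Q (\<lambda>z. (1 + (a \<bullet> s (snd z)) / sqrt n)\<^sup>2)"
    unfolding sq using s1 inner_s_Q_L2 by simp
  show "integrable (Qn n) (\<lambda>\<omega>. (cmod (tilted t a n \<omega>))\<^sup>2)"
    unfolding tilted_norm by (rule Q.PiM_integrable_prod[OF _ i]) simp
  let ?k = "\<integral>z. (a \<bullet> s (snd z))\<^sup>2 \<partial>Q"
  have "(\<integral>\<omega>. (cmod (tilted t a n \<omega>))\<^sup>2 \<partial>Qn n) = (\<integral>z. (1 + (a \<bullet> s (snd z)) / sqrt n)\<^sup>2 \<partial>Q) ^ n"
    unfolding tilted_norm using Q.PiM_integral_prod[OF _ i, of "{..<n}"] by simp
  also have "(\<integral>z. (1 + (a \<bullet> s (snd z)) / sqrt n)\<^sup>2 \<partial>Q) = 1 + ?k / n"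
    unfolding sq using s1 inner_s_Q_L2 inner_s_Q_mean by (simp add: Q.prob_space power_divide)
  also have "(1 + ?k / n) ^ n \<le> exp ?k"
  proof (cases "n = 0")
    case False
    have "(1 + ?k / n) ^ n \<le> exp (?k / n) ^ n"
      by (intro power_mono exp_ge_add_one_self) (simp add: add_nonneg_nonneg)
    also have "\<dots> = exp ?k" using False by (simp add: exp_of_nat_mult[symmetric])
    finally show ?thesis .
  qed simp
  finally show "(\<integral>\<omega>. (cmod (tilted t a n \<omega>))\<^sup>2 \<partial>Qn n) \<le> exp ?k" .
qed

lemma tilted_integrable: "integrable (Qn n) (tilted t a n)"
  by (rule Q.PiM_integrable_prod[OF _ Q.tilt_integrable(1)[OF \<psi>_meas inner_s_Q \<psi>_L2 inner_s_Q_L2]]) simp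

text \<open>Replacing exp(itR) by 1 costs at most its L2 distance from 1 times the L2 norm of the
  tilted product. Negligibility under P_\<tau> thus controls all local alternatives, the task
  usually given to contiguity.\<close>

theorem negligible_remainder_imp_regular:
  assumes S: "estimator \<nu> S"
    and small: "\<And>\<epsilon>. 0 < \<epsilon> \<Longrightarrow> (\<lambda>n. measure (Qn n) {\<omega>\<in>space (Qn n). \<epsilon> < \<bar>remainder S n (observed n \<omega>)\<bar>}) \<longlonglongrightarrow> 0"
  shows "regular_with_limit \<nu> P u \<tau> S (normal_law \<sigma>2)"
  unfolding regular_iff
proof (intro conjI allI)
  have v: "0 \<le> \<sigma>2" by simp
  show L: "real_distribution (normal_law \<sigma>2)" by (rule normal_law[OF v])
  show "estimator \<nu> S" by (rule S)
  fix a
  show "weak_conv_m (law S a) (normal_law \<sigma>2)"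
    unfolding weak_conv_law_iff[OF S L] char_law_iff[OF S]
  proof
    fix t
    let ?e = "\<lambda>n \<omega>. iexp (t * remainder S n (observed n \<omega>)) - 1"
    note Rm = remainder_observed_meas[OF S]
    have em: "(\<lambda>\<omega>. ?e n \<omega>) \<in> borel_measurable (Qn n)" for n
      using Rm by measurable
    have e_sq: "(\<lambda>n. \<integral>\<omega>. (cmod (?e n \<omega>))\<^sup>2 \<partial>Qn n) \<longlonglongrightarrow> 0"
      by (rule measure_tendsto_0_imp_iexp[OF prob_Qn Rm small])
    have tm: "tilted t a n \<in> borel_measurable (Qn n)" for n
      using tilted_integrable by auto
    have e_int: "integrable (Qn n) (\<lambda>\<omega>. (cmod (?e n \<omega>))\<^sup>2)" for n
    proof -
      interpret P: prob_space "Qn n" by (rule prob_Qn)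
      have "(cmod (iexp y - 1))\<^sup>2 \<le> 4" for y :: real
        using power_mono[OF norm_iexp_diff_le(2)[of y], of 2] by simp
      then show ?thesis
        using em by (intro P.integrable_const_bound[where B=4] AE_I2) (auto simp del: of_real_mult)
    qed
    have et_int: "integrable (Qn n) (\<lambda>\<omega>. ?e n \<omega> * tilted t a n \<omega>)" for n
    proof (rule Bochner_Integration.integrable_bound[OF integrable_mult_L2])
      show "integrable (Qn n) (\<lambda>\<omega>. (cmod (?e n \<omega>))\<^sup>2)" "integrable (Qn n) (\<lambda>\<omega>. (cmod (tilted t a n \<omega>))\<^sup>2)"
        by (rule e_int, rule tilted_L2)
    qed (use em tm in \<open>auto simp: norm_mult\<close>)
    have "(\<lambda>n. \<integral>\<omega>. ?e n \<omega> * tilted t a n \<omega> \<partial>Qn n) \<longlonglongrightarrow> 0"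
    proof (rule Lim_null_comparison)
      let ?k = "\<integral>z. (a \<bullet> s (snd z))\<^sup>2 \<partial>Q"
      show "\<forall>\<^sub>F n in sequentially. norm (\<integral>\<omega>. ?e n \<omega> * tilted t a n \<omega> \<partial>Qn n)
        \<le> sqrt (\<integral>\<omega>. (cmod (?e n \<omega>))\<^sup>2 \<partial>Qn n) * sqrt (exp ?k)"
      proof (intro always_eventually allI)
        fix n
        have "norm (\<integral>\<omega>. ?e n \<omega> * tilted t a n \<omega> \<partial>Qn n) \<le> (\<integral>\<omega>. norm (?e n \<omega> * tilted t a n \<omega>) \<partial>Qn n)"
          by (rule integral_norm_bound)
        also have "\<dots> = (\<integral>\<omega>. \<bar>cmod (?e n \<omega>) * cmod (tilted t a n \<omega>)\<bar> \<partial>Qn n)"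
          by (simp add: norm_mult)
        also have "\<dots> \<le> sqrt (\<integral>\<omega>. (cmod (?e n \<omega>))\<^sup>2 \<partial>Qn n) * sqrt (\<integral>\<omega>. (cmod (tilted t a n \<omega>))\<^sup>2 \<partial>Qn n)"
          by (rule integral_Cauchy_Schwarz[OF measurable_compose[OF em borel_measurable_norm] measurable_compose[OF tm borel_measurable_norm] e_int tilted_L2(1)])
        also have "\<dots> \<le> sqrt (\<integral>\<omega>. (cmod (?e n \<omega>))\<^sup>2 \<partial>Qn n) * sqrt (exp ?k)"
          using tilted_L2(2) by (intro mult_left_mono) auto
        finally show "norm (\<integral>\<omega>. ?e n \<omega> * tilted t a n \<omega> \<partial>Qn n)
          \<le> sqrt (\<integral>\<omega>. (cmod (?e n \<omega>))\<^sup>2 \<partial>Qn n) * sqrt (exp ?k)" .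
      qed
      have "(\<lambda>n. sqrt (\<integral>\<omega>. (cmod (?e n \<omega>))\<^sup>2 \<partial>Qn n) * sqrt (exp ?k)) \<longlonglongrightarrow> sqrt 0 * sqrt (exp ?k)"
        by (intro tendsto_mult tendsto_real_sqrt e_sq tendsto_const)
      then show "(\<lambda>n. sqrt (\<integral>\<omega>. (cmod (?e n \<omega>))\<^sup>2 \<partial>Qn n) * sqrt (exp ?k)) \<longlonglongrightarrow> 0"
        by simp
    qed
    from tendsto_add[OF this tilted_limit[of t a]]
    have "(\<lambda>n. (\<integral>\<omega>. ?e n \<omega> * tilted t a n \<omega> \<partial>Qn n) + (\<integral>\<omega>. tilted t a n \<omega> \<partial>Qn n)) \<longlonglongrightarrow> of_real (exp (- (\<sigma>2 * t\<^sup>2 / 2)))"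
      by simp
    moreover have "(\<integral>\<omega>. ?e n \<omega> * tilted t a n \<omega> \<partial>Qn n) + (\<integral>\<omega>. tilted t a n \<omega> \<partial>Qn n)
       = (\<integral>\<omega>. iexp (t * remainder S n (observed n \<omega>)) * tilted t a n \<omega> \<partial>Qn n)" for n
      unfolding Bochner_Integration.integral_add[OF et_int tilted_integrable, symmetric]
      by (simp add: left_diff_distrib)
    ultimately show "(\<lambda>n. \<integral>\<omega>. iexp (t * remainder S n (observed n \<omega>)) * tilted t a n \<omega> \<partial>Qn n) \<longlonglongrightarrow> char (normal_law \<sigma>2) t"
      using normal_law(2)[OF v] by simp
  qed
qed

text \<open>The bound is attained: with \<tau> fixed, \<open>S\<close> may use the unknown \<mu> and
  \<phi>, and its remainder is identically 0.\<close>

lemma variance_bound_eq: "variance_bound \<nu> P u \<tau> = ennreal \<sigma>2"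
proof (rule antisym)
  define S where "S n x = real n * mean_u Q u + (\<Sum>j<n. \<phi> (x j))" for n and x :: "nat \<Rightarrow> 'x"
  have "(\<lambda>x. \<phi> (x j)) \<in> borel_measurable (\<Pi>\<^sub>M i\<in>{..<n}. \<nu>)" if "j < n" for j n
    using that by (intro measurable_coordinate \<phi>_meas) simp
  then have S: "estimator \<nu> S"
    unfolding estimator_def S_def[abs_def] by (intro allI borel_measurable_add borel_measurable_sum) auto
  have "remainder S n x = 0" for n x by (simp add: remainder_def S_def)
  then have "regular_with_limit \<nu> P u \<tau> S (normal_law \<sigma>2)"
    by (intro negligible_remainder_imp_regular S) simp
  then have "variance_bound \<nu> P u \<tau> \<le> ext_variance (normal_law \<sigma>2)"
    unfolding variance_bound_def by (intro INF_lower) auto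
  also have "\<dots> = ennreal \<sigma>2" by (rule normal_law) simp
  finally show "variance_bound \<nu> P u \<tau> \<le> ennreal \<sigma>2" .
  show "ennreal \<sigma>2 \<le> variance_bound \<nu> P u \<tau>"
    unfolding variance_bound_def using regular_variance by (intro INF_greatest) auto
qed

lemma measure_remainder_law:
  assumes S: "estimator \<nu> S"
  shows "measure (remainder_law S n) {x. \<epsilon> < \<bar>x\<bar>} = measure (Qn n) {\<omega>\<in>space (Qn n). \<epsilon> < \<bar>remainder S n (observed n \<omega>)\<bar>}"
  unfolding remainder_law_def
  by (subst measure_distr[OF remainder_observed_meas[OF S]]) (auto intro!: arg_cong[where f="measure (Qn n)"])

lemma small_o_prob_iff:
  assumes S: "estimator \<nu> S"
  shows "small_o_prob (iid_law Q)
      (\<lambda>n \<omega>. S n (observed n \<omega>) / real n - (mean_u Q u + (1 / real n) * (\<Sum>j<n. \<phi> (fst (\<omega> j)))))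
      (\<lambda>n. 1 / sqrt (real n))
    \<longleftrightarrow> (\<forall>\<epsilon>>0. (\<lambda>n. measure (Qn n) {\<omega>\<in>space (Qn n). \<epsilon> < \<bar>remainder S n (observed n \<omega>)\<bar>}) \<longlonglongrightarrow> 0)"
proof -
  let ?D = "\<lambda>n \<omega>. S n (observed n \<omega>) / real n - (mean_u Q u + (1 / real n) * (\<Sum>j<n. \<phi> (fst (\<omega> j))))"
  have eq: "measure (iid_law Q) {\<omega> \<in> space (iid_law Q). \<bar>?D n \<omega>\<bar> > \<epsilon> * (1 / sqrt (real n))}
      = measure (Qn n) {\<omega>\<in>space (Qn n). \<epsilon> < \<bar>remainder S n (observed n \<omega>)\<bar>}" if n: "0 < n" for n \<epsilon>
  proof -
    have obs: "(\<Sum>j<n. \<phi> (observed n \<omega> j)) = (\<Sum>j<n. \<phi> (fst (\<omega> j)))" for \<omega> :: "nat \<Rightarrow> 'x \<times> 't"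
      by (intro sum.cong) (auto simp: observed_def)
    have D: "\<bar>?D n \<omega>\<bar> > \<epsilon> * (1 / sqrt (real n)) \<longleftrightarrow> \<epsilon> < \<bar>remainder S n (observed n \<omega>)\<bar>" for \<omega> :: "nat \<Rightarrow> 'x \<times> 't"
    proof -
      define q where "q = sqrt (real n)"
      have q: "q > 0" "real n = q * q" using n by (auto simp: q_def)
      have D_eq: "?D n \<omega> = remainder S n (observed n \<omega>) / q"
        unfolding remainder_def obs q_def[symmetric] q(2) using q(1) by (simp add: field_simps)
      show ?thesis unfolding D_eq unfolding q_def[symmetric] using q(1) by (simp add: field_simps)
    qed
    have restr: "observed n (restrict \<omega> {..<n}) = observed n \<omega>" for \<omega> :: "nat \<Rightarrow> 'x \<times> 't"
      by (auto simp: observed_def fun_eq_iff)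
    let ?E = "{\<omega>\<in>space (Qn n). \<epsilon> < \<bar>remainder S n (observed n \<omega>)\<bar>}"
    have E: "?E \<in> sets (Qn n)"
      using remainder_observed_meas[OF S, of n] by measurable
    have "measure (Qn n) ?E = measure (distr (iid_law Q) (Qn n) (\<lambda>\<omega>. restrict \<omega> {..<n})) ?E"
      by (simp add: distr_iid_restrict[OF prob_P[OF tau]])
    also have "\<dots> = measure (iid_law Q) ((\<lambda>\<omega>. restrict \<omega> {..<n}) -` ?E \<inter> space (iid_law Q))"
      by (rule measure_distr[OF restrict_meas E])
    also have "(\<lambda>\<omega>. restrict \<omega> {..<n}) -` ?E \<inter> space (iid_law Q) = {\<omega> \<in> space (iid_law Q). \<bar>?D n \<omega>\<bar> > \<epsilon> * (1 / sqrt (real n))}"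
      unfolding D using measurable_space[OF restrict_meas[of n Q]] by (auto simp: restr)
    finally show ?thesis ..
  qed
  have "(\<lambda>n. measure (iid_law Q) {\<omega> \<in> space (iid_law Q). \<bar>?D n \<omega>\<bar> > \<epsilon> * (1 / sqrt (real n))}) \<longlonglongrightarrow> 0
    \<longleftrightarrow> (\<lambda>n. measure (Qn n) {\<omega>\<in>space (Qn n). \<epsilon> < \<bar>remainder S n (observed n \<omega>)\<bar>}) \<longlonglongrightarrow> 0" for \<epsilon>
    \<comment> \<open>The index 0, where division by zero makes the normalisations meaningless, is
      discarded.\<close>
    by (rule tendsto_cong) (rule eventually_mono[OF eventually_gt_at_top[of "0::nat"] eq])
  then show ?thesis unfolding small_o_prob_def by simp
qed

text \<open>Forwards, the second moment of the limit equals \<sigma>2, the exact value for which the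
  factor of the remainder is trivial. Backwards, the normal limit is centred, so its second moment
  is its variance.\<close>

theorem efficient_iff:
  assumes S: "estimator \<nu> S"
  shows "asymptotically_efficient \<nu> P u \<tau> S \<longleftrightarrow>
    (\<forall>\<epsilon>>0. (\<lambda>n. measure (Qn n) {\<omega>\<in>space (Qn n). \<epsilon> < \<bar>remainder S n (observed n \<omega>)\<bar>}) \<longlonglongrightarrow> 0)"
proof
  assume "asymptotically_efficient \<nu> P u \<tau> S"
  then obtain L where reg: "regular_with_limit \<nu> P u \<tau> S L" and m2: "(\<integral>\<^sup>+x. ennreal (x\<^sup>2) \<partial>L) = ennreal \<sigma>2"
    unfolding asymptotically_efficient_def variance_bound_eq by blast
  have L: "real_distribution L" using reg unfolding regular_iff by simp
  have "(\<lambda>n. char (remainder_law S n) t) \<longlonglongrightarrow> 1" for t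
    by (rule char_factor_trivial[OF real_distribution_remainder[OF S] L convolution[OF reg] _ m2]) simp
  from char_tendsto_1_imp_measure[OF real_distribution_remainder[OF S] this]
  show "\<forall>\<epsilon>>0. (\<lambda>n. measure (Qn n) {\<omega>\<in>space (Qn n). \<epsilon> < \<bar>remainder S n (observed n \<omega>)\<bar>}) \<longlonglongrightarrow> 0"
    by (simp only: measure_remainder_law[OF S]) blast
next
  assume "\<forall>\<epsilon>>0. (\<lambda>n. measure (Qn n) {\<omega>\<in>space (Qn n). \<epsilon> < \<bar>remainder S n (observed n \<omega>)\<bar>}) \<longlonglongrightarrow> 0"
  then have "regular_with_limit \<nu> P u \<tau> S (normal_law \<sigma>2)"
    by (intro negligible_remainder_imp_regular S) blast
  moreover have "(\<integral>\<^sup>+x. ennreal (x\<^sup>2) \<partial>normal_law \<sigma>2) = variance_bound \<nu> P u \<tau>"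
    unfolding variance_bound_eq by (rule normal_law) simp
  ultimately show "asymptotically_efficient \<nu> P u \<tau> S"
    unfolding asymptotically_efficient_def by blast
qed

end

theorem theorem2p1:
  fixes \<nu> :: "'x measure" and f :: "'x \<Rightarrow> 't \<Rightarrow> real" and \<Theta> :: "'t measure"
    and T :: "(real^'k) set" and G :: "real^'k \<Rightarrow> 't measure"
    and u :: "'x \<Rightarrow> 't \<Rightarrow> real"
    and P :: "real^'k \<Rightarrow> ('x \<times> 't) measure"
    and \<rho>' :: "real^'k \<Rightarrow> 't \<Rightarrow> real^'k"
  assumes "open T"
    and "mixture_model \<nu> f \<Theta> T G"
    and "(\<lambda>(x, t). u x t) \<in> borel_measurable (\<nu> \<Otimes>\<^sub>M \<Theta>)"
    and "\<And>\<tau>. P \<tau> = joint_law \<nu> f (G \<tau>)"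
    and "\<And>\<tau>. \<tau> \<in> T \<Longrightarrow> score_at \<Theta> G \<tau> (\<rho>' \<tau>)"
    and "\<And>\<tau>. \<tau> \<in> T \<Longrightarrow> \<exists>r>0. \<exists>B::real. \<forall>\<tau>'\<in>T \<inter> ball \<tau> r.
           (\<integral>\<^sup>+ z. ennreal ((u (fst z) (snd z))\<^sup>2) \<partial>P \<tau>') \<le> ennreal B"
    and "\<And>\<tau>. \<tau> \<in> T \<Longrightarrow> rank (fisher_info \<nu> (P \<tau>) (\<rho>' \<tau>)) = CARD('k)"
  shows "\<forall>\<tau>\<in>T.
      gamma_vec \<nu> (P \<tau>) u (\<rho>' \<tau>) =
        (\<chi> i. \<integral>z. u (fst z) (snd z) * \<rho>' \<tau> (snd z) $ i
                 - u_bar \<nu> (P \<tau>) u (fst z) * score_X \<nu> (P \<tau>) (\<rho>' \<tau>) (fst z) $ i \<partial>P \<tau>) \<and>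
      (\<forall>S. estimator \<nu> S \<longrightarrow>
        (asymptotically_efficient \<nu> P u \<tau> S \<longleftrightarrow>
         small_o_prob (iid_law (P \<tau>))
           (\<lambda>n \<omega>. S n (observed n \<omega>) / real n -
              (mean_u (P \<tau>) u +
               (1 / real n) * (\<Sum>j<n. phi_star \<nu> (P \<tau>) u (\<rho>' \<tau>) (fst (\<omega> j)))))
           (\<lambda>n. 1 / sqrt (real n))))"
proof
  fix \<tau> assume tau: "\<tau> \<in> T"
  have P: "P = (\<lambda>\<tau>'. joint_law \<nu> f (G \<tau>'))"
    using assms(4) by auto
  obtain r B where "r > 0"
    and B: "\<And>\<tau>'. \<tau>' \<in> T \<inter> ball \<tau> r \<Longrightarrow> (\<integral>\<^sup>+ z. ennreal ((u (fst z) (snd z))\<^sup>2) \<partial>P \<tau>') \<le> ennreal B"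
    using assms(6)[OF tau] by blast
  then have "(\<integral>\<^sup>+ z. ennreal ((u (fst z) (snd z))\<^sup>2) \<partial>joint_law \<nu> f (G \<tau>)) \<le> ennreal B"
    using tau unfolding P by simp
  then have u2: "(\<integral>\<^sup>+ z. ennreal ((u (fst z) (snd z))\<^sup>2) \<partial>joint_law \<nu> f (G \<tau>)) < \<infinity>"
    by (rule order.strict_trans1) simp
  interpret M: local_mixture \<nu> f \<Theta> T G u \<tau> "\<rho>' \<tau>"
    by unfold_locales (use assms(1-3,5,7) tau u2 in \<open>simp_all add: P\<close>)
  show "gamma_vec \<nu> (P \<tau>) u (\<rho>' \<tau>) =
        (\<chi> i. \<integral>z. u (fst z) (snd z) * \<rho>' \<tau> (snd z) $ i
                 - u_bar \<nu> (P \<tau>) u (fst z) * score_X \<nu> (P \<tau>) (\<rho>' \<tau>) (fst z) $ i \<partial>P \<tau>) \<and>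
      (\<forall>S. estimator \<nu> S \<longrightarrow>
        (asymptotically_efficient \<nu> P u \<tau> S \<longleftrightarrow>
         small_o_prob (iid_law (P \<tau>))
           (\<lambda>n \<omega>. S n (observed n \<omega>) / real n -
              (mean_u (P \<tau>) u +
               (1 / real n) * (\<Sum>j<n. phi_star \<nu> (P \<tau>) u (\<rho>' \<tau>) (fst (\<omega> j)))))
           (\<lambda>n. 1 / sqrt (real n))))"
    unfolding P vec_eq_iff using M.gamma_nth M.efficient_iff M.small_o_prob_iff by simp
qed

end
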